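(* Let $B$ be a ring, $\rho$ an automorphism of $B$, $m$ the order of $\rho$ (with $m\ge 2$), and let $f=X^m+X^{m-1}a_{m-1}+\cdots+Xa_1+a_0$ be in $B[X;\rho]_{(0)}\cap B^{\rho}[X]$. Let $C(A)$ be the center of $A=B[X;\rho]/fB[X;\rho]$, and let $I_x$ be the inner derivation of $A$ by $x$, that is, $I_x(h)=hx-xh$ for any $h\in A$. (1) $f$ is weakly separable in $B[X;\rho]$ if and only if the following sequence of $V^{\tilde\rho}$-$V^{\tilde\rho}$-homomorphisms is exact: $$0\longrightarrow C(A)\overset{\mathrm{inj}}{\longrightarrow}V\overset{I_x}{\longrightarrow}J_\rho\overset{\tau}{\longrightarrow}V^{\tilde\rho}.$$ (2) $f$ is separable in $B[X;\rho]$ if and only if the following sequence of $V^{\tilde\rho}$-$V^{\tilde\rho}$-homomorphisms is exact: $$0\longrightarrow C(A)\overset{\mathrm{inj}}{\longrightarrow}V\overset{I_x}{\longrightarrow}J_\rho\overset{\tau}{\longrightarrow}V^{\tilde\rho}\longrightarrow 0.$$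
   Context: Rings are associative with identity, not necessarily commutative. $B[X;\rho]$ is the skew polynomial ring whose elements are $\sum_j X^j c_j$ ($c_j\in B$), with multiplication determined by $\alpha X=X\rho(\alpha)$ for $\alpha\in B$. $B[X;\rho]_{(0)}$ is the set of all monic $g\in B[X;\rho]$ with $gB[X;\rho]=B[X;\rho]g$. $B^\rho=\{\alpha\in B\mid \rho(\alpha)=\alpha\}$, and $f\in B^\rho[X]$ means that all coefficients $a_j$ of $f$ lie in $B^\rho$. Put $a_m=1$. Set $A=B[X;\rho]/fB[X;\rho]$, a ring extension of $B$ that is free with basis $1,x,\dots,x^{m-1}$, where $x=X+fB[X;\rho]$. Since $f\in B[X;\rho]_{(0)}\cap B^\rho[X]$, $\rho$ induces an automorphism $\tilde\rho$ of $A$ given by $\tilde\rho(\sum_{j=0}^{m-1}x^jc_j)=\sum_{j=0}^{m-1}x^j\rho(c_j)$. Let $V=V_A(B)$ be the centralizer of $B$ in $A$, $V^{\tilde\rho}=\{h\in V\mid\tilde\rho(h)=h\}$, and for $k\ge1$ let $J_{\rho^k}=\{h\in A\mid \alpha h=h\rho^k(\alpha)\ \text{for all }\alpha\in B\}$. The map $\tau:J_\rho\to J_{\rho^m}$ is the $V^{\tilde\rho}$-$V^{\tilde\rho}$-homomorphism $$\tau(h)=\sum_{k=0}^{m-1}x^k\sum_{j=0}^{k}\tilde\rho^{\,j}(h)\,a_{k+1}.$$ Here, since $\rho^m=1$, $J_{\rho^m}=V$; the image of $\tau$ is contained in $V^{\tilde\rho}$ and $\tau$ is regarded as a map $J_\rho\to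 V^{\tilde\rho}$. The map "inj" is the inclusion, and $I_x:V\to J_\rho$ is the restriction of $I_x$ to $V$. A ring extension $A/B$ is separable if the $A$-$A$-homomorphism $A\otimes_BA\to A$, $a\otimes b\mapsto ab$, splits (as a homomorphism of $A$-$A$-bimodules). A $B$-derivation of $A$ is an additive map $\delta:A\to A$ with $\delta(yz)=\delta(y)z+y\delta(z)$ for all $y,z\in A$ and $\delta(\alpha)=0$ for all $\alpha\in B$; it is inner if there is $u\in A$ with $\delta(y)=uy-yu$ for all $y\in A$. $A/B$ is weakly separable if every $B$-derivation of $A$ to $A$ is inner. The polynomial $f$ is separable (resp. weakly separable) in $B[X;\rho]$ if $A=B[X;\rho]/fB[X;\rho]$ is separable (resp. weakly separable) over $B$. *)

theory Defs
  imports
    "HOL-Algebra.UnivPoly"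
    "HOL-Algebra.QuotRing"
    "HOL-Algebra.Exact_Sequence"
    "HOL-Algebra.Free_Abelian_Groups"
begin

section \<open>Separable and weakly separable extensions of noncommutative rings\<close>

text \<open>
  A ring extension is given by a ring \<open>A\<close> together with (the carrier of) a subring
  \<open>K\<close> of \<open>A\<close>.
\<close>

definition centralizer :: "('r, 'n) ring_scheme \<Rightarrow> 'r set \<Rightarrow> 'r set" where
  "centralizer A K = {h \<in> carrier A. \<forall>k\<in>K. k \<otimes>\<^bsub>A\<^esub> h = h \<otimes>\<^bsub>A\<^esub> k}"

definition center :: "('r, 'n) ring_scheme \<Rightarrow> 'r set" where
  "center A = centralizer A (carrier A)"

definition derivation_over :: "('r, 'n) ring_scheme \<Rightarrow> 'r set \<Rightarrow> ('r \<Rightarrow> 'r) \<Rightarrow> bool" where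
  "derivation_over A K \<delta> \<longleftrightarrow>
     \<delta> \<in> carrier A \<rightarrow> carrier A \<and>
     (\<forall>y\<in>carrier A. \<forall>z\<in>carrier A. \<delta> (y \<oplus>\<^bsub>A\<^esub> z) = \<delta> y \<oplus>\<^bsub>A\<^esub> \<delta> z) \<and>
     (\<forall>y\<in>carrier A. \<forall>z\<in>carrier A.
        \<delta> (y \<otimes>\<^bsub>A\<^esub> z) = \<delta> y \<otimes>\<^bsub>A\<^esub> z \<oplus>\<^bsub>A\<^esub> y \<otimes>\<^bsub>A\<^esub> \<delta> z) \<and>
     (\<forall>k\<in>K. \<delta> k = \<zero>\<^bsub>A\<^esub>)"

definition inner_derivation :: "('r, 'n) ring_scheme \<Rightarrow> ('r \<Rightarrow> 'r) \<Rightarrow> bool" where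
  "inner_derivation A \<delta> \<longleftrightarrow>
     (\<exists>u\<in>carrier A. \<forall>y\<in>carrier A. \<delta> y = u \<otimes>\<^bsub>A\<^esub> y \<ominus>\<^bsub>A\<^esub> y \<otimes>\<^bsub>A\<^esub> u)"

definition weakly_separable_ext :: "('r, 'n) ring_scheme \<Rightarrow> 'r set \<Rightarrow> bool" where
  "weakly_separable_ext A K \<longleftrightarrow> (\<forall>\<delta>. derivation_over A K \<delta> \<longrightarrow> inner_derivation A \<delta>)"

text \<open>
  The tensor product of \<open>A\<close> with itself over \<open>K\<close> is the free abelian group on
  \<open>A \<times> A\<close> modulo the subgroup generated by the biadditivity and \<open>K\<close>-balancing
  relations; it is a multiplicatively written group whose elements are cosets.
\<close>

abbreviation pair_group :: "('r, 'n) ring_scheme \<Rightarrow> ('r \<times> 'r \<Rightarrow>\<^sub>0 int) monoid" where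
  "pair_group A \<equiv> free_Abelian_group (carrier A \<times> carrier A)"

definition tensor_relators :: "('r, 'n) ring_scheme \<Rightarrow> 'r set \<Rightarrow> ('r \<times> 'r \<Rightarrow>\<^sub>0 int) set" where
  "tensor_relators A K =
     {frag_of (u \<oplus>\<^bsub>A\<^esub> u', v) - frag_of (u, v) - frag_of (u', v) | u u' v.
        u \<in> carrier A \<and> u' \<in> carrier A \<and> v \<in> carrier A} \<union>
     {frag_of (u, v \<oplus>\<^bsub>A\<^esub> v') - frag_of (u, v) - frag_of (u, v') | u v v'.
        u \<in> carrier A \<and> v \<in> carrier A \<and> v' \<in> carrier A} \<union>
     {frag_of (u \<otimes>\<^bsub>A\<^esub> k, v) - frag_of (u, k \<otimes>\<^bsub>A\<^esub> v) | u k v.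
        u \<in> carrier A \<and> k \<in> K \<and> v \<in> carrier A}"

definition tensor_kernel :: "('r, 'n) ring_scheme \<Rightarrow> 'r set \<Rightarrow> ('r \<times> 'r \<Rightarrow>\<^sub>0 int) set" where
  "tensor_kernel A K = generate (pair_group A) (tensor_relators A K)"

definition tensor :: "('r, 'n) ring_scheme \<Rightarrow> 'r set \<Rightarrow> ('r \<times> 'r \<Rightarrow>\<^sub>0 int) set monoid" where
  "tensor A K = pair_group A Mod tensor_kernel A K"

text \<open>
  The two-sided action sending the class of \<open>(u, v)\<close> to the class of \<open>(a u, v b)\<close>.
  The elementwise image of a coset need not be a full coset, hence the product with the
  kernel.
\<close>

definition tensor_act ::
  "('r, 'n) ring_scheme \<Rightarrow> 'r set \<Rightarrow> 'r \<Rightarrow> 'r \<Rightarrow> ('r \<times> 'r \<Rightarrow>\<^sub>0 int) set \<Rightarrow> ('r \<times> 'r \<Rightarrow>\<^sub>0 int) set" where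
  "tensor_act A K a b t =
     tensor_kernel A K <#>\<^bsub>pair_group A\<^esub>
       (frag_extend (\<lambda>(u, v). frag_of (a \<otimes>\<^bsub>A\<^esub> u, v \<otimes>\<^bsub>A\<^esub> b)) ` t)"

text \<open>
  The multiplication map, induced by the evaluation of formal sums of pairs; evaluation is
  constant on each coset.
\<close>

definition pair_eval :: "('r, 'n) ring_scheme \<Rightarrow> ('r \<times> 'r \<Rightarrow>\<^sub>0 int) \<Rightarrow> 'r" where
  "pair_eval A c =
     (\<Oplus>\<^bsub>A\<^esub>p\<in>Poly_Mapping.keys c. [Poly_Mapping.lookup c p] \<cdot>\<^bsub>A\<^esub> (fst p \<otimes>\<^bsub>A\<^esub> snd p))"

definition tensor_mult :: "('r, 'n) ring_scheme \<Rightarrow> ('r \<times> 'r \<Rightarrow>\<^sub>0 int) set \<Rightarrow> 'r" where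
  "tensor_mult A t = the_elem (pair_eval A ` t)"

definition separable_ext :: "('r, 'n) ring_scheme \<Rightarrow> 'r set \<Rightarrow> bool" where
  "separable_ext A K \<longleftrightarrow>
     (\<exists>s \<in> hom (add_monoid A) (tensor A K).
        (\<forall>a\<in>carrier A. \<forall>b\<in>carrier A. \<forall>h\<in>carrier A.
           s (a \<otimes>\<^bsub>A\<^esub> h \<otimes>\<^bsub>A\<^esub> b) = tensor_act A K a b (s h)) \<and>
        (\<forall>h\<in>carrier A. tensor_mult A (s h) = h))"


section \<open>Exact sequences of bimodules inside a ring\<close>

text \<open>
  All bimodules below are additive subgroups of one ring \<open>A\<close>, with a subset \<open>R\<close> of \<open>A\<close>
  acting on both sides by multiplication.
\<close>

definition sub_bimodule :: "('r, 'n) ring_scheme \<Rightarrow> 'r set \<Rightarrow> 'r set \<Rightarrow> bool" where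
  "sub_bimodule A R M \<longleftrightarrow>
     subgroup M (add_monoid A) \<and>
     (\<forall>r\<in>R. \<forall>h\<in>M. r \<otimes>\<^bsub>A\<^esub> h \<in> M \<and> h \<otimes>\<^bsub>A\<^esub> r \<in> M)"

definition add_sub :: "'r ring \<Rightarrow> 'r set \<Rightarrow> 'r monoid" where
  "add_sub A M = (add_monoid A)\<lparr>carrier := M\<rparr>"

definition bimodule_hom :: "'r ring \<Rightarrow> 'r set \<Rightarrow> 'r set \<Rightarrow> 'r set \<Rightarrow> ('r \<Rightarrow> 'r) \<Rightarrow> bool" where
  "bimodule_hom A R M N g \<longleftrightarrow>
     g \<in> hom (add_sub A M) (add_sub A N) \<and>
     (\<forall>r\<in>R. \<forall>h\<in>M. g (r \<otimes>\<^bsub>A\<^esub> h) = r \<otimes>\<^bsub>A\<^esub> g h \<and> g (h \<otimes>\<^bsub>A\<^esub> r) = g h \<otimes>\<^bsub>A\<^esub> r)"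

text \<open>
  The modules \<open>Ms\<close> and maps \<open>gs\<close> are listed from left to right, \<open>gs ! i\<close> going from
  \<open>Ms ! i\<close> to \<open>Ms ! Suc i\<close>, whereas \<^const>\<open>exact_seq\<close> lists them from right to left.
\<close>

definition exact_bimodule_seq :: "'r ring \<Rightarrow> 'r set \<Rightarrow> 'r set list \<Rightarrow> ('r \<Rightarrow> 'r) list \<Rightarrow> bool" where
  "exact_bimodule_seq A R Ms gs \<longleftrightarrow>
     (\<forall>M\<in>set Ms. sub_bimodule A R M) \<and>
     (\<forall>i<length gs. bimodule_hom A R (Ms ! i) (Ms ! Suc i) (gs ! i)) \<and>
     exact_seq (rev (map (add_sub A) Ms), rev gs)"


section \<open>Skew polynomial rings of automorphism type\<close>

text \<open>
  The function \<open>p\<close> stands for the sum of the \<open>X\<^sup>j (p j)\<close>, coefficients on the right.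
  Since \<open>\<alpha> X = X \<rho>(\<alpha>)\<close>, we have \<open>(X\<^sup>i b) (X\<^sup>j c) = X\<^sup>i\<^sup>+\<^sup>j \<rho>\<^sup>j(b) c\<close>.
\<close>

definition skew_poly :: "('a, 'm) ring_scheme \<Rightarrow> ('a \<Rightarrow> 'a) \<Rightarrow> (nat \<Rightarrow> 'a) ring" where
  "skew_poly B \<rho> =
     \<lparr>carrier = up B,
      monoid.mult = (\<lambda>p q n. \<Oplus>\<^bsub>B\<^esub>i\<in>{..n}. (\<rho> ^^ (n - i)) (p i) \<otimes>\<^bsub>B\<^esub> q (n - i)),
      one = (\<lambda>n. if n = 0 then \<one>\<^bsub>B\<^esub> else \<zero>\<^bsub>B\<^esub>),
      ring.zero = (\<lambda>n. \<zero>\<^bsub>B\<^esub>),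
      add = (\<lambda>p q n. p n \<oplus>\<^bsub>B\<^esub> q n)\<rparr>"

definition skew_const :: "('a, 'm) ring_scheme \<Rightarrow> 'a \<Rightarrow> nat \<Rightarrow> 'a" where
  "skew_const B \<alpha> = (\<lambda>n. if n = 0 then \<alpha> else \<zero>\<^bsub>B\<^esub>)"

definition skew_X :: "('a, 'm) ring_scheme \<Rightarrow> nat \<Rightarrow> 'a" where
  "skew_X B = (\<lambda>n. if n = 1 then \<one>\<^bsub>B\<^esub> else \<zero>\<^bsub>B\<^esub>)"

definition monic_of_degree :: "('a, 'm) ring_scheme \<Rightarrow> nat \<Rightarrow> (nat \<Rightarrow> 'a) \<Rightarrow> bool" where
  "monic_of_degree B m g \<longleftrightarrow> g \<in> up B \<and> g m = \<one>\<^bsub>B\<^esub> \<and> (\<forall>n>m. g n = \<zero>\<^bsub>B\<^esub>)"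

text \<open>The set \<open>B[X;\<rho>]\<^sub>(\<^sub>0\<^sub>)\<close>.\<close>

definition skew_poly_0 :: "('a, 'm) ring_scheme \<Rightarrow> ('a \<Rightarrow> 'a) \<Rightarrow> (nat \<Rightarrow> 'a) set" where
  "skew_poly_0 B \<rho> =
     {g. (\<exists>n. monic_of_degree B n g) \<and>
         g <#\<^bsub>skew_poly B \<rho>\<^esub> carrier (skew_poly B \<rho>) = carrier (skew_poly B \<rho>) #>\<^bsub>skew_poly B \<rho>\<^esub> g}"

definition fixed_ring :: "('a, 'm) ring_scheme \<Rightarrow> ('a \<Rightarrow> 'a) \<Rightarrow> 'a set" where
  "fixed_ring B \<rho> = {\<alpha> \<in> carrier B. \<rho> \<alpha> = \<alpha>}"

definition has_order :: "('a, 'm) ring_scheme \<Rightarrow> ('a \<Rightarrow> 'a) \<Rightarrow> nat \<Rightarrow> bool" where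
  "has_order B \<rho> m \<longleftrightarrow>
     0 < m \<and> (\<forall>\<alpha>\<in>carrier B. (\<rho> ^^ m) \<alpha> = \<alpha>) \<and>
     (\<forall>k. 0 < k \<and> k < m \<longrightarrow> (\<exists>\<alpha>\<in>carrier B. (\<rho> ^^ k) \<alpha> \<noteq> \<alpha>))"


section \<open>The quotient by a polynomial and the maps attached to it\<close>

definition skew_ideal :: "('a, 'm) ring_scheme \<Rightarrow> ('a \<Rightarrow> 'a) \<Rightarrow> (nat \<Rightarrow> 'a) \<Rightarrow> (nat \<Rightarrow> 'a) set" where
  "skew_ideal B \<rho> f = f <#\<^bsub>skew_poly B \<rho>\<^esub> carrier (skew_poly B \<rho>)"

definition skew_quot :: "('a, 'm) ring_scheme \<Rightarrow> ('a \<Rightarrow> 'a) \<Rightarrow> (nat \<Rightarrow> 'a) \<Rightarrow> (nat \<Rightarrow> 'a) set ring" where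
  "skew_quot B \<rho> f = skew_poly B \<rho> Quot skew_ideal B \<rho> f"

definition quot_const ::
  "('a, 'm) ring_scheme \<Rightarrow> ('a \<Rightarrow> 'a) \<Rightarrow> (nat \<Rightarrow> 'a) \<Rightarrow> 'a \<Rightarrow> (nat \<Rightarrow> 'a) set" where
  "quot_const B \<rho> f \<alpha> = skew_ideal B \<rho> f +>\<^bsub>skew_poly B \<rho>\<^esub> skew_const B \<alpha>"

definition quot_x ::
  "('a, 'm) ring_scheme \<Rightarrow> ('a \<Rightarrow> 'a) \<Rightarrow> (nat \<Rightarrow> 'a) \<Rightarrow> (nat \<Rightarrow> 'a) set" where
  "quot_x B \<rho> f = skew_ideal B \<rho> f +>\<^bsub>skew_poly B \<rho>\<^esub> skew_X B"

abbreviation quot_base ::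
  "('a, 'm) ring_scheme \<Rightarrow> ('a \<Rightarrow> 'a) \<Rightarrow> (nat \<Rightarrow> 'a) \<Rightarrow> (nat \<Rightarrow> 'a) set set" where
  "quot_base B \<rho> f \<equiv> quot_const B \<rho> f ` carrier B"

definition separable_poly :: "('a, 'm) ring_scheme \<Rightarrow> ('a \<Rightarrow> 'a) \<Rightarrow> (nat \<Rightarrow> 'a) \<Rightarrow> bool" where
  "separable_poly B \<rho> f \<longleftrightarrow> separable_ext (skew_quot B \<rho> f) (quot_base B \<rho> f)"

definition weakly_separable_poly :: "('a, 'm) ring_scheme \<Rightarrow> ('a \<Rightarrow> 'a) \<Rightarrow> (nat \<Rightarrow> 'a) \<Rightarrow> bool" where
  "weakly_separable_poly B \<rho> f \<longleftrightarrow> weakly_separable_ext (skew_quot B \<rho> f) (quot_base B \<rho> f)"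

text \<open>
  In what follows \<open>m\<close> is the degree of \<open>f\<close>. The linear combination of \<open>1, x, \<dots>, x\<^sup>m\<^sup>-\<^sup>1\<close>
  with right coefficients \<open>c\<close>, and the coefficients of an element with respect to this basis.
\<close>

definition quot_comb ::
  "('a, 'm) ring_scheme \<Rightarrow> ('a \<Rightarrow> 'a) \<Rightarrow> (nat \<Rightarrow> 'a) \<Rightarrow> nat \<Rightarrow> (nat \<Rightarrow> 'a) \<Rightarrow> (nat \<Rightarrow> 'a) set" where
  "quot_comb B \<rho> f m c =
     (\<Oplus>\<^bsub>skew_quot B \<rho> f\<^esub>j\<in>{..<m}.
        quot_x B \<rho> f [^]\<^bsub>skew_quot B \<rho> f\<^esub> j \<otimes>\<^bsub>skew_quot B \<rho> f\<^esub> quot_const B \<rho> f (c j))"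

definition quot_coords ::
  "('a, 'm) ring_scheme \<Rightarrow> ('a \<Rightarrow> 'a) \<Rightarrow> (nat \<Rightarrow> 'a) \<Rightarrow> nat \<Rightarrow> (nat \<Rightarrow> 'a) set \<Rightarrow> nat \<Rightarrow> 'a" where
  "quot_coords B \<rho> f m h =
     (THE c. c \<in> {..<m} \<rightarrow>\<^sub>E carrier B \<and> quot_comb B \<rho> f m c = h)"

definition rho_tilde ::
  "('a, 'm) ring_scheme \<Rightarrow> ('a \<Rightarrow> 'a) \<Rightarrow> (nat \<Rightarrow> 'a) \<Rightarrow> nat \<Rightarrow> (nat \<Rightarrow> 'a) set \<Rightarrow> (nat \<Rightarrow> 'a) set" where
  "rho_tilde B \<rho> f m h = quot_comb B \<rho> f m (\<lambda>j. \<rho> (quot_coords B \<rho> f m h j))"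

definition J_mod ::
  "('a, 'm) ring_scheme \<Rightarrow> ('a \<Rightarrow> 'a) \<Rightarrow> (nat \<Rightarrow> 'a) \<Rightarrow> nat \<Rightarrow> (nat \<Rightarrow> 'a) set set" where
  "J_mod B \<rho> f k =
     {h \<in> carrier (skew_quot B \<rho> f). \<forall>\<alpha>\<in>carrier B.
        quot_const B \<rho> f \<alpha> \<otimes>\<^bsub>skew_quot B \<rho> f\<^esub> h =
        h \<otimes>\<^bsub>skew_quot B \<rho> f\<^esub> quot_const B \<rho> f ((\<rho> ^^ k) \<alpha>)}"

definition V_cent ::
  "('a, 'm) ring_scheme \<Rightarrow> ('a \<Rightarrow> 'a) \<Rightarrow> (nat \<Rightarrow> 'a) \<Rightarrow> (nat \<Rightarrow> 'a) set set" where
  "V_cent B \<rho> f = centralizer (skew_quot B \<rho> f) (quot_base B \<rho> f)"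

definition V_fixed ::
  "('a, 'm) ring_scheme \<Rightarrow> ('a \<Rightarrow> 'a) \<Rightarrow> (nat \<Rightarrow> 'a) \<Rightarrow> nat \<Rightarrow> (nat \<Rightarrow> 'a) set set" where
  "V_fixed B \<rho> f m = {h \<in> V_cent B \<rho> f. rho_tilde B \<rho> f m h = h}"

text \<open>
  \<open>tau\<close> uses the coefficients \<open>f 1, \<dots>, f m\<close> of \<open>f\<close>; here \<open>f m\<close> is the leading
  coefficient \<open>1\<close>.
\<close>

definition tau ::
  "('a, 'm) ring_scheme \<Rightarrow> ('a \<Rightarrow> 'a) \<Rightarrow> (nat \<Rightarrow> 'a) \<Rightarrow> nat \<Rightarrow> (nat \<Rightarrow> 'a) set \<Rightarrow> (nat \<Rightarrow> 'a) set" where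
  "tau B \<rho> f m h =
     (\<Oplus>\<^bsub>skew_quot B \<rho> f\<^esub>k\<in>{..<m}.
        quot_x B \<rho> f [^]\<^bsub>skew_quot B \<rho> f\<^esub> k \<otimes>\<^bsub>skew_quot B \<rho> f\<^esub>
        (\<Oplus>\<^bsub>skew_quot B \<rho> f\<^esub>j\<in>{..k}.
           (rho_tilde B \<rho> f m ^^ j) h \<otimes>\<^bsub>skew_quot B \<rho> f\<^esub> quot_const B \<rho> f (f (Suc k))))"

definition I_x ::
  "('a, 'm) ring_scheme \<Rightarrow> ('a \<Rightarrow> 'a) \<Rightarrow> (nat \<Rightarrow> 'a) \<Rightarrow> (nat \<Rightarrow> 'a) set \<Rightarrow> (nat \<Rightarrow> 'a) set" where
  "I_x B \<rho> f h =
     h \<otimes>\<^bsub>skew_quot B \<rho> f\<^esub> quot_x B \<rho> f \<ominus>\<^bsub>skew_quot B \<rho> f\<^esub>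
     quot_x B \<rho> f \<otimes>\<^bsub>skew_quot B \<rho> f\<^esub> h"

end

theory Submission
  imports Defs "HOL-Algebra.Subrings"
begin

text \<open>
  Let \<open>A\<close> be the quotient of the skew polynomial ring by \<open>f\<close>, let \<open>K\<close> be the image of \<open>B\<close> in
  \<open>A\<close>, and write \<open>T\<close> for the automorphism of \<open>A\<close> induced by \<open>\<rho>\<close>. The arguments use only that
  \<open>1, x, \<dots>, x\<^sup>m\<^sup>-\<^sup>1\<close> is a right \<open>K\<close>-basis, that \<open>f(x) = 0\<close> with coefficients \<open>a\<^sub>j\<close> fixed by
  \<open>T\<close>, that \<open>T\<^sup>m\<close> is the identity on \<open>K\<close>, and the rule \<open>y x = x T(y)\<close> for all \<open>y \<in> A\<close>. This
  rule shows that the elements of \<open>V\<close> fixed by \<open>T\<close> are central, so all maps are linear over them.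
  Comparing coordinates in \<open>k x\<^sup>m = x\<^sup>m k\<close> for \<open>k \<in> K\<close> gives \<open>a\<^sub>j y = T\<^sup>j(y) a\<^sub>j\<close>, which is
  what makes the image of \<open>\<tau>\<close> consist of such fixed elements.

  Weak separability. A derivation \<open>\<delta>\<close> over \<open>K\<close> is determined by \<open>h = \<delta>(x)\<close>. Differentiating
  \<open>k x = x T(k)\<close> puts \<open>h\<close> into \<open>J\<close>, and differentiating \<open>f(x) = 0\<close> gives \<open>\<tau>(h) = 0\<close>, because
  \<open>\<tau>(h)\<close> is the sum of the \<open>\<delta>(x\<^sup>n) a\<^sub>n\<close> (\<open>derivation_tau_zero\<close>). Conversely every such \<open>h\<close>
  comes from a derivation, defined on the basis (\<open>exists_derivation\<close>). The inner derivations
  over \<open>K\<close> are those given by \<open>u \<in> V\<close>, with value \<open>I\<^sub>x(u)\<close> at \<open>x\<close>. Hence all derivations are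
  inner exactly when \<open>ker \<tau> = I\<^sub>x(V)\<close>; exactness at the other places is automatic, as an
  element of \<open>V\<close> commuting with \<open>x\<close> is central.

  Separability. A bimodule splitting is the same as an element \<open>e = \<Sum> u\<^sub>i \<otimes> v\<^sub>i\<close> with
  \<open>\<Sum> u\<^sub>i v\<^sub>i = 1\<close> and \<open>b e = e b\<close> for all \<open>b\<close> (\<open>separable_ext_iff\<close>). As a left module,
  \<open>A \<otimes> A\<close> is free on the \<open>1 \<otimes> x\<^sup>j\<close>. Let \<open>h\<close> be the coordinate of \<open>e\<close> at \<open>1 \<otimes> x\<^sup>m\<^sup>-\<^sup>1\<close>.
  Commutation with \<open>K\<close> says that \<open>h \<in> J\<close>, commutation with \<open>x\<close> expresses the other coordinates
  through \<open>h\<close>, and then \<open>\<Sum> u\<^sub>i v\<^sub>i = 1\<close> becomes \<open>\<tau>(h) = 1\<close>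
  (\<open>separable_imp_tau_one\<close>). Reading these formulas backwards turns any \<open>h \<in> J\<close> with
  \<open>\<tau>(h) = 1\<close> into a separability element (\<open>tau_one_imp_separable\<close>). Since \<open>\<tau>\<close> is linear
  over central elements, attaining \<open>1\<close> is the same as being onto \<open>W\<close>, and separability
  implies weak separability, so both conditions of the longer sequence appear.
\<close>


section \<open>Finite sums in an abelian monoid\<close>

lemma (in abelian_monoid) finsum_single:
  assumes "i \<in> I" "finite I" "\<And>j. j \<in> I \<Longrightarrow> j \<noteq> i \<Longrightarrow> g j = \<zero>" "g i \<in> carrier G"
  shows "finsum G g I = g i"
proof -
  have "finsum G g I = (\<Oplus>j\<in>I. if i = j then g j else \<zero>)"
    by (rule finsum_cong') (use assms in auto)
  also have "\<dots> = g i"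
    using assms by (intro finsum_singleton) (auto, metis zero_closed)
  finally show ?thesis .
qed

text \<open>Both sides sum \<open>F k l s\<close> over all \<open>k + l + s = n\<close>. This is the rearrangement behind
  associativity of a convolution product.\<close>

lemma (in abelian_monoid) finsum_triangle:
  fixes n :: nat
  assumes "\<And>i j k. F i j k \<in> carrier G"
  shows "(\<Oplus>i\<in>{..n}. \<Oplus>k\<in>{..i}. F k (i - k) (n - i)) =
         (\<Oplus>k\<in>{..n}. \<Oplus>l\<in>{..n - k}. F k l (n - k - l))"
  using assms
proof (induction n arbitrary: F)
  case 0
  then show ?case by simp
next
  case (Suc n)
  let ?L = "\<Oplus>k\<in>{..Suc n}. F k (Suc n - k) 0"
  have "(\<Oplus>i\<in>{..Suc n}. \<Oplus>k\<in>{..i}. F k (i - k) (Suc n - i)) =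
        ?L \<oplus> (\<Oplus>i\<in>{..n}. \<Oplus>k\<in>{..i}. F k (i - k) (Suc n - i))"
    using Suc.prems by (subst finsum_Suc) auto
  also have "(\<Oplus>i\<in>{..n}. \<Oplus>k\<in>{..i}. F k (i - k) (Suc n - i)) =
             (\<Oplus>i\<in>{..n}. \<Oplus>k\<in>{..i}. F k (i - k) (Suc (n - i)))"
    by (intro finsum_cong') (use Suc.prems in \<open>auto simp: Suc_diff_le\<close>)
  also have "\<dots> = (\<Oplus>k\<in>{..n}. \<Oplus>l\<in>{..n - k}. F k l (Suc (n - k - l)))"
    by (rule Suc.IH) (use Suc.prems in auto)
  also have "?L \<oplus> \<dots> = (F (Suc n) 0 0 \<oplus> (\<Oplus>k\<in>{..n}. F k (Suc n - k) 0)) \<oplus> \<dots>"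
    using Suc.prems by (subst finsum_Suc) auto
  also have "\<dots> = F (Suc n) 0 0 \<oplus>
      (\<Oplus>k\<in>{..n}. F k (Suc n - k) 0 \<oplus> (\<Oplus>l\<in>{..n - k}. F k l (Suc (n - k - l))))"
    using Suc.prems by (simp add: finsum_addf a_assoc)
  also have "\<dots> = F (Suc n) 0 0 \<oplus> (\<Oplus>k\<in>{..n}. \<Oplus>l\<in>{..Suc n - k}. F k l (Suc n - k - l))"
  proof (rule arg_cong[of _ _ "\<lambda>z. _ \<oplus> z"], intro finsum_cong')
    fix k assume k: "k \<in> {..n}"
    have "(\<Oplus>l\<in>{..Suc (n - k)}. F k l (Suc n - k - l)) =
          F k (Suc (n - k)) (Suc n - k - Suc (n - k)) \<oplus> (\<Oplus>l\<in>{..n - k}. F k l (Suc n - k - l))"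
      using Suc.prems by (subst finsum_Suc) auto
    also have "(\<Oplus>l\<in>{..n - k}. F k l (Suc n - k - l)) = (\<Oplus>l\<in>{..n - k}. F k l (Suc (n - k - l)))"
      by (intro finsum_cong') (use Suc.prems k in \<open>auto simp: Suc_diff_le\<close>)
    finally show "F k (Suc n - k) 0 \<oplus> (\<Oplus>l\<in>{..n - k}. F k l (Suc (n - k - l))) =
                  (\<Oplus>l\<in>{..Suc n - k}. F k l (Suc n - k - l))"
      using k by (simp add: Suc_diff_le)
  qed (use Suc.prems in auto)
  also have "\<dots> = (\<Oplus>k\<in>{..Suc n}. \<Oplus>l\<in>{..Suc n - k}. F k l (Suc n - k - l))"
    using Suc.prems by (subst finsum_Suc[of _ n]) auto
  finally show ?case .
qed


section \<open>The skew polynomial ring\<close>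

lemma skew_poly_simps [simp]:
  "carrier (skew_poly B \<rho>) = up B"
  "\<zero>\<^bsub>skew_poly B \<rho>\<^esub> = (\<lambda>n. \<zero>\<^bsub>B\<^esub>)"
  "\<one>\<^bsub>skew_poly B \<rho>\<^esub> = (\<lambda>n. if n = 0 then \<one>\<^bsub>B\<^esub> else \<zero>\<^bsub>B\<^esub>)"
  "p \<oplus>\<^bsub>skew_poly B \<rho>\<^esub> q = (\<lambda>n. p n \<oplus>\<^bsub>B\<^esub> q n)"
  by (simp_all add: skew_poly_def)

definition skew_monom :: "('a, 'm) ring_scheme \<Rightarrow> nat \<Rightarrow> 'a \<Rightarrow> nat \<Rightarrow> 'a" where
  "skew_monom B k c = (\<lambda>n. if n = k then c else \<zero>\<^bsub>B\<^esub>)"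

lemma skew_monom_apply: "skew_monom B k c n = (if n = k then c else \<zero>\<^bsub>B\<^esub>)"
  by (simp add: skew_monom_def)

text \<open>The multiplication of \<open>skew_poly\<close> is associative because the powers of \<open>\<rho>\<close> are ring
  endomorphisms.\<close>

locale skew_poly_ring = B?: ring B for B (structure) +
  fixes \<rho> :: "'a \<Rightarrow> 'a"
  assumes rho_hom: "\<rho> \<in> ring_hom B B"
begin

abbreviation P where "P \<equiv> skew_poly B \<rho>"

lemma funpow_rho_hom: "\<rho> ^^ k \<in> ring_hom B B"
proof (induction k)
  case 0
  then show ?case by (auto intro: ring_hom_memI)
next
  case (Suc k)
  then show ?case using ring_hom_trans[OF Suc rho_hom] by (simp add: o_def)
qed

lemma rho_pow_closed [simp]: "b \<in> carrier B \<Longrightarrow> (\<rho> ^^ k) b \<in> carrier B"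
  using ring_hom_closed[OF funpow_rho_hom] by blast

lemma rho_closed [simp]: "b \<in> carrier B \<Longrightarrow> \<rho> b \<in> carrier B"
  using ring_hom_closed[OF rho_hom] by blast

lemma rho_pow_hom:
  assumes "b \<in> carrier B" "c \<in> carrier B"
  shows "(\<rho> ^^ k) (b \<otimes> c) = (\<rho> ^^ k) b \<otimes> (\<rho> ^^ k) c"
        "(\<rho> ^^ k) (b \<oplus> c) = (\<rho> ^^ k) b \<oplus> (\<rho> ^^ k) c"
  using assms ring_hom_mult[OF funpow_rho_hom] ring_hom_add[OF funpow_rho_hom] by blast+

lemma rho_pow_zero [simp]: "(\<rho> ^^ k) \<zero> = \<zero>"
  using ring_hom_zero[OF funpow_rho_hom B.ring_axioms B.ring_axioms] .

lemma rho_pow_one [simp]: "(\<rho> ^^ k) \<one> = \<one>"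
  using ring_hom_one[OF funpow_rho_hom] .

lemma rho_zero [simp]: "\<rho> \<zero> = \<zero>" and rho_one [simp]: "\<rho> \<one> = \<one>"
  using rho_pow_zero[of 1] rho_pow_one[of 1] by simp_all

lemma rho_pow_finsum:
  assumes "finite I" "g \<in> I \<rightarrow> carrier B"
  shows "(\<rho> ^^ k) (finsum B g I) = (\<Oplus>i\<in>I. (\<rho> ^^ k) (g i))"
  using assms
proof (induction I rule: finite_induct)
  case (insert i I)
  then show ?case
    by (simp add: Pi_iff rho_pow_hom)
qed simp

lemma up_coeff [simp]: "p \<in> up B \<Longrightarrow> p n \<in> carrier B"
  by (rule mem_upD)

lemma mult_coeff: "(p \<otimes>\<^bsub>P\<^esub> q) n = (\<Oplus>i\<in>{..n}. (\<rho> ^^ (n - i)) (p i) \<otimes> q (n - i))"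
  by (simp add: skew_poly_def)

lemma up_skew_mult_closed:
  assumes "p \<in> up B" "q \<in> up B"
  shows "p \<otimes>\<^bsub>P\<^esub> q \<in> up B"
proof
  show "(p \<otimes>\<^bsub>P\<^esub> q) n \<in> carrier B" for n
    using assms by (simp add: mult_coeff)
  obtain a b where a: "bound \<zero> a p" and b: "bound \<zero> b q"
    using assms by (meson bound_upD)
  have "bound \<zero> (a + b) (p \<otimes>\<^bsub>P\<^esub> q)"
  proof
    fix n assume n: "a + b < n"
    have "(\<rho> ^^ (n - i)) (p i) \<otimes> q (n - i) = \<zero>" for i
    proof (cases "a < i")
      case True
      then show ?thesis using bound.bound[OF a, of i] assms by simp
    next
      case False
      then have "q (n - i) = \<zero>" using n by (intro bound.bound[OF b]) auto
      then show ?thesis using assms by simp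
    qed
    then show "(p \<otimes>\<^bsub>P\<^esub> q) n = \<zero>" by (simp add: mult_coeff)
  qed
  then show "\<exists>n. bound \<zero> n (p \<otimes>\<^bsub>P\<^esub> q)" ..
qed

lemma skew_mult_assoc:
  assumes "p \<in> up B" "q \<in> up B" "r \<in> up B"
  shows "p \<otimes>\<^bsub>P\<^esub> q \<otimes>\<^bsub>P\<^esub> r = p \<otimes>\<^bsub>P\<^esub> (q \<otimes>\<^bsub>P\<^esub> r)"
proof
  fix n
  define F where "F k l s = (\<rho> ^^ (l + s)) (p k) \<otimes> ((\<rho> ^^ s) (q l) \<otimes> r s)" for k l s
  have F: "F k l s \<in> carrier B" for k l s using assms by (simp add: F_def)
  have "(p \<otimes>\<^bsub>P\<^esub> q \<otimes>\<^bsub>P\<^esub> r) n = (\<Oplus>i\<in>{..n}. \<Oplus>k\<in>{..i}. F k (i - k) (n - i))"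
    unfolding mult_coeff
  proof (intro finsum_cong')
    fix i assume i: "i \<in> {..n}"
    have "(\<rho> ^^ (n - i)) (\<Oplus>k\<in>{..i}. (\<rho> ^^ (i - k)) (p k) \<otimes> q (i - k)) =
          (\<Oplus>k\<in>{..i}. (\<rho> ^^ (n - i)) ((\<rho> ^^ (i - k)) (p k) \<otimes> q (i - k)))"
      using assms by (intro rho_pow_finsum) auto
    then have "(\<rho> ^^ (n - i)) (\<Oplus>k\<in>{..i}. (\<rho> ^^ (i - k)) (p k) \<otimes> q (i - k)) \<otimes> r (n - i) =
          (\<Oplus>k\<in>{..i}. (\<rho> ^^ (n - i)) ((\<rho> ^^ (i - k)) (p k) \<otimes> q (i - k)) \<otimes> r (n - i))"
      using assms by (simp add: finsum_ldistr)
    also have "\<dots> = (\<Oplus>k\<in>{..i}. F k (i - k) (n - i))"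
    proof (intro finsum_cong')
      fix k assume k: "k \<in> {..i}"
      have "\<rho> ^^ (n - k) = \<rho> ^^ (n - i) \<circ> \<rho> ^^ (i - k)"
        using i k by (simp flip: funpow_add)
      then show "(\<rho> ^^ (n - i)) ((\<rho> ^^ (i - k)) (p k) \<otimes> q (i - k)) \<otimes> r (n - i) = F k (i - k) (n - i)"
        using assms i k by (simp add: F_def rho_pow_hom m_assoc)
    qed (use F in auto)
    finally show "(\<rho> ^^ (n - i)) (\<Oplus>k\<in>{..i}. (\<rho> ^^ (i - k)) (p k) \<otimes> q (i - k)) \<otimes> r (n - i) =
                  (\<Oplus>k\<in>{..i}. F k (i - k) (n - i))" .
  qed (use F in auto)
  also have "\<dots> = (\<Oplus>k\<in>{..n}. \<Oplus>l\<in>{..n - k}. F k l (n - k - l))"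
    by (rule finsum_triangle) (rule F)
  also have "\<dots> = (p \<otimes>\<^bsub>P\<^esub> (q \<otimes>\<^bsub>P\<^esub> r)) n"
    unfolding mult_coeff
  proof (intro finsum_cong')
    fix k assume k: "k \<in> {..n}"
    have "(\<rho> ^^ (n - k)) (p k) \<otimes> (\<Oplus>l\<in>{..n - k}. (\<rho> ^^ (n - k - l)) (q l) \<otimes> r (n - k - l)) =
      (\<Oplus>l\<in>{..n - k}. (\<rho> ^^ (n - k)) (p k) \<otimes> ((\<rho> ^^ (n - k - l)) (q l) \<otimes> r (n - k - l)))"
      using assms by (intro finsum_rdistr) auto
    also have "\<dots> = (\<Oplus>l\<in>{..n - k}. F k l (n - k - l))"
      using assms by (intro finsum_cong') (auto simp: F_def simp del: diff_diff_left)
    finally show "(\<Oplus>l\<in>{..n - k}. F k l (n - k - l)) =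
      (\<rho> ^^ (n - k)) (p k) \<otimes> (\<Oplus>l\<in>{..n - k}. (\<rho> ^^ (n - k - l)) (q l) \<otimes> r (n - k - l))" ..
  qed (use assms in auto)
  finally show "(p \<otimes>\<^bsub>P\<^esub> q \<otimes>\<^bsub>P\<^esub> r) n = (p \<otimes>\<^bsub>P\<^esub> (q \<otimes>\<^bsub>P\<^esub> r)) n" .
qed

lemma skew_monom_closed [simp]: "c \<in> carrier B \<Longrightarrow> skew_monom B k c \<in> up B"
  by (intro mem_upI) (auto simp: skew_monom_def intro!: exI[of _ k])

lemma mult_monom_coeff:
  assumes "p \<in> up B" "c \<in> carrier B"
  shows "(p \<otimes>\<^bsub>P\<^esub> skew_monom B k c) n = (if k \<le> n then (\<rho> ^^ k) (p (n - k)) \<otimes> c else \<zero>)"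
proof (cases "k \<le> n")
  case True
  have "(p \<otimes>\<^bsub>P\<^esub> skew_monom B k c) n = (\<rho> ^^ (n - (n - k))) (p (n - k)) \<otimes> skew_monom B k c (n - (n - k))"
    unfolding mult_coeff
    by (rule finsum_single) (use assms True in \<open>auto simp: skew_monom_def\<close>)
  then show ?thesis using True by (simp add: skew_monom_def)
next
  case False
  have "(p \<otimes>\<^bsub>P\<^esub> skew_monom B k c) n = (\<Oplus>i\<in>{..n}. \<zero>)"
    unfolding mult_coeff
    by (rule finsum_cong') (use assms False in \<open>auto simp: skew_monom_def\<close>)
  then show ?thesis using False by simp
qed

lemma one_eq_monom: "\<one>\<^bsub>P\<^esub> = skew_monom B 0 \<one>"
  by (simp add: skew_monom_def)

lemma monom_mult_coeff:
  assumes "p \<in> up B" "c \<in> carrier B"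
  shows "(skew_monom B 0 c \<otimes>\<^bsub>P\<^esub> p) n = (\<rho> ^^ n) c \<otimes> p n"
proof -
  have "(skew_monom B 0 c \<otimes>\<^bsub>P\<^esub> p) n = (\<rho> ^^ (n - 0)) (skew_monom B 0 c 0) \<otimes> p (n - 0)"
    unfolding mult_coeff
    by (rule finsum_single) (use assms in \<open>auto simp: skew_monom_def\<close>)
  then show ?thesis by (simp add: skew_monom_def)
qed

sublocale P: ring "skew_poly B \<rho>"
proof (rule ringI)
  show "abelian_group P"
  proof (rule abelian_groupI)
    show "\<zero>\<^bsub>P\<^esub> \<in> carrier P" by (auto intro!: mem_upI)
  next
    fix p assume "p \<in> carrier P"
    then show "\<exists>q\<in>carrier P. q \<oplus>\<^bsub>P\<^esub> p = \<zero>\<^bsub>P\<^esub>"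
      by (intro bexI[of _ "\<lambda>n. \<ominus> p n"]) (auto simp: up_a_inv_closed l_neg)
    show "\<zero>\<^bsub>P\<^esub> \<oplus>\<^bsub>P\<^esub> p = p" using \<open>p \<in> carrier P\<close> by auto
  qed (auto simp: up_add_closed a_assoc intro: a_comm)
  show "monoid P"
  proof (rule monoidI)
    fix p assume p: "p \<in> carrier P"
    show "\<one>\<^bsub>P\<^esub> \<otimes>\<^bsub>P\<^esub> p = p" "p \<otimes>\<^bsub>P\<^esub> \<one>\<^bsub>P\<^esub> = p"
      using p unfolding one_eq_monom by (auto simp: mult_monom_coeff monom_mult_coeff)
  qed (auto simp: up_skew_mult_closed skew_mult_assoc up_one_closed)
next
  fix p q r assume pqr: "p \<in> carrier P" "q \<in> carrier P" "r \<in> carrier P"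
  show "(p \<oplus>\<^bsub>P\<^esub> q) \<otimes>\<^bsub>P\<^esub> r = p \<otimes>\<^bsub>P\<^esub> r \<oplus>\<^bsub>P\<^esub> q \<otimes>\<^bsub>P\<^esub> r"
  proof
    fix n
    have "((p \<oplus>\<^bsub>P\<^esub> q) \<otimes>\<^bsub>P\<^esub> r) n =
      (\<Oplus>i\<in>{..n}. (\<rho> ^^ (n - i)) (p i) \<otimes> r (n - i) \<oplus> (\<rho> ^^ (n - i)) (q i) \<otimes> r (n - i))"
      unfolding mult_coeff using pqr
      by (intro finsum_cong') (auto simp: rho_pow_hom l_distr)
    also have "\<dots> = (p \<otimes>\<^bsub>P\<^esub> r \<oplus>\<^bsub>P\<^esub> q \<otimes>\<^bsub>P\<^esub> r) n"
      using pqr by (simp add: finsum_addf mult_coeff)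
    finally show "((p \<oplus>\<^bsub>P\<^esub> q) \<otimes>\<^bsub>P\<^esub> r) n = (p \<otimes>\<^bsub>P\<^esub> r \<oplus>\<^bsub>P\<^esub> q \<otimes>\<^bsub>P\<^esub> r) n" .
  qed
  show "r \<otimes>\<^bsub>P\<^esub> (p \<oplus>\<^bsub>P\<^esub> q) = r \<otimes>\<^bsub>P\<^esub> p \<oplus>\<^bsub>P\<^esub> r \<otimes>\<^bsub>P\<^esub> q"
  proof
    fix n
    have "(r \<otimes>\<^bsub>P\<^esub> (p \<oplus>\<^bsub>P\<^esub> q)) n =
      (\<Oplus>i\<in>{..n}. (\<rho> ^^ (n - i)) (r i) \<otimes> p (n - i) \<oplus> (\<rho> ^^ (n - i)) (r i) \<otimes> q (n - i))"
      unfolding mult_coeff using pqr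
      by (intro finsum_cong') (auto simp: r_distr)
    also have "\<dots> = (r \<otimes>\<^bsub>P\<^esub> p \<oplus>\<^bsub>P\<^esub> r \<otimes>\<^bsub>P\<^esub> q) n"
      using pqr by (simp add: finsum_addf mult_coeff)
    finally show "(r \<otimes>\<^bsub>P\<^esub> (p \<oplus>\<^bsub>P\<^esub> q)) n = (r \<otimes>\<^bsub>P\<^esub> p \<oplus>\<^bsub>P\<^esub> r \<otimes>\<^bsub>P\<^esub> q) n" .
  qed
qed

end


context skew_poly_ring
begin

lemma X_pow_eq_monom: "skew_X B [^]\<^bsub>P\<^esub> (k::nat) = skew_monom B k \<one>"
proof (induction k)
  case 0
  show ?case unfolding P.nat_pow_0 by (rule one_eq_monom)
next
  case (Suc k)
  have X: "skew_X B = skew_monom B 1 \<one>"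
    by (auto simp: skew_X_def skew_monom_def)
  show ?case
    unfolding P.nat_pow_Suc Suc unfolding X
    by (rule ext) (auto simp: mult_monom_coeff skew_monom_apply)
qed

lemma X_pow_mult_const:
  "c \<in> carrier B \<Longrightarrow> skew_X B [^]\<^bsub>P\<^esub> (k::nat) \<otimes>\<^bsub>P\<^esub> skew_const B c = skew_monom B k c"
proof -
  assume c: "c \<in> carrier B"
  have C: "skew_const B c = skew_monom B 0 c"
    by (auto simp: skew_const_def skew_monom_def)
  show ?thesis
    unfolding X_pow_eq_monom C using c by (intro ext) (auto simp: mult_monom_coeff skew_monom_apply)
qed

lemma finsum_skew_coeff:
  assumes "finite I" "\<And>i. i \<in> I \<Longrightarrow> g i \<in> up B"
  shows "(\<Oplus>\<^bsub>P\<^esub>i\<in>I. g i) n = (\<Oplus>i\<in>I. g i n)"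
  using assms by (induction I rule: finite_induct) (simp_all add: Pi_iff)

lemma finsum_monom:
  assumes "\<And>j. j < m \<Longrightarrow> c j \<in> carrier B"
  shows "(\<Oplus>\<^bsub>P\<^esub>j\<in>{..<m}. skew_X B [^]\<^bsub>P\<^esub> j \<otimes>\<^bsub>P\<^esub> skew_const B (c j)) =
         (\<lambda>n. if n < m then c n else \<zero>)"
proof
  fix n
  have "(\<Oplus>\<^bsub>P\<^esub>j\<in>{..<m}. skew_X B [^]\<^bsub>P\<^esub> j \<otimes>\<^bsub>P\<^esub> skew_const B (c j)) =
        (\<Oplus>\<^bsub>P\<^esub>j\<in>{..<m}. skew_monom B j (c j))"
    using assms by (intro P.finsum_cong') (auto simp: X_pow_mult_const)
  then have "(\<Oplus>\<^bsub>P\<^esub>j\<in>{..<m}. skew_X B [^]\<^bsub>P\<^esub> j \<otimes>\<^bsub>P\<^esub> skew_const B (c j)) n =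
        (\<Oplus>j\<in>{..<m}. skew_monom B j (c j) n)"
    using assms by (simp only:) (rule finsum_skew_coeff, auto)
  also have "\<dots> = (if n < m then c n else \<zero>)"
  proof (cases "n < m")
    case True
    have "(\<Oplus>j\<in>{..<m}. skew_monom B j (c j) n) = skew_monom B n (c n) n"
      using assms True by (intro finsum_single) (auto simp: skew_monom_def)
    then show ?thesis using True by (simp add: skew_monom_def)
  next
    case False
    have "(\<Oplus>j\<in>{..<m}. skew_monom B j (c j) n) = (\<Oplus>j\<in>{..<m}. \<zero>)"
      using assms False by (intro finsum_cong') (auto simp: skew_monom_def)
    then show ?thesis using False by simp
  qed
  finally show "(\<Oplus>\<^bsub>P\<^esub>j\<in>{..<m}. skew_X B [^]\<^bsub>P\<^esub> j \<otimes>\<^bsub>P\<^esub> skew_const B (c j)) n =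
      (if n < m then c n else \<zero>)" .
qed

lemma map_rho_closed [simp]: "p \<in> up B \<Longrightarrow> \<rho> \<circ> p \<in> up B"
proof
  assume p: "p \<in> up B"
  then obtain n where "bound \<zero> n p" by blast
  then have "bound \<zero> n (\<rho> \<circ> p)" by (auto simp: bound_def)
  then show "\<exists>n. bound \<zero> n (\<rho> \<circ> p)" ..
  show "(\<rho> \<circ> p) n \<in> carrier B" for n using p by simp
qed

text \<open>Since \<open>\<rho>\<close> commutes with its own powers, applying it to all coefficients respects the twisted
  convolution; on the quotient by \<open>f\<close> this is the automorphism called \<open>\<rho>\<close>-tilde.\<close>

lemma map_rho_hom: "(\<lambda>p. \<rho> \<circ> p) \<in> ring_hom P P"
proof (rule ring_hom_memI)
  fix p q assume pq: "p \<in> carrier P" "q \<in> carrier P"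
  show "\<rho> \<circ> (p \<oplus>\<^bsub>P\<^esub> q) = (\<rho> \<circ> p) \<oplus>\<^bsub>P\<^esub> (\<rho> \<circ> q)"
    using pq rho_pow_hom(2)[of _ _ 1] by auto
  show "\<rho> \<circ> (p \<otimes>\<^bsub>P\<^esub> q) = (\<rho> \<circ> p) \<otimes>\<^bsub>P\<^esub> (\<rho> \<circ> q)"
  proof
    fix n
    have "(\<rho> \<circ> (p \<otimes>\<^bsub>P\<^esub> q)) n = (\<rho> ^^ 1) (\<Oplus>i\<in>{..n}. (\<rho> ^^ (n - i)) (p i) \<otimes> q (n - i))"
      by (simp add: mult_coeff)
    also have "\<dots> = (\<Oplus>i\<in>{..n}. (\<rho> ^^ 1) ((\<rho> ^^ (n - i)) (p i) \<otimes> q (n - i)))"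
      using pq by (intro rho_pow_finsum) auto
    also have "\<dots> = ((\<rho> \<circ> p) \<otimes>\<^bsub>P\<^esub> (\<rho> \<circ> q)) n"
      unfolding mult_coeff using pq rho_pow_hom(1)[of _ _ 1]
      by (intro finsum_cong') (auto simp: funpow_swap1)
    finally show "(\<rho> \<circ> (p \<otimes>\<^bsub>P\<^esub> q)) n = ((\<rho> \<circ> p) \<otimes>\<^bsub>P\<^esub> (\<rho> \<circ> q)) n" .
  qed
qed (auto intro!: ext)

lemma const_hom: "skew_const B \<in> ring_hom B P"
proof (rule ring_hom_memI)
  have C: "skew_const B c = skew_monom B 0 c" for c
    by (auto simp: skew_const_def skew_monom_def)
  fix b c assume "b \<in> carrier B" "c \<in> carrier B"
  then show "skew_const B (b \<otimes> c) = skew_const B b \<otimes>\<^bsub>P\<^esub> skew_const B c"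
    unfolding C by (intro ext) (auto simp: mult_monom_coeff skew_monom_apply)
qed (auto simp: skew_const_def intro!: mem_upI ext)

end


section \<open>Division by a monic polynomial\<close>

locale skew_monic = skew_poly_ring +
  fixes m :: nat and f :: "nat \<Rightarrow> 'a"
  assumes monic: "monic_of_degree B m f"
    and f_0: "f \<in> skew_poly_0 B \<rho>"
    and f_fixed: "\<And>j. f j \<in> fixed_ring B \<rho>"
begin

lemma f_closed [simp]: "f \<in> up B" and f_lead [simp]: "f m = \<one>"
  and f_above: "n > m \<Longrightarrow> f n = \<zero>"
  using monic by (auto simp: monic_of_degree_def)

lemma f_coeff [simp]: "f j \<in> carrier B" and rho_f [simp]: "\<rho> (f j) = f j"
  using f_fixed[of j] by (auto simp: fixed_ring_def)

lemma rho_pow_f [simp]: "(\<rho> ^^ k) (f j) = f j"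
  by (induction k) auto

text \<open>Since \<open>f\<close> is monic with coefficients fixed by \<open>\<rho>\<close>, subtracting \<open>f X\<^sup>N\<^sup>-\<^sup>m p\<^sub>N\<close> from a
  polynomial \<open>p\<close> of degree at most \<open>N \<ge> m\<close> removes its coefficient at \<open>N\<close>.\<close>

lemma division:
  assumes "p \<in> up B"
  obtains q r where "q \<in> up B" "r \<in> up B" "p = f \<otimes>\<^bsub>P\<^esub> q \<oplus>\<^bsub>P\<^esub> r" "\<And>n. n \<ge> m \<Longrightarrow> r n = \<zero>"
proof -
  have "\<exists>q\<in>carrier P. \<exists>r\<in>carrier P. p = f \<otimes>\<^bsub>P\<^esub> q \<oplus>\<^bsub>P\<^esub> r \<and> (\<forall>n\<ge>m. r n = \<zero>)"
    if "p \<in> carrier P" "\<forall>n\<ge>N. p n = \<zero>" for p N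
    using that
  proof (induction N arbitrary: p)
    case 0
    then show ?case
      by (intro bexI[of _ "\<zero>\<^bsub>P\<^esub>"] bexI[of _ p]) (simp_all del: skew_poly_simps(2,4), auto)
  next
    case (Suc N)
    show ?case
    proof (cases "N < m")
      case True
      then show ?thesis using Suc.prems
        by (intro bexI[of _ "\<zero>\<^bsub>P\<^esub>"] bexI[of _ p]) (simp_all del: skew_poly_simps(2,4), auto)
    next
      case False
      define g where "g = skew_monom B (N - m) (p N)"
      have g: "g \<in> carrier P" using Suc.prems by (simp add: g_def)
      have fg: "(f \<otimes>\<^bsub>P\<^esub> g) n = (if N - m \<le> n then f (n - (N - m)) \<otimes> p N else \<zero>)" for n
        unfolding g_def using Suc.prems by (subst mult_monom_coeff) auto
      have fgC: "f \<otimes>\<^bsub>P\<^esub> g \<in> carrier P" using g by (intro P.m_closed) auto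
      define p' where "p' = (\<lambda>n. p n \<ominus> (f \<otimes>\<^bsub>P\<^esub> g) n)"
      have p': "p' \<in> carrier P"
        unfolding p'_def using Suc.prems fgC by (simp add: up_minus_closed)
      have "p' n = \<zero>" if "n \<ge> N" for n
      proof (cases "n = N")
        case True
        then show ?thesis using False Suc.prems by (simp add: p'_def fg r_neg a_minus_def)
      next
        case n: False
        then have "f (n - (N - m)) = \<zero>" using False that by (intro f_above) auto
        then show ?thesis using n that Suc.prems by (simp add: p'_def fg a_minus_def)
      qed
      then obtain q r where qr: "q \<in> carrier P" "r \<in> carrier P" "p' = f \<otimes>\<^bsub>P\<^esub> q \<oplus>\<^bsub>P\<^esub> r" "\<forall>n\<ge>m. r n = \<zero>"
        using Suc.IH[OF p'] by blast
      have "p = f \<otimes>\<^bsub>P\<^esub> g \<oplus>\<^bsub>P\<^esub> p'"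
        using Suc.prems fgC by (auto simp: p'_def a_minus_def a_ac r_neg)
      also have "\<dots> = f \<otimes>\<^bsub>P\<^esub> (g \<oplus>\<^bsub>P\<^esub> q) \<oplus>\<^bsub>P\<^esub> r"
        using qr(1-3) g f_closed[folded skew_poly_simps(1)[of B \<rho>]]
        by (simp add: P.r_distr P.a_assoc del: skew_poly_simps)
      finally show ?thesis using qr g by blast
    qed
  qed
  moreover obtain N where "bound \<zero> N p" using assms by blast
  then have "\<forall>n\<ge>Suc N. p n = \<zero>" by (auto simp: bound_def)
  ultimately show thesis using that assms
    by (metis skew_poly_simps(1))
qed

text \<open>If \<open>q\<close> has degree \<open>d\<close>, then \<open>f q\<close> has the same coefficient at \<open>m + d\<close> as \<open>q\<close> at \<open>d\<close>, because
  \<open>f\<close> is monic and \<open>\<rho>(1) = 1\<close>. This gives uniqueness of remainders.\<close>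

lemma low_degree_multiple:
  assumes q: "q \<in> up B" and low: "\<And>n. n \<ge> m \<Longrightarrow> (f \<otimes>\<^bsub>P\<^esub> q) n = \<zero>"
  shows "q = \<zero>\<^bsub>P\<^esub>"
proof (rule ccontr)
  assume "q \<noteq> \<zero>\<^bsub>P\<^esub>"
  then obtain n where n: "q n \<noteq> \<zero>" by auto
  obtain N where N: "\<And>n. N < n \<Longrightarrow> q n = \<zero>" using q by (auto dest!: bound_upD simp: bound_def)
  (* the degree of q *)
  define d where "d = (GREATEST n. q n \<noteq> \<zero>)"
  have "q d \<noteq> \<zero>" unfolding d_def
    by (rule GreatestI_nat[of _ n N]) (use n N in \<open>auto simp: not_less[symmetric]\<close>)
  moreover have above: "q n = \<zero>" if "n > d" for n
    using that Greatest_le_nat[of "\<lambda>n. q n \<noteq> \<zero>" n N] N unfolding d_def by (meson not_less)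
  have "(f \<otimes>\<^bsub>P\<^esub> q) (m + d) = (\<rho> ^^ (m + d - m)) (f m) \<otimes> q (m + d - m)"
    unfolding mult_coeff
  proof (rule finsum_single)
    fix j assume "j \<in> {..m + d}" "j \<noteq> m"
    then show "(\<rho> ^^ (m + d - j)) (f j) \<otimes> q (m + d - j) = \<zero>"
      using q by (cases "j < m") (auto simp: above f_above)
  qed (use q in auto)
  ultimately show False using low[of "m + d"] q by simp
qed

lemma skew_ideal_iff: "p \<in> skew_ideal B \<rho> f \<longleftrightarrow> (\<exists>q\<in>up B. p = f \<otimes>\<^bsub>P\<^esub> q)"
  by (auto simp: skew_ideal_def l_coset_def)

text \<open>The set \<open>f P\<close> is a right ideal; the equality \<open>f P = P f\<close> makes it a left ideal as well.\<close>

lemma ideal_skew_ideal: "ideal (skew_ideal B \<rho> f) P"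
proof -
  have sw: "skew_ideal B \<rho> f = carrier P #>\<^bsub>P\<^esub> f"
    using f_0 by (simp add: skew_poly_0_def skew_ideal_def)
  have sw': "p \<in> skew_ideal B \<rho> f \<longleftrightarrow> (\<exists>q\<in>up B. p = q \<otimes>\<^bsub>P\<^esub> f)" for p
    unfolding sw by (auto simp: r_coset_def)
  have cl: "f \<in> carrier P" by simp
  show ?thesis
  proof (rule idealI)
    show "ring P" by (rule P.ring_axioms)
    show "subgroup (skew_ideal B \<rho> f) (add_monoid P)"
    proof (rule P.add.subgroupI)
      show "skew_ideal B \<rho> f \<subseteq> carrier P"
        using P.m_closed[OF cl] by (auto simp: skew_ideal_iff simp del: skew_poly_simps(2-))
      show "skew_ideal B \<rho> f \<noteq> {}" using skew_ideal_iff P.zero_closed skew_poly_simps(1) by blast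
    next
      fix p assume "p \<in> skew_ideal B \<rho> f"
      then obtain q where q: "q \<in> carrier P" "p = f \<otimes>\<^bsub>P\<^esub> q" by (auto simp: skew_ideal_iff)
      then have "\<ominus>\<^bsub>P\<^esub> p = f \<otimes>\<^bsub>P\<^esub> (\<ominus>\<^bsub>P\<^esub> q)" using cl by (simp add: P.r_minus)
      then show "\<ominus>\<^bsub>P\<^esub> p \<in> skew_ideal B \<rho> f"
        using P.a_inv_closed[OF q(1)] unfolding skew_ideal_iff skew_poly_simps(1) by blast
    next
      fix p p' assume "p \<in> skew_ideal B \<rho> f" "p' \<in> skew_ideal B \<rho> f"
      then obtain q q' where q: "q \<in> carrier P" "p = f \<otimes>\<^bsub>P\<^esub> q" "q' \<in> carrier P" "p' = f \<otimes>\<^bsub>P\<^esub> q'"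
        by (auto simp: skew_ideal_iff)
      then have "p \<oplus>\<^bsub>P\<^esub> p' = f \<otimes>\<^bsub>P\<^esub> (q \<oplus>\<^bsub>P\<^esub> q')" using cl by (simp only: P.r_distr)
      then show "p \<oplus>\<^bsub>P\<^esub> p' \<in> skew_ideal B \<rho> f"
        using P.a_closed[OF q(1) q(3)] unfolding skew_ideal_iff skew_poly_simps(1) by blast
    qed
  next
    fix p r assume "p \<in> skew_ideal B \<rho> f" and r: "r \<in> carrier P"
    then obtain q where q: "q \<in> carrier P" "p = f \<otimes>\<^bsub>P\<^esub> q" by (auto simp: skew_ideal_iff)
    then have "p \<otimes>\<^bsub>P\<^esub> r = f \<otimes>\<^bsub>P\<^esub> (q \<otimes>\<^bsub>P\<^esub> r)" using cl r by (simp only: P.m_assoc)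
    then show "p \<otimes>\<^bsub>P\<^esub> r \<in> skew_ideal B \<rho> f"
      using P.m_closed[OF q(1) r] unfolding skew_ideal_iff skew_poly_simps(1) by blast
  next
    fix p r assume "p \<in> skew_ideal B \<rho> f" and r: "r \<in> carrier P"
    then obtain q where q: "q \<in> carrier P" "p = q \<otimes>\<^bsub>P\<^esub> f" by (auto simp: sw')
    then have "r \<otimes>\<^bsub>P\<^esub> p = (r \<otimes>\<^bsub>P\<^esub> q) \<otimes>\<^bsub>P\<^esub> f" using cl r by (simp only: P.m_assoc)
    then show "r \<otimes>\<^bsub>P\<^esub> p \<in> skew_ideal B \<rho> f"
      using P.m_closed[OF r q(1)] unfolding sw' skew_poly_simps(1) by blast
  qed
qed

end


section \<open>Tensor products and separability elements\<close>

text \<open>The additive extension of a map on pairs to formal integer combinations. Multiplication on the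
  tensor product is one instance; the other instances are functionals that extract information
  from a separability element.\<close>

definition frag_eval :: "('r, 'n) ring_scheme \<Rightarrow> ('p \<Rightarrow> 'r) \<Rightarrow> ('p \<Rightarrow>\<^sub>0 int) \<Rightarrow> 'r" where
  "frag_eval A g c = (\<Oplus>\<^bsub>A\<^esub>p\<in>Poly_Mapping.keys c. [Poly_Mapping.lookup c p] \<cdot>\<^bsub>A\<^esub> g p)"

lemmas frag_span_induct = free_Abelian_group_induct [consumes 1, case_names zero diff single]

lemma pair_eval_eq: "pair_eval A = frag_eval A (\<lambda>p. fst p \<otimes>\<^bsub>A\<^esub> snd p)"
  by (simp add: pair_eval_def frag_eval_def fun_eq_iff)

definition pair_act :: "('r, 'n) ring_scheme \<Rightarrow> 'r \<Rightarrow> 'r \<Rightarrow> ('r \<times> 'r \<Rightarrow>\<^sub>0 int) \<Rightarrow> ('r \<times> 'r \<Rightarrow>\<^sub>0 int)" where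
  "pair_act A a b = frag_extend (\<lambda>(u, v). frag_of (a \<otimes>\<^bsub>A\<^esub> u, v \<otimes>\<^bsub>A\<^esub> b))"

context ring
begin

lemma minus_eq_zeroD:
  assumes "a \<ominus> b = \<zero>" "a \<in> carrier R" "b \<in> carrier R"
  shows "a = b"
proof -
  have "a = (a \<ominus> b) \<oplus> b" using assms(2,3) by (simp add: a_minus_def a_assoc l_neg)
  then show ?thesis using assms by simp
qed

lemma add_pow_int_closed [simp]: "a \<in> carrier R \<Longrightarrow> [(k::int)] \<cdot> a \<in> carrier R"
  by (rule add.int_pow_closed)

lemma add_pow_int_zero [simp]: "[(0::int)] \<cdot> a = \<zero>"
  by (simp add: add_pow_def)

lemma frag_eval_superset:
  assumes "finite S" "Poly_Mapping.keys c \<subseteq> S" "g \<in> S \<rightarrow> carrier R"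
  shows "frag_eval R g c = (\<Oplus>p\<in>S. [Poly_Mapping.lookup c p] \<cdot> g p)"
  unfolding frag_eval_def
  by (rule add.finprod_mono_neutral_cong_left)
    (use assms in \<open>auto simp: in_keys_iff\<close>)

lemma frag_eval_closed [simp]:
  "g \<in> Poly_Mapping.keys c \<rightarrow> carrier R \<Longrightarrow> frag_eval R g c \<in> carrier R"
  unfolding frag_eval_def by (intro finsum_closed) auto

lemma frag_eval_add:
  assumes "Poly_Mapping.keys c \<subseteq> S" "Poly_Mapping.keys d \<subseteq> S" "g \<in> S \<rightarrow> carrier R"
  shows "frag_eval R g (c + d) = frag_eval R g c \<oplus> frag_eval R g d"
proof -
  let ?S = "Poly_Mapping.keys c \<union> Poly_Mapping.keys d"
  have g: "g \<in> ?S \<rightarrow> carrier R" using assms by blast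
  have *: "frag_eval R g e = (\<Oplus>p\<in>?S. [Poly_Mapping.lookup e p] \<cdot> g p)"
    if "Poly_Mapping.keys e \<subseteq> ?S" for e
    using that g by (intro frag_eval_superset) auto
  have "frag_eval R g (c + d) = (\<Oplus>p\<in>?S. [Poly_Mapping.lookup c p] \<cdot> g p \<oplus> [Poly_Mapping.lookup d p] \<cdot> g p)"
    unfolding *[OF Poly_Mapping.keys_add] using g
    by (intro finsum_cong') (auto simp: lookup_add add.int_pow_mult Pi_iff)
  also have "\<dots> = frag_eval R g c \<oplus> frag_eval R g d"
    using g by (subst finsum_addf) (auto simp: *)
  finally show ?thesis .
qed

lemma frag_eval_zero [simp]: "frag_eval R g 0 = \<zero>"
  by (simp add: frag_eval_def)

lemma frag_eval_minus:
  assumes "g \<in> Poly_Mapping.keys c \<rightarrow> carrier R"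
  shows "frag_eval R g (- c) = \<ominus> frag_eval R g c"
proof -
  have "frag_eval R g (- c + c) = frag_eval R g (- c) \<oplus> frag_eval R g c"
    using assms by (intro frag_eval_add[of _ "Poly_Mapping.keys c"]) auto
  then show ?thesis using assms
    by (intro minus_equality[symmetric]) auto
qed

lemma frag_eval_diff:
  assumes "Poly_Mapping.keys c \<subseteq> S" "Poly_Mapping.keys d \<subseteq> S" "g \<in> S \<rightarrow> carrier R"
  shows "frag_eval R g (c - d) = frag_eval R g c \<ominus> frag_eval R g d"
proof -
  have "g \<in> Poly_Mapping.keys d \<rightarrow> carrier R" using assms by blast
  then show ?thesis
    using frag_eval_add[of c S "- d" g] frag_eval_minus[of g d] assms by (simp add: a_minus_def)
qed

lemma frag_eval_of [simp]: "g p \<in> carrier R \<Longrightarrow> frag_eval R g (frag_of p) = g p"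
  by (simp add: frag_eval_def)


end

locale ring_ext = ring A for A (structure) +
  fixes K :: "'a set"
  assumes K_sub: "K \<subseteq> carrier A"
begin

abbreviation AA :: "('a \<times> 'a) set" where "AA \<equiv> carrier A \<times> carrier A"
abbreviation N where "N \<equiv> tensor_kernel A K"

lemma K_closed [simp, intro]: "k \<in> K \<Longrightarrow> k \<in> carrier A"
  using K_sub by blast

lemma keys_diff_sub: "Poly_Mapping.keys c \<subseteq> S \<Longrightarrow> Poly_Mapping.keys d \<subseteq> S \<Longrightarrow> Poly_Mapping.keys (c - d) \<subseteq> S"
  using keys_diff[of c d] by blast

lemma keys_add_sub: "Poly_Mapping.keys c \<subseteq> S \<Longrightarrow> Poly_Mapping.keys d \<subseteq> S \<Longrightarrow> Poly_Mapping.keys (c + d) \<subseteq> S"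
  using Poly_Mapping.keys_add[of c d] by blast

lemma relators_keys: "c \<in> tensor_relators A K \<Longrightarrow> Poly_Mapping.keys c \<subseteq> AA"
  unfolding tensor_relators_def
  by (elim UnE CollectE exE conjE; hypsubst; intro keys_diff_sub; simp)

lemma subgroup_kernel: "subgroup N (pair_group A)"
  unfolding tensor_kernel_def
  by (rule group.generate_is_subgroup) (use relators_keys in auto)

lemma kernel_keys: "c \<in> N \<Longrightarrow> Poly_Mapping.keys c \<subseteq> AA"
  using subgroup.subset[OF subgroup_kernel] by (metis carrier_free_Abelian_group_iff subsetD)

lemma kernel_zero [simp]: "0 \<in> N"
  using subgroup.one_closed[OF subgroup_kernel] by simp

lemma kernel_add: "c \<in> N \<Longrightarrow> d \<in> N \<Longrightarrow> c + d \<in> N"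
  using subgroup.m_closed[OF subgroup_kernel, of c d] by simp

lemma kernel_minus: "c \<in> N \<Longrightarrow> - c \<in> N"
  using subgroup.m_inv_closed[OF subgroup_kernel, of c] kernel_keys[of c] by simp

lemma kernel_diff: "c \<in> N \<Longrightarrow> d \<in> N \<Longrightarrow> c - d \<in> N"
  using kernel_add[of c "- d"] kernel_minus[of d] by simp

lemma kernel_relator: "c \<in> tensor_relators A K \<Longrightarrow> c \<in> N"
  unfolding tensor_kernel_def by (rule generate.incl)

lemma kernel_induct [consumes 1, case_names zero relator minus add]:
  assumes "c \<in> N" "Q 0" "\<And>c. c \<in> tensor_relators A K \<Longrightarrow> Q c"
    "\<And>c. c \<in> tensor_relators A K \<Longrightarrow> Q c \<Longrightarrow> Q (- c)"
    "\<And>c d. c \<in> N \<Longrightarrow> d \<in> N \<Longrightarrow> Q c \<Longrightarrow> Q d \<Longrightarrow> Q (c + d)"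
  shows "Q c"
  using assms(1) unfolding tensor_kernel_def
proof (induction rule: generate.induct)
  case (inv h)
  then show ?case using assms(3,4) relators_keys[of h] by simp
next
  case (eng h1 h2)
  then show ?case using assms(5) by (simp add: tensor_kernel_def)
qed (use assms in auto)

definition balanced :: "('a \<times> 'a \<Rightarrow> 'a) \<Rightarrow> bool" where
  "balanced g \<longleftrightarrow> g \<in> AA \<rightarrow> carrier A \<and>
     (\<forall>u\<in>carrier A. \<forall>u'\<in>carrier A. \<forall>v\<in>carrier A. g (u \<oplus> u', v) = g (u, v) \<oplus> g (u', v)) \<and>
     (\<forall>u\<in>carrier A. \<forall>v\<in>carrier A. \<forall>v'\<in>carrier A. g (u, v \<oplus> v') = g (u, v) \<oplus> g (u, v')) \<and>
     (\<forall>u\<in>carrier A. \<forall>k\<in>K. \<forall>v\<in>carrier A. g (u \<otimes> k, v) = g (u, k \<otimes> v))"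

text \<open>The universal property of the tensor product: a balanced biadditive map kills all relations.\<close>

lemma frag_eval_kernel:
  assumes "balanced g" "c \<in> N"
  shows "frag_eval A g c = \<zero>"
  using assms(2)
proof (induction rule: kernel_induct)
  case (relator c)
  have g: "g \<in> AA \<rightarrow> carrier A" using assms(1) by (simp add: balanced_def)
  note D = frag_eval_diff[OF _ _ g]
  have gC: "g (u, v) \<in> carrier A" if "u \<in> carrier A" "v \<in> carrier A" for u v using g that by auto
  from relator show ?case
    unfolding tensor_relators_def
  proof (elim UnE CollectE exE conjE)
    fix u u' v assume c: "c = frag_of (u \<oplus> u', v) - frag_of (u, v) - frag_of (u', v)"
      and uv: "u \<in> carrier A" "u' \<in> carrier A" "v \<in> carrier A"
    have "frag_eval A g c = g (u \<oplus> u', v) \<ominus> g (u, v) \<ominus> g (u', v)"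
      unfolding c using uv gC by (simp add: D keys_diff_sub)
    then show ?thesis using assms(1) uv gC
      by (auto simp: balanced_def a_minus_def a_ac r_neg minus_add r_neg1)
  next
    fix u v v' assume c: "c = frag_of (u, v \<oplus> v') - frag_of (u, v) - frag_of (u, v')"
      and uv: "u \<in> carrier A" "v \<in> carrier A" "v' \<in> carrier A"
    have "frag_eval A g c = g (u, v \<oplus> v') \<ominus> g (u, v) \<ominus> g (u, v')"
      unfolding c using uv gC by (simp add: D keys_diff_sub)
    then show ?thesis using assms(1) uv gC
      by (auto simp: balanced_def a_minus_def a_ac r_neg minus_add r_neg1)
  next
    fix u k v assume c: "c = frag_of (u \<otimes> k, v) - frag_of (u, k \<otimes> v)"
      and uv: "u \<in> carrier A" "k \<in> K" "v \<in> carrier A"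
    have "frag_eval A g c = g (u \<otimes> k, v) \<ominus> g (u, k \<otimes> v)"
      unfolding c using uv gC by (simp add: D keys_diff_sub)
    then show ?thesis using assms(1) uv gC
      by (simp add: balanced_def a_minus_def r_neg)
  qed
next
  case (minus c)
  then show ?case
    using assms(1) relators_keys[of c] by (subst frag_eval_minus) (auto simp: balanced_def)
next
  case (add c d)
  then show ?case
    using assms(1) kernel_keys
    by (subst frag_eval_add[of _ AA]) (auto simp: balanced_def)
qed simp

lemma frag_eval_eq_of_kernel:
  assumes "balanced g" "c - d \<in> N" "Poly_Mapping.keys c \<subseteq> AA" "Poly_Mapping.keys d \<subseteq> AA"
  shows "frag_eval A g c = frag_eval A g d"
proof -
  have g: "g \<in> AA \<rightarrow> carrier A" using assms(1) by (simp add: balanced_def)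
  have "frag_eval A g c \<ominus> frag_eval A g d = \<zero>"
    using frag_eval_kernel[OF assms(1,2)] frag_eval_diff[OF assms(3,4) g] by simp
  moreover have "frag_eval A g c \<in> carrier A" "frag_eval A g d \<in> carrier A"
    using g assms(3,4) by (auto intro!: frag_eval_closed)
  ultimately show ?thesis by (rule minus_eq_zeroD)
qed

lemma balanced_mult: "balanced (\<lambda>p. fst p \<otimes> snd p)"
  by (auto simp: balanced_def l_distr r_distr m_assoc)

lemma pair_act_of [simp]: "pair_act A a b (frag_of (u, v)) = frag_of (a \<otimes> u, v \<otimes> b)"
  by (simp add: pair_act_def)

lemma pair_act_add: "pair_act A a b (c + d) = pair_act A a b c + pair_act A a b d"
  and pair_act_diff: "pair_act A a b (c - d) = pair_act A a b c - pair_act A a b d"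
  and pair_act_minus: "pair_act A a b (- c) = - pair_act A a b c"
  and pair_act_zero [simp]: "pair_act A a b 0 = 0"
  by (simp_all add: pair_act_def frag_extend_add frag_extend_diff frag_extend_minus)

lemma pair_act_keys:
  assumes "Poly_Mapping.keys c \<subseteq> AA" "a \<in> carrier A" "b \<in> carrier A"
  shows "Poly_Mapping.keys (pair_act A a b c) \<subseteq> AA"
  using assms(1)
proof (induction rule: frag_span_induct)
  case (diff x y)
  then show ?case by (simp add: pair_act_diff keys_diff_sub)
qed (use assms in auto)

lemma pair_act_comp:
  assumes "Poly_Mapping.keys c \<subseteq> AA"
    "a \<in> carrier A" "b \<in> carrier A" "a' \<in> carrier A" "b' \<in> carrier A"
  shows "pair_act A a b (pair_act A a' b' c) = pair_act A (a \<otimes> a') (b' \<otimes> b) c"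
  using assms(1)
proof (induction rule: frag_span_induct)
  case (diff x y)
  then show ?case by (simp add: pair_act_diff)
qed (use assms in \<open>auto simp: m_assoc\<close>)

lemma pair_act_kernel:
  assumes "c \<in> N" "a \<in> carrier A" "b \<in> carrier A"
  shows "pair_act A a b c \<in> N"
  using assms(1)
proof (induction rule: kernel_induct)
  case (relator c)
  have "pair_act A a b c \<in> tensor_relators A K"
    using relator unfolding tensor_relators_def
  proof (elim UnE CollectE exE conjE, goal_cases)
    case (1 u u' v)
    then show ?case using assms
      by (intro UnI1 CollectI exI[of _ "a \<otimes> u"] exI[of _ "a \<otimes> u'"] exI[of _ "v \<otimes> b"])
         (auto simp: pair_act_diff r_distr)
  next
    case (2 u v v')
    then show ?case using assms
      by (intro UnI1[OF UnI2] CollectI exI[of _ "a \<otimes> u"] exI[of _ "v \<otimes> b"] exI[of _ "v' \<otimes> b"])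
         (auto simp: pair_act_diff l_distr)
  next
    case (3 u k v)
    then show ?case using assms
      by (intro UnI2 CollectI exI[of _ "a \<otimes> u"] exI[of _ "k"] exI[of _ "v \<otimes> b"])
         (auto simp: pair_act_diff m_assoc)
  qed
  then show ?case by (rule kernel_relator)
qed (auto simp: pair_act_add pair_act_minus kernel_add kernel_minus)

lemma pair_act_biadditive:
  assumes "Poly_Mapping.keys c \<subseteq> AA"
    "a \<in> carrier A" "a' \<in> carrier A" "b \<in> carrier A"
  shows "pair_act A (a \<oplus> a') b c - (pair_act A a b c + pair_act A a' b c) \<in> N"
    and "pair_act A b (a \<oplus> a') c - (pair_act A b a c + pair_act A b a' c) \<in> N"
proof -
  have "pair_act A (a \<oplus> a') b c - pair_act A a b c - pair_act A a' b c \<in> N \<and>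
        pair_act A b (a \<oplus> a') c - pair_act A b a c - pair_act A b a' c \<in> N"
    using assms(1)
  proof (induction rule: frag_span_induct)
    case (diff x y)
    have rearrange: "X - Y - (X' - Y') - (X'' - Y'') = X - X' - X'' - (Y - Y' - Y'')" for X Y X' Y' X'' Y'' :: "'a \<times> 'a \<Rightarrow>\<^sub>0 int"
      by (simp add: algebra_simps)
    show ?case using diff unfolding pair_act_diff rearrange by (auto intro: kernel_diff)
  next
    case (single p)
    obtain u v where p: "p = (u, v)" "u \<in> carrier A" "v \<in> carrier A" using single by auto
    have "pair_act A (a \<oplus> a') b (frag_of p) - pair_act A a b (frag_of p) - pair_act A a' b (frag_of p) \<in> tensor_relators A K"
      unfolding p(1) pair_act_of tensor_relators_def using p assms
      by (intro UnI1 CollectI exI[of _ "a \<otimes> u"] exI[of _ "a' \<otimes> u"] exI[of _ "v \<otimes> b"])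
         (auto simp: l_distr)
    moreover have "pair_act A b (a \<oplus> a') (frag_of p) - pair_act A b a (frag_of p) - pair_act A b a' (frag_of p) \<in> tensor_relators A K"
      unfolding p(1) pair_act_of tensor_relators_def using p assms
      by (intro UnI1[OF UnI2] CollectI exI[of _ "b \<otimes> u"] exI[of _ "v \<otimes> a"] exI[of _ "v \<otimes> a'"])
         (auto simp: r_distr)
    ultimately show ?case using kernel_relator by blast
  qed simp
  then show "pair_act A (a \<oplus> a') b c - (pair_act A a b c + pair_act A a' b c) \<in> N"
    "pair_act A b (a \<oplus> a') c - (pair_act A b a c + pair_act A b a' c) \<in> N"
    by (simp_all add: diff_diff_eq)
qed

lemma frag_eval_pair_act:
  assumes "Poly_Mapping.keys c \<subseteq> AA" "a \<in> carrier A" "b \<in> carrier A" "g \<in> AA \<rightarrow> carrier A"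
  shows "frag_eval A g (pair_act A a b c) = frag_eval A (\<lambda>p. g (a \<otimes> fst p, snd p \<otimes> b)) c"
  using assms(1)
proof (induction rule: frag_span_induct)
  case (diff x y)
  have g': "(\<lambda>p. g (a \<otimes> fst p, snd p \<otimes> b)) \<in> AA \<rightarrow> carrier A"
    using assms by auto
  show ?case
    unfolding pair_act_diff
    using diff by (simp add: frag_eval_diff[OF _ _ assms(4)] frag_eval_diff[OF _ _ g'] pair_act_keys assms)
next
  case (single p)
  then show ?case using assms by (cases p) (auto simp: Pi_iff)
qed simp

lemma frag_eval_fun_add:
  assumes "Poly_Mapping.keys c \<subseteq> AA" "g \<in> AA \<rightarrow> carrier A" "g' \<in> AA \<rightarrow> carrier A"
  shows "frag_eval A (\<lambda>p. g p \<oplus> g' p) c = frag_eval A g c \<oplus> frag_eval A g' c"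
proof -
  have "frag_eval A (\<lambda>p. g p \<oplus> g' p) c =
    (\<Oplus>p\<in>Poly_Mapping.keys c. [Poly_Mapping.lookup c p] \<cdot> g p \<oplus> [Poly_Mapping.lookup c p] \<cdot> g' p)"
    unfolding frag_eval_def using assms
    by (intro finsum_cong') (auto simp: add.int_pow_distrib Pi_iff subset_iff)
  also have "\<dots> = frag_eval A g c \<oplus> frag_eval A g' c"
    unfolding frag_eval_def using assms by (intro finsum_addf) (auto simp: Pi_iff subset_iff)
  finally show ?thesis .
qed

lemma frag_eval_rmult:
  assumes "Poly_Mapping.keys c \<subseteq> AA" "g \<in> AA \<rightarrow> carrier A" "a \<in> carrier A"
  shows "frag_eval A (\<lambda>p. g p \<otimes> a) c = frag_eval A g c \<otimes> a"
proof -
  have "frag_eval A (\<lambda>p. g p \<otimes> a) c = (\<Oplus>p\<in>Poly_Mapping.keys c. ([Poly_Mapping.lookup c p] \<cdot> g p) \<otimes> a)"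
    unfolding frag_eval_def using assms
    by (intro finsum_cong') (auto simp: add_pow_ldistr_int Pi_iff subset_iff)
  also have "\<dots> = frag_eval A g c \<otimes> a"
    unfolding frag_eval_def using assms by (intro finsum_ldistr[symmetric]) (auto simp: Pi_iff subset_iff)
  finally show ?thesis .
qed

lemma frag_eval_lmult:
  assumes "Poly_Mapping.keys c \<subseteq> AA" "g \<in> AA \<rightarrow> carrier A" "a \<in> carrier A"
  shows "frag_eval A (\<lambda>p. a \<otimes> g p) c = a \<otimes> frag_eval A g c"
proof -
  have "frag_eval A (\<lambda>p. a \<otimes> g p) c = (\<Oplus>p\<in>Poly_Mapping.keys c. a \<otimes> ([Poly_Mapping.lookup c p] \<cdot> g p))"
    unfolding frag_eval_def using assms
    by (intro finsum_cong') (auto simp: add_pow_rdistr_int Pi_iff subset_iff)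
  also have "\<dots> = a \<otimes> frag_eval A g c"
    unfolding frag_eval_def using assms by (intro finsum_rdistr[symmetric]) (auto simp: Pi_iff subset_iff)
  finally show ?thesis .
qed

lemma frag_eval_cong:
  assumes "Poly_Mapping.keys c \<subseteq> AA" "g' \<in> AA \<rightarrow> carrier A" "\<And>p. p \<in> AA \<Longrightarrow> g p = g' p"
  shows "frag_eval A g c = frag_eval A g' c"
  unfolding frag_eval_def using assms by (intro finsum_cong') (auto simp: Pi_iff subset_iff)

text \<open>The class of a formal sum in the tensor product. Congruences modulo the relations become
  equations between classes, which can be chained.\<close>

definition tensor_class :: "('a \<times> 'a \<Rightarrow>\<^sub>0 int) \<Rightarrow> ('a \<times> 'a \<Rightarrow>\<^sub>0 int) set" where
  "tensor_class c = {n + c | n. n \<in> N}"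

lemma tensor_class_eq_coset: "tensor_class c = N #>\<^bsub>pair_group A\<^esub> c"
  by (auto simp: tensor_class_def r_coset_def)

lemma carrier_tensor: "carrier (tensor A K) = tensor_class ` {c. Poly_Mapping.keys c \<subseteq> AA}"
  by (auto simp: tensor_def FactGroup_def RCOSETS_def tensor_class_eq_coset)

lemma tensor_class_eqI: "c - d \<in> N \<Longrightarrow> tensor_class c = tensor_class d"
proof -
  have "tensor_class c \<subseteq> tensor_class d" if "c - d \<in> N" for c d
  proof
    fix x assume "x \<in> tensor_class c"
    then obtain n where "n \<in> N" "x = n + c" by (auto simp: tensor_class_def)
    then have "n + (c - d) \<in> N" "x = (n + (c - d)) + d" using that by (auto intro: kernel_add)
    then show "x \<in> tensor_class d" unfolding tensor_class_def by blast
  qed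
  moreover assume "c - d \<in> N"
  moreover from this have "d - c \<in> N" using kernel_minus by fastforce
  ultimately show ?thesis by blast
qed

lemma tensor_class_eqD: "tensor_class c = tensor_class d \<Longrightarrow> c - d \<in> N"
proof -
  assume "tensor_class c = tensor_class d"
  moreover have "c \<in> tensor_class c" unfolding tensor_class_def using kernel_zero by force
  ultimately obtain n where "n \<in> N" "c = n + d" by (auto simp: tensor_class_def)
  then show ?thesis by simp
qed

lemma tensor_mult_class: "tensor_class c \<otimes>\<^bsub>tensor A K\<^esub> tensor_class d = tensor_class (c + d)"
proof
  show "tensor_class c \<otimes>\<^bsub>tensor A K\<^esub> tensor_class d \<subseteq> tensor_class (c + d)"
  proof
    fix x assume "x \<in> tensor_class c \<otimes>\<^bsub>tensor A K\<^esub> tensor_class d"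
    then obtain n n' where n: "n \<in> N" "n' \<in> N" "x = (n + c) + (n' + d)"
      by (auto simp: tensor_def FactGroup_def set_mult_def tensor_class_def)
    then have "n + n' \<in> N" "x = (n + n') + (c + d)" by (simp_all add: kernel_add algebra_simps)
    then show "x \<in> tensor_class (c + d)" unfolding tensor_class_def by blast
  qed
  show "tensor_class (c + d) \<subseteq> tensor_class c \<otimes>\<^bsub>tensor A K\<^esub> tensor_class d"
  proof
    fix x assume "x \<in> tensor_class (c + d)"
    then obtain n where n: "n \<in> N" "x = (n + c) + (0 + d)" by (auto simp: tensor_class_def add.assoc)
    then have "n + c \<in> tensor_class c" "0 + d \<in> tensor_class d" unfolding tensor_class_def using kernel_zero by blast+
    then show "x \<in> tensor_class c \<otimes>\<^bsub>tensor A K\<^esub> tensor_class d"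
      unfolding n(2) by (auto simp: tensor_def FactGroup_def set_mult_def)
  qed
qed

lemma tensor_act_class:
  assumes "a \<in> carrier A" "b \<in> carrier A"
  shows "tensor_act A K a b (tensor_class c) = tensor_class (pair_act A a b c)"
proof
  show "tensor_act A K a b (tensor_class c) \<subseteq> tensor_class (pair_act A a b c)"
  proof
    fix x assume "x \<in> tensor_act A K a b (tensor_class c)"
    then obtain n n' where n: "n \<in> N" "n' \<in> N" "x = n' + pair_act A a b (n + c)"
      by (auto simp: tensor_act_def set_mult_def tensor_class_def pair_act_def)
    then have "n' + pair_act A a b n \<in> N" using assms by (simp add: kernel_add pair_act_kernel)
    moreover have "x = (n' + pair_act A a b n) + pair_act A a b c"
      using n by (simp add: pair_act_add add.assoc)
    ultimately show "x \<in> tensor_class (pair_act A a b c)" unfolding tensor_class_def by blast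
  qed
  show "tensor_class (pair_act A a b c) \<subseteq> tensor_act A K a b (tensor_class c)"
  proof
    fix x assume "x \<in> tensor_class (pair_act A a b c)"
    then obtain n where n: "n \<in> N" "x = n + pair_act A a b c" by (auto simp: tensor_class_def)
    moreover have "c \<in> tensor_class c" unfolding tensor_class_def using kernel_zero by force
    ultimately show "x \<in> tensor_act A K a b (tensor_class c)"
      by (auto simp: tensor_act_def set_mult_def pair_act_def)
  qed
qed

lemma tensor_mult_map_class:
  assumes "Poly_Mapping.keys c \<subseteq> AA"
  shows "tensor_mult A (tensor_class c) = pair_eval A c"
proof -
  have "pair_eval A (n + c) = pair_eval A c" if "n \<in> N" for n
    unfolding pair_eval_eq
    by (rule frag_eval_eq_of_kernel[OF balanced_mult])
      (use that assms kernel_keys[OF that] in \<open>simp_all add: keys_add_sub\<close>)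
  then have "pair_eval A ` tensor_class c = {pair_eval A c}"
    unfolding tensor_class_def using kernel_zero by auto
  then show ?thesis by (simp add: tensor_mult_def)
qed

text \<open>The elements are kept as formal sums of pairs instead of cosets, so that balanced maps can be
  applied to them directly.\<close>

definition separability_element :: "('a \<times> 'a \<Rightarrow>\<^sub>0 int) \<Rightarrow> bool" where
  "separability_element e \<longleftrightarrow> Poly_Mapping.keys e \<subseteq> AA \<and> pair_eval A e = \<one> \<and>
     (\<forall>b\<in>carrier A. pair_act A b \<one> e - pair_act A \<one> b e \<in> N)"

text \<open>A splitting \<open>s\<close> is determined by \<open>s(1)\<close>, and bilinearity of \<open>s\<close> at \<open>1\<close> says that \<open>s(1)\<close>
  commutes with \<open>A\<close>; conversely \<open>z \<mapsto> z e\<close> is a splitting.\<close>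

lemma separable_ext_iff: "separable_ext A K \<longleftrightarrow> (\<exists>e. separability_element e)"
proof
  assume "separable_ext A K"
  then obtain s where s: "s \<in> hom (add_monoid A) (tensor A K)"
    and act: "\<And>a b h. a \<in> carrier A \<Longrightarrow> b \<in> carrier A \<Longrightarrow> h \<in> carrier A \<Longrightarrow>
           s (a \<otimes> h \<otimes> b) = tensor_act A K a b (s h)"
    and mult: "\<And>h. h \<in> carrier A \<Longrightarrow> tensor_mult A (s h) = h"
    unfolding separable_ext_def by blast
  have "s \<one> \<in> carrier (tensor A K)" using s by (auto simp: hom_def)
  then obtain e where e: "Poly_Mapping.keys e \<subseteq> AA" "s \<one> = tensor_class e"
    unfolding carrier_tensor by blast
  have "pair_act A b \<one> e - pair_act A \<one> b e \<in> N" if "b \<in> carrier A" for b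
    using act[of b \<one> \<one>] act[of \<one> b \<one>] that e by (intro tensor_class_eqD) (simp add: tensor_act_class)
  moreover have "pair_eval A e = \<one>"
    using mult[of \<one>] e by (simp add: tensor_mult_map_class)
  ultimately have "separability_element e"
    unfolding separability_element_def using e by blast
  then show "\<exists>e. separability_element e" ..
next
  assume "\<exists>e. separability_element e"
  then obtain e where e: "Poly_Mapping.keys e \<subseteq> AA" "pair_eval A e = \<one>"
    and comm: "\<And>b. b \<in> carrier A \<Longrightarrow> pair_act A b \<one> e - pair_act A \<one> b e \<in> N"
    unfolding separability_element_def by blast
  define s where "s z = tensor_class (pair_act A z \<one> e)" for z
  have "s \<in> hom (add_monoid A) (tensor A K)"
  proof (rule homI)
    fix z assume "z \<in> carrier (add_monoid A)"
    then show "s z \<in> carrier (tensor A K)"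
      using e unfolding s_def carrier_tensor by (intro imageI CollectI pair_act_keys) auto
  next
    fix z z' assume "z \<in> carrier (add_monoid A)" "z' \<in> carrier (add_monoid A)"
    then show "s (z \<otimes>\<^bsub>add_monoid A\<^esub> z') = s z \<otimes>\<^bsub>tensor A K\<^esub> s z'"
      unfolding s_def tensor_mult_class using e
      by (intro tensor_class_eqI) (simp add: pair_act_biadditive)
  qed
  moreover have "s (a \<otimes> h \<otimes> b) = tensor_act A K a b (s h)"
    if "a \<in> carrier A" "b \<in> carrier A" "h \<in> carrier A" for a b h
  proof -
    have "pair_act A (a \<otimes> h) \<one> (pair_act A b \<one> e - pair_act A \<one> b e) \<in> N"
      using comm that by (intro pair_act_kernel) auto
    then show ?thesis
      unfolding s_def using that e
      by (subst tensor_act_class) (auto simp: pair_act_diff pair_act_comp intro!: tensor_class_eqI)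
  qed
  moreover have "tensor_mult A (s h) = h" if "h \<in> carrier A" for h
  proof -
    have "pair_eval A (pair_act A h \<one> e) = frag_eval A (\<lambda>p. h \<otimes> (fst p \<otimes> snd p)) e"
      unfolding pair_eval_eq using that e
      by (subst frag_eval_pair_act) (auto intro!: frag_eval_cong simp: m_assoc)
    also have "\<dots> = h \<otimes> pair_eval A e"
      unfolding pair_eval_eq using that e by (intro frag_eval_lmult) auto
    finally show ?thesis
      unfolding s_def using that e by (simp add: tensor_mult_map_class pair_act_keys)
  qed
  ultimately show "separable_ext A K"
    unfolding separable_ext_def by blast
qed

text \<open>For a separability element \<open>\<Sum> u\<^sub>i \<otimes> v\<^sub>i\<close> and a derivation \<open>\<delta>\<close> over \<open>K\<close>, put
  \<open>u = \<Sum> \<delta>(u\<^sub>i) v\<^sub>i\<close>. Applying the balanced map \<open>(y, z) \<mapsto> \<delta>(y) z\<close> to the commutation of the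
  separability element with \<open>y\<close> yields \<open>\<delta>(y) + y u = u y\<close>.\<close>

lemma separable_imp_weakly_separable:
  assumes "separable_ext A K"
  shows "weakly_separable_ext A K"
  unfolding weakly_separable_ext_def
proof (intro allI impI)
  fix \<delta> assume "derivation_over A K \<delta>"
  then have cl: "\<And>y. y \<in> carrier A \<Longrightarrow> \<delta> y \<in> carrier A"
    and add: "\<And>y z. y \<in> carrier A \<Longrightarrow> z \<in> carrier A \<Longrightarrow> \<delta> (y \<oplus> z) = \<delta> y \<oplus> \<delta> z"
    and leib: "\<And>y z. y \<in> carrier A \<Longrightarrow> z \<in> carrier A \<Longrightarrow> \<delta> (y \<otimes> z) = \<delta> y \<otimes> z \<oplus> y \<otimes> \<delta> z"
    and zero: "\<And>k. k \<in> K \<Longrightarrow> \<delta> k = \<zero>"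
    unfolding derivation_over_def by blast+
  obtain e where e: "Poly_Mapping.keys e \<subseteq> AA" "pair_eval A e = \<one>"
    and comm: "\<And>b. b \<in> carrier A \<Longrightarrow> pair_act A b \<one> e - pair_act A \<one> b e \<in> N"
    using assms unfolding separable_ext_iff separability_element_def by blast
  define g where "g p = \<delta> (fst p) \<otimes> snd p" for p
  have gC: "g \<in> AA \<rightarrow> carrier A" by (auto simp: g_def cl)
  have bal: "balanced g"
    unfolding balanced_def using gC by (auto simp: g_def cl add leib zero l_distr r_distr m_assoc)
  define u where "u = frag_eval A g e"
  have u: "u \<in> carrier A" unfolding u_def using gC e by (intro frag_eval_closed) auto
  have "\<delta> y = u \<otimes> y \<ominus> y \<otimes> u" if y: "y \<in> carrier A" for y
  proof -
    have "frag_eval A g (pair_act A y \<one> e) = frag_eval A (\<lambda>p. \<delta> y \<otimes> (fst p \<otimes> snd p) \<oplus> y \<otimes> g p) e"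
      using e y gC
      by (subst frag_eval_pair_act) (auto intro!: frag_eval_cong simp: g_def cl leib l_distr m_assoc)
    also have "\<dots> = frag_eval A (\<lambda>p. \<delta> y \<otimes> (fst p \<otimes> snd p)) e \<oplus> frag_eval A (\<lambda>p. y \<otimes> g p) e"
      using e y gC by (intro frag_eval_fun_add) (auto simp: cl)
    also have "\<dots> = \<delta> y \<otimes> pair_eval A e \<oplus> y \<otimes> u"
      unfolding pair_eval_eq u_def using e y gC
      by (intro arg_cong2[of _ _ _ _ "(\<oplus>)"] frag_eval_lmult) (auto simp: cl)
    finally have 1: "frag_eval A g (pair_act A y \<one> e) = \<delta> y \<oplus> y \<otimes> u"
      using e y by (simp add: cl)
    have "frag_eval A g (pair_act A \<one> y e) = frag_eval A (\<lambda>p. g p \<otimes> y) e"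
      using e y gC
      by (subst frag_eval_pair_act) (auto intro!: frag_eval_cong simp: g_def cl m_assoc)
    also have "\<dots> = u \<otimes> y"
      unfolding u_def using e y gC by (intro frag_eval_rmult) auto
    finally have 2: "frag_eval A g (pair_act A \<one> y e) = u \<otimes> y" .
    have "frag_eval A g (pair_act A y \<one> e) = frag_eval A g (pair_act A \<one> y e)"
      using bal comm[OF y] e y by (intro frag_eval_eq_of_kernel) (simp_all add: pair_act_keys)
    then have "\<delta> y \<oplus> y \<otimes> u = u \<otimes> y" using 1 2 by simp
    then have "u \<otimes> y \<ominus> y \<otimes> u = (\<delta> y \<oplus> y \<otimes> u) \<ominus> y \<otimes> u" by simp
    also have "\<dots> = \<delta> y" using y u by (simp add: a_minus_def a_assoc r_neg cl)
    finally show ?thesis ..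
  qed
  then show "inner_derivation A \<delta>"
    unfolding inner_derivation_def using u by blast
qed

end

context ring_ext
begin

lemma tensor_class_add: "tensor_class c = tensor_class d \<Longrightarrow> tensor_class c' = tensor_class d' \<Longrightarrow> tensor_class (c + c') = tensor_class (d + d')"
  by (metis tensor_mult_class)

lemma tensor_class_act: "tensor_class c = tensor_class d \<Longrightarrow> a \<in> carrier A \<Longrightarrow> b \<in> carrier A \<Longrightarrow>
  tensor_class (pair_act A a b c) = tensor_class (pair_act A a b d)"
  by (metis tensor_act_class)

lemma tensor_class_sum:
  "(\<And>i. i \<in> I \<Longrightarrow> tensor_class (F i) = tensor_class (H i)) \<Longrightarrow> tensor_class (sum F I) = tensor_class (sum H I)"
proof (induction I rule: infinite_finite_induct)
  case (insert i I)
  then have "tensor_class (F i + sum F I) = tensor_class (H i + sum H I)" by (intro tensor_class_add) blast+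
  then show ?case using insert.hyps by simp
qed simp_all

lemma tensor_class_add_left: "u \<in> carrier A \<Longrightarrow> u' \<in> carrier A \<Longrightarrow> v \<in> carrier A \<Longrightarrow>
  tensor_class (frag_of (u \<oplus> u', v)) = tensor_class (frag_of (u, v) + frag_of (u', v))"
  by (rule tensor_class_eqI, unfold diff_diff_eq[symmetric] tensor_relators_def,
      rule kernel_relator, unfold tensor_relators_def) blast

lemma tensor_class_add_right: "u \<in> carrier A \<Longrightarrow> v \<in> carrier A \<Longrightarrow> v' \<in> carrier A \<Longrightarrow>
  tensor_class (frag_of (u, v \<oplus> v')) = tensor_class (frag_of (u, v) + frag_of (u, v'))"
  by (rule tensor_class_eqI, unfold diff_diff_eq[symmetric] tensor_relators_def,
      rule kernel_relator, unfold tensor_relators_def) blast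

lemma tensor_class_balance: "u \<in> carrier A \<Longrightarrow> k \<in> K \<Longrightarrow> v \<in> carrier A \<Longrightarrow>
  tensor_class (frag_of (u \<otimes> k, v)) = tensor_class (frag_of (u, k \<otimes> v))"
  by (rule tensor_class_eqI, rule kernel_relator, unfold tensor_relators_def) blast

lemma tensor_class_zero_left: "v \<in> carrier A \<Longrightarrow> tensor_class (frag_of (\<zero>, v)) = tensor_class 0"
proof -
  assume v: "v \<in> carrier A"
  have "- (frag_of (\<zero>, v) - (frag_of (\<zero>, v) + frag_of (\<zero>, v))) \<in> N"
    using tensor_class_add_left[of \<zero> \<zero> v] v by (intro kernel_minus tensor_class_eqD) simp
  then show ?thesis by (intro tensor_class_eqI) simp
qed

lemma tensor_class_zero_right: "u \<in> carrier A \<Longrightarrow> tensor_class (frag_of (u, \<zero>)) = tensor_class 0"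
proof -
  assume u: "u \<in> carrier A"
  have "- (frag_of (u, \<zero>) - (frag_of (u, \<zero>) + frag_of (u, \<zero>))) \<in> N"
    using tensor_class_add_right[of u \<zero> \<zero>] u by (intro kernel_minus tensor_class_eqD) simp
  then show ?thesis by (intro tensor_class_eqI) simp
qed

lemma tensor_class_sum_left:
  assumes "finite I" "\<And>i. i \<in> I \<Longrightarrow> u i \<in> carrier A" "v \<in> carrier A"
  shows "tensor_class (\<Sum>i\<in>I. frag_of (u i, v)) = tensor_class (frag_of (\<Oplus>i\<in>I. u i, v))"
  using assms
proof (induction I rule: finite_induct)
  case (insert i I)
  then have "tensor_class (frag_of (u i, v) + (\<Sum>i\<in>I. frag_of (u i, v))) =
    tensor_class (frag_of (u i, v) + frag_of (\<Oplus>i\<in>I. u i, v))" by (intro tensor_class_add) auto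
  also have "\<dots> = tensor_class (frag_of (u i \<oplus> (\<Oplus>i\<in>I. u i), v))"
    using insert by (intro tensor_class_add_left[symmetric] finsum_closed) auto
  finally show ?case using insert by (simp add: Pi_iff)
qed (simp add: tensor_class_zero_left)

lemma tensor_class_sum_right:
  assumes "finite I" "\<And>i. i \<in> I \<Longrightarrow> v i \<in> carrier A" "u \<in> carrier A"
  shows "tensor_class (\<Sum>i\<in>I. frag_of (u, v i)) = tensor_class (frag_of (u, \<Oplus>i\<in>I. v i))"
  using assms
proof (induction I rule: finite_induct)
  case (insert i I)
  then have "tensor_class (frag_of (u, v i) + (\<Sum>i\<in>I. frag_of (u, v i))) =
    tensor_class (frag_of (u, v i) + frag_of (u, \<Oplus>i\<in>I. v i))" by (intro tensor_class_add) auto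
  also have "\<dots> = tensor_class (frag_of (u, v i \<oplus> (\<Oplus>i\<in>I. v i)))"
    using insert by (intro tensor_class_add_right[symmetric] finsum_closed) auto
  finally show ?case using insert by (simp add: Pi_iff)
qed (simp add: tensor_class_zero_right)

lemma pair_act_sum: "pair_act A a b (sum F I) = (\<Sum>i\<in>I. pair_act A a b (F i))"
  by (induction I rule: infinite_finite_induct) (auto simp: pair_act_add)

lemma frag_eval_sum:
  assumes "finite I" "\<And>i. i \<in> I \<Longrightarrow> Poly_Mapping.keys (F i) \<subseteq> AA" "g \<in> AA \<rightarrow> carrier A"
  shows "frag_eval A g (\<Sum>i\<in>I. F i) = (\<Oplus>i\<in>I. frag_eval A g (F i))"
proof -
  have "Poly_Mapping.keys (\<Sum>i\<in>I. F i) \<subseteq> AA \<and> frag_eval A g (\<Sum>i\<in>I. F i) = (\<Oplus>i\<in>I. frag_eval A g (F i))"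
    using assms
  proof (induction I rule: finite_induct)
    case (insert i I)
    have "frag_eval A g (F j) \<in> carrier A" if "j \<in> insert i I" for j
      using insert.prems that by (intro frag_eval_closed) blast
    then show ?case using insert
      by (simp add: keys_add_sub frag_eval_add[of _ AA] Pi_iff)
  qed simp
  then show ?thesis ..
qed

end


section \<open>Ring extensions with a twisting generator\<close>

text \<open>The properties of the quotient by \<open>f\<close> on which the theorem depends. The coefficient ring is
  taken as a subring \<open>K\<close> of \<open>A\<close>, and the twist as a ring endomorphism \<open>T\<close> of all of \<open>A\<close>, so
  that \<open>y x = x T(y)\<close> holds for every \<open>y\<close> and not only for coefficients.\<close>

locale skew_extension = ring_ext +
  fixes T :: "'a \<Rightarrow> 'a" and x :: 'a and m :: nat and a :: "nat \<Rightarrow> 'a"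
  assumes K_subring: "subring K A"
    and T_hom: "T \<in> ring_hom A A"
    and T_K [simp, intro]: "k \<in> K \<Longrightarrow> T k \<in> K"
    and T_x [simp]: "T x = x"
    and x_closed [simp]: "x \<in> carrier A"
    and mult_x: "y \<in> carrier A \<Longrightarrow> y \<otimes> x = x \<otimes> T y"
    and T_order: "k \<in> K \<Longrightarrow> (T ^^ m) k = k"
    and m_pos: "0 < m"
    and a_K [simp, intro]: "a j \<in> K"
    and T_a [simp]: "T (a j) = a j"
    and a_m [simp]: "a m = \<one>"
    and root: "(\<Oplus>j\<in>{..m}. x [^] j \<otimes> a j) = \<zero>"
    and basis: "y \<in> carrier A \<Longrightarrow> \<exists>!c. c \<in> {..<m} \<rightarrow>\<^sub>E K \<and> (\<Oplus>j\<in>{..<m}. x [^] j \<otimes> c j) = y"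
begin

lemma a_coeff_closed [simp]: "a j \<in> carrier A" by blast

lemma K_ops [simp, intro]:
  "\<zero> \<in> K" "\<one> \<in> K"
  "k \<in> K \<Longrightarrow> l \<in> K \<Longrightarrow> k \<oplus> l \<in> K" "k \<in> K \<Longrightarrow> l \<in> K \<Longrightarrow> k \<otimes> l \<in> K" "k \<in> K \<Longrightarrow> \<ominus> k \<in> K"
  using subringE[OF K_subring] by auto

lemma T_pow_hom: "T ^^ j \<in> ring_hom A A"
proof (induction j)
  case 0
  then show ?case by (auto intro: ring_hom_memI)
next
  case (Suc j)
  then show ?case using ring_hom_trans[OF Suc T_hom] by (simp add: o_def)
qed

lemma T_pow_closed [simp]: "y \<in> carrier A \<Longrightarrow> (T ^^ j) y \<in> carrier A"
  using ring_hom_closed[OF T_pow_hom] by blast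

lemma T_closed [simp]: "y \<in> carrier A \<Longrightarrow> T y \<in> carrier A"
  using ring_hom_closed[OF T_hom] by blast

lemma T_pow_K [simp, intro]: "k \<in> K \<Longrightarrow> (T ^^ j) k \<in> K"
  by (induction j) auto

lemma T_mult: "y \<in> carrier A \<Longrightarrow> z \<in> carrier A \<Longrightarrow> T (y \<otimes> z) = T y \<otimes> T z"
  and T_add: "y \<in> carrier A \<Longrightarrow> z \<in> carrier A \<Longrightarrow> T (y \<oplus> z) = T y \<oplus> T z"
  and T_one [simp]: "T \<one> = \<one>"
  and T_zero [simp]: "T \<zero> = \<zero>"
  using ring_hom_mult[OF T_hom] ring_hom_add[OF T_hom] ring_hom_one[OF T_hom]
    ring_hom_zero[OF T_hom ring_axioms ring_axioms] by blast+

lemma T_pow_mult: "y \<in> carrier A \<Longrightarrow> z \<in> carrier A \<Longrightarrow> (T ^^ j) (y \<otimes> z) = (T ^^ j) y \<otimes> (T ^^ j) z"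
  and T_pow_add: "y \<in> carrier A \<Longrightarrow> z \<in> carrier A \<Longrightarrow> (T ^^ j) (y \<oplus> z) = (T ^^ j) y \<oplus> (T ^^ j) z"
  using ring_hom_mult[OF T_pow_hom] ring_hom_add[OF T_pow_hom] by blast+

lemma T_pow_x [simp]: "(T ^^ j) (x [^] (i::nat)) = x [^] i"
proof (induction j)
  case (Suc j)
  have "T (x [^] i) = x [^] i" by (induction i) (simp_all add: T_mult)
  then show ?case using Suc by simp
qed simp

lemma T_pow_a [simp]: "(T ^^ j) (a i) = a i"
  by (induction j) auto

lemma mult_x_pow: "y \<in> carrier A \<Longrightarrow> y \<otimes> x [^] (j::nat) = x [^] j \<otimes> (T ^^ j) y"
proof (induction j)
  case (Suc j)
  have "y \<otimes> x [^] Suc j = y \<otimes> x [^] j \<otimes> x" using Suc.prems by (simp add: m_assoc)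
  also have "\<dots> = x [^] j \<otimes> (T ^^ j) y \<otimes> x" using Suc by simp
  also have "\<dots> = x [^] j \<otimes> (x \<otimes> T ((T ^^ j) y))"
    using Suc.prems by (simp only: m_assoc mult_x T_pow_closed nat_pow_closed x_closed)
  finally show ?case using Suc.prems by (simp add: m_assoc)
qed simp

lemma a_x_pow: "a i \<otimes> x [^] (j::nat) = x [^] j \<otimes> a i"
  by (simp add: mult_x_pow)

lemma a_x: "a i \<otimes> x = x \<otimes> a i"
  by (simp add: mult_x)

definition coord :: "'a \<Rightarrow> nat \<Rightarrow> 'a" where
  "coord y = (THE c. c \<in> {..<m} \<rightarrow>\<^sub>E K \<and> (\<Oplus>j\<in>{..<m}. x [^] j \<otimes> c j) = y)"

lemma coord:
  assumes "y \<in> carrier A"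
  shows "j < m \<Longrightarrow> coord y j \<in> K" "(\<Oplus>j\<in>{..<m}. x [^] j \<otimes> coord y j) = y"
  using theI'[OF basis[OF assms]] unfolding coord_def[symmetric] by auto

lemma coord_closed [simp]: "y \<in> carrier A \<Longrightarrow> j < m \<Longrightarrow> coord y j \<in> carrier A"
  using coord(1) by blast

lemma coord_unique:
  assumes "\<And>j. j < m \<Longrightarrow> c j \<in> K" "(\<Oplus>j\<in>{..<m}. x [^] j \<otimes> c j) = y" "j < m"
  shows "coord y j = c j"
proof -
  have y: "y \<in> carrier A" using assms(1,2) by (auto intro!: finsum_closed)
  let ?c = "restrict c {..<m}"
  have "(\<Oplus>j\<in>{..<m}. x [^] j \<otimes> ?c j) = (\<Oplus>j\<in>{..<m}. x [^] j \<otimes> c j)"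
    using assms(1) by (intro finsum_cong') auto
  then have "?c \<in> {..<m} \<rightarrow>\<^sub>E K \<and> (\<Oplus>j\<in>{..<m}. x [^] j \<otimes> ?c j) = y" using assms(1,2) by auto
  then have "coord y = ?c" unfolding coord_def using basis[OF y] by (intro the1_equality) auto
  then show ?thesis using assms(3) by simp
qed

lemma coord_add:
  assumes "y \<in> carrier A" "z \<in> carrier A" "j < m"
  shows "coord (y \<oplus> z) j = coord y j \<oplus> coord z j"
proof (rule coord_unique)
  have "(\<Oplus>j\<in>{..<m}. x [^] j \<otimes> (coord y j \<oplus> coord z j)) =
    (\<Oplus>j\<in>{..<m}. x [^] j \<otimes> coord y j \<oplus> x [^] j \<otimes> coord z j)"
    using assms by (intro finsum_cong') (auto simp: r_distr)
  also have "\<dots> = y \<oplus> z"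
    using assms by (subst finsum_addf) (auto simp: coord)
  finally show "(\<Oplus>j\<in>{..<m}. x [^] j \<otimes> (coord y j \<oplus> coord z j)) = y \<oplus> z" .
qed (use assms coord in auto)

lemma coord_rmult:
  assumes "y \<in> carrier A" "k \<in> K" "j < m"
  shows "coord (y \<otimes> k) j = coord y j \<otimes> k"
proof (rule coord_unique)
  have "(\<Oplus>j\<in>{..<m}. x [^] j \<otimes> (coord y j \<otimes> k)) = (\<Oplus>j\<in>{..<m}. x [^] j \<otimes> coord y j \<otimes> k)"
    using assms by (intro finsum_cong') (auto simp: m_assoc)
  also have "\<dots> = y \<otimes> k"
    using assms by (subst finsum_ldistr[symmetric]) (auto simp: coord)
  finally show "(\<Oplus>j\<in>{..<m}. x [^] j \<otimes> (coord y j \<otimes> k)) = y \<otimes> k" .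
qed (use assms coord in auto)

lemma coord_lmult:
  assumes "y \<in> carrier A" "k \<in> K" "j < m"
  shows "coord (k \<otimes> y) j = (T ^^ j) k \<otimes> coord y j"
proof (rule coord_unique)
  have "x [^] j \<otimes> ((T ^^ j) k \<otimes> c) = k \<otimes> (x [^] j \<otimes> c)" if "c \<in> carrier A" for j c
    using mult_x_pow[of k j] that assms(2) by (simp add: m_assoc[symmetric])
  then have "(\<Oplus>j\<in>{..<m}. x [^] j \<otimes> ((T ^^ j) k \<otimes> coord y j)) = (\<Oplus>j\<in>{..<m}. k \<otimes> (x [^] j \<otimes> coord y j))"
    using assms by (intro finsum_cong') auto
  also have "\<dots> = k \<otimes> y"
    using assms by (subst finsum_rdistr[symmetric]) (auto simp: coord)
  finally show "(\<Oplus>j\<in>{..<m}. x [^] j \<otimes> ((T ^^ j) k \<otimes> coord y j)) = k \<otimes> y" .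
qed (use assms coord in auto)

lemma coord_basis:
  assumes "i < m" "k \<in> K" "j < m"
  shows "coord (x [^] i \<otimes> k) j = (if j = i then k else \<zero>)"
proof (rule coord_unique)
  have "(\<Oplus>j\<in>{..<m}. x [^] j \<otimes> (if j = i then k else \<zero>)) = x [^] i \<otimes> (if i = i then k else \<zero>)"
    by (rule finsum_single) (use assms in auto)
  then show "(\<Oplus>j\<in>{..<m}. x [^] j \<otimes> (if j = i then k else \<zero>)) = x [^] i \<otimes> k" by simp
qed (use assms in auto)

text \<open>To prove an additive property it suffices to treat monomials.\<close>

lemma span_induct [consumes 1, case_names add basis]:
  assumes "y \<in> carrier A"
    and "\<And>y z. y \<in> carrier A \<Longrightarrow> z \<in> carrier A \<Longrightarrow> Q y \<Longrightarrow> Q z \<Longrightarrow> Q (y \<oplus> z)"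
    and "\<And>j k. j < m \<Longrightarrow> k \<in> K \<Longrightarrow> Q (x [^] j \<otimes> k)"
  shows "Q y"
proof -
  have "Q \<zero>" using assms(3)[of 0 \<zero>] m_pos by simp
  have "Q (\<Oplus>j\<in>I. x [^] j \<otimes> coord y j)" if "finite I" "I \<subseteq> {..<m}" for I
    using that
  proof (induction I rule: finite_induct)
    case empty
    then show ?case using \<open>Q \<zero>\<close> by simp
  next
    case (insert j I)
    then have "(\<lambda>j. x [^] j \<otimes> coord y j) \<in> I \<rightarrow> carrier A" using assms(1) by auto
    then show ?case using insert assms(1)
      by (simp, intro assms(2,3)) (auto intro: coord)
  qed
  from this[of "{..<m}"] show ?thesis using assms(1) by (simp add: coord)
qed

text \<open>The ring \<open>A\<close> is generated by \<open>K\<close> and \<open>x\<close>, because every monomial is a product of them.\<close>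

lemma gen_induct [consumes 1, case_names base x add mult]:
  assumes "y \<in> carrier A"
    and K: "\<And>k. k \<in> K \<Longrightarrow> Q k" and x: "Q x"
    and "\<And>y z. y \<in> carrier A \<Longrightarrow> z \<in> carrier A \<Longrightarrow> Q y \<Longrightarrow> Q z \<Longrightarrow> Q (y \<oplus> z)"
    and mult: "\<And>y z. y \<in> carrier A \<Longrightarrow> z \<in> carrier A \<Longrightarrow> Q y \<Longrightarrow> Q z \<Longrightarrow> Q (y \<otimes> z)"
  shows "Q y"
  using assms(1)
proof (induction rule: span_induct)
  case (basis j k)
  have "Q (x [^] j)" by (induction j) (auto intro: K x mult)
  then show ?case using basis K mult by auto
qed (use assms in auto)

lemma x_pow_m: "x [^] m = \<ominus> (\<Oplus>j\<in>{..<m}. x [^] j \<otimes> a j)"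
proof -
  have "{..m} = insert m {..<m}" by auto
  then have "x [^] m \<oplus> (\<Oplus>j\<in>{..<m}. x [^] j \<otimes> a j) = \<zero>"
    using root by (simp add: Pi_iff)
  then show ?thesis
    by (intro minus_equality[symmetric]) (auto intro!: finsum_closed)
qed

lemma coord_x_pow_m:
  assumes "k \<in> K" "j < m"
  shows "coord (x [^] m \<otimes> k) j = \<ominus> (a j \<otimes> k)"
proof (rule coord_unique)
  let ?s = "\<Oplus>j\<in>{..<m}. x [^] j \<otimes> (a j \<otimes> k)"
  have s: "?s = (\<Oplus>j\<in>{..<m}. x [^] j \<otimes> a j) \<otimes> k"
    using assms by (subst finsum_ldistr) (auto simp: m_assoc intro!: finsum_cong')
  have "(\<Oplus>j\<in>{..<m}. x [^] j \<otimes> \<ominus> (a j \<otimes> k)) \<oplus> ?s =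
    (\<Oplus>j\<in>{..<m}. x [^] j \<otimes> \<ominus> (a j \<otimes> k) \<oplus> x [^] j \<otimes> (a j \<otimes> k))"
    using assms by (subst finsum_addf) auto
  also have "\<dots> = (\<Oplus>j\<in>{..<m}. \<zero>)"
    using assms by (intro finsum_cong') (auto simp: r_minus l_neg)
  finally have "(\<Oplus>j\<in>{..<m}. x [^] j \<otimes> \<ominus> (a j \<otimes> k)) = \<ominus> ?s"
    using assms by (intro minus_equality[symmetric]) (auto intro!: finsum_closed)
  then show "(\<Oplus>j\<in>{..<m}. x [^] j \<otimes> \<ominus> (a j \<otimes> k)) = x [^] m \<otimes> k"
    unfolding s x_pow_m using assms by (subst l_minus) (auto intro!: finsum_closed)
qed (use assms in auto)

text \<open>By \<open>T\<^sup>m = 1\<close> on \<open>K\<close>, the elements \<open>k x\<^sup>m\<close> and \<open>x\<^sup>m k\<close> coincide. Replacing \<open>x\<^sup>m\<close> by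
  \<open>- \<Sum> x\<^sup>j a\<^sub>j\<close> and comparing coordinates gives the claim.\<close>

lemma a_mult_K:
  assumes k: "k \<in> K" and "j \<le> m"
  shows "a j \<otimes> k = (T ^^ j) k \<otimes> a j"
proof (cases "j = m")
  case True
  then show ?thesis using k by (simp add: T_order)
next
  case False
  then have j: "j < m" using assms by simp
  have "x [^] m \<otimes> k = k \<otimes> (x [^] m \<otimes> \<one>)" using k by (simp add: mult_x_pow T_order)
  then have "\<ominus> (a j \<otimes> k) = (T ^^ j) k \<otimes> \<ominus> (a j \<otimes> \<one>)"
    using coord_x_pow_m[OF k j] coord_lmult[OF _ k j, of "x [^] m \<otimes> \<one>"] coord_x_pow_m[of \<one>, OF _ j]
    by simp
  then have "\<ominus> (a j \<otimes> k) = \<ominus> ((T ^^ j) k \<otimes> a j)" using k by (simp add: r_minus)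
  then show ?thesis using k by (metis K_closed a_K m_closed T_pow_K minus_minus)
qed

lemma a_mult:
  assumes "y \<in> carrier A" "j \<le> m"
  shows "a j \<otimes> y = (T ^^ j) y \<otimes> a j"
  using assms(1)
proof (induction rule: span_induct)
  case (basis i k)
  have "a j \<otimes> (x [^] i \<otimes> k) = x [^] i \<otimes> (a j \<otimes> k)"
    using basis a_x_pow[of j i] by (simp add: m_assoc[symmetric])
  then show ?case using basis assms(2) by (simp add: a_mult_K T_pow_mult m_assoc)
qed (simp add: r_distr l_distr T_pow_add)

end


section \<open>Derivations and the map \<open>\<tau>\<close>\<close>

lemma derivation_overD:
  assumes "derivation_over A K \<delta>"
  shows "y \<in> carrier A \<Longrightarrow> \<delta> y \<in> carrier A"
    "y \<in> carrier A \<Longrightarrow> z \<in> carrier A \<Longrightarrow> \<delta> (y \<oplus>\<^bsub>A\<^esub> z) = \<delta> y \<oplus>\<^bsub>A\<^esub> \<delta> z"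
    "y \<in> carrier A \<Longrightarrow> z \<in> carrier A \<Longrightarrow> \<delta> (y \<otimes>\<^bsub>A\<^esub> z) = \<delta> y \<otimes>\<^bsub>A\<^esub> z \<oplus>\<^bsub>A\<^esub> y \<otimes>\<^bsub>A\<^esub> \<delta> z"
    "k \<in> K \<Longrightarrow> \<delta> k = \<zero>\<^bsub>A\<^esub>"
  using assms unfolding derivation_over_def by blast+

context skew_extension
begin

definition V :: "'a set" where "V = centralizer A K"
definition J :: "'a set" where "J = {h \<in> carrier A. \<forall>k\<in>K. k \<otimes> h = h \<otimes> T k}"
definition W :: "'a set" where "W = {h \<in> V. T h = h}"
definition ad_x :: "'a \<Rightarrow> 'a" where "ad_x h = h \<otimes> x \<ominus> x \<otimes> h"
definition \<tau> :: "'a \<Rightarrow> 'a" where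
  "\<tau> h = (\<Oplus>k\<in>{..<m}. x [^] k \<otimes> (\<Oplus>j\<in>{..k}. (T ^^ j) h \<otimes> a (Suc k)))"

lemma V_closed [simp]: "h \<in> V \<Longrightarrow> h \<in> carrier A"
  and J_closed [simp]: "h \<in> J \<Longrightarrow> h \<in> carrier A"
  and W_V: "h \<in> W \<Longrightarrow> h \<in> V"
  and W_T: "h \<in> W \<Longrightarrow> T h = h"
  by (simp_all add: V_def J_def W_def centralizer_def)

lemma W_closed [simp]: "h \<in> W \<Longrightarrow> h \<in> carrier A" by (simp add: W_V)

lemma V_comm: "h \<in> V \<Longrightarrow> k \<in> K \<Longrightarrow> k \<otimes> h = h \<otimes> k"
  unfolding V_def centralizer_def by blast

lemma J_comm: "h \<in> J \<Longrightarrow> k \<in> K \<Longrightarrow> k \<otimes> h = h \<otimes> T k"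
  unfolding J_def by blast

lemma J_a: "h \<in> J \<Longrightarrow> j \<le> m \<Longrightarrow> a j \<otimes> h = h \<otimes> a j"
  using J_comm[of h "a j"] by simp

lemma centerI:
  assumes "u \<in> V" "u \<otimes> x = x \<otimes> u"
  shows "u \<in> center A"
proof -
  have "y \<otimes> u = u \<otimes> y" if "y \<in> carrier A" for y
    using that
  proof (induction rule: gen_induct)
    case (mult y z)
    have "y \<otimes> z \<otimes> u = y \<otimes> (u \<otimes> z)" using mult assms by (simp add: m_assoc)
    also have "\<dots> = u \<otimes> (y \<otimes> z)" using mult assms by (simp add: m_assoc[symmetric])
    finally show ?case .
  qed (use assms V_comm[OF assms(1)] in \<open>simp_all add: l_distr r_distr\<close>)
  then show ?thesis unfolding center_def centralizer_def using V_closed[OF assms(1)] by blast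
qed

lemma center_iff: "u \<in> center A \<longleftrightarrow> u \<in> V \<and> ad_x u = \<zero>"
proof
  assume "u \<in> center A"
  then have u: "u \<in> carrier A" "\<And>y. y \<in> carrier A \<Longrightarrow> y \<otimes> u = u \<otimes> y"
    unfolding center_def centralizer_def by blast+
  have "u \<in> V" unfolding V_def centralizer_def using u by blast
  moreover have "ad_x u = \<zero>" unfolding ad_x_def u(2)[OF x_closed]
    using u(1) x_closed by (simp only: a_minus_def r_neg m_closed)
  ultimately show "u \<in> V \<and> ad_x u = \<zero>" ..
next
  assume u: "u \<in> V \<and> ad_x u = \<zero>"
  then have "u \<otimes> x = x \<otimes> u" using minus_eq_zeroD[of "u \<otimes> x" "x \<otimes> u"] by (simp add: ad_x_def)
  then show "u \<in> center A" using u centerI by blast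
qed

text \<open>If \<open>T(w) = w\<close>, then \<open>w x = x T(w) = x w\<close>.\<close>

lemma W_center: "w \<in> W \<Longrightarrow> w \<in> center A"
  using mult_x[of w] by (intro centerI) (simp_all add: W_V W_T)

lemma center_comm: "w \<in> center A \<Longrightarrow> y \<in> carrier A \<Longrightarrow> y \<otimes> w = w \<otimes> y"
  unfolding center_def centralizer_def by blast

text \<open>The value at \<open>x\<^sup>n\<close> of a derivation over \<open>K\<close> that sends \<open>x\<close> to \<open>h\<close>, namely the sum of the
  \<open>x\<^sup>i h x\<^sup>j\<close> over \<open>i + j = n - 1\<close>. It makes sense whether or not such a derivation exists.\<close>

primrec pow_deriv :: "nat \<Rightarrow> 'a \<Rightarrow> 'a" where
  "pow_deriv 0 h = \<zero>"
| "pow_deriv (Suc n) h = x \<otimes> pow_deriv n h \<oplus> h \<otimes> x [^] n"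

lemma pow_deriv_closed [simp]: "h \<in> carrier A \<Longrightarrow> pow_deriv n h \<in> carrier A"
  by (induction n) auto

lemma pow_deriv_Suc_right: "h \<in> carrier A \<Longrightarrow> pow_deriv (Suc n) h = pow_deriv n h \<otimes> x \<oplus> x [^] n \<otimes> h"
proof (induction n)
  case (Suc n)
  have c: "x \<otimes> x [^] n = x [^] n \<otimes> x" using nat_pow_Suc2[of x n] by simp
  have "pow_deriv (Suc (Suc n)) h = x \<otimes> (pow_deriv n h \<otimes> x \<oplus> x [^] n \<otimes> h) \<oplus> h \<otimes> x [^] Suc n"
    using Suc by (metis pow_deriv.simps(2))
  also have "\<dots> = (x \<otimes> pow_deriv n h \<oplus> h \<otimes> x [^] n) \<otimes> x \<oplus> x [^] Suc n \<otimes> h"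
    using Suc.prems by (simp add: l_distr r_distr m_assoc[symmetric] a_ac c)
  finally show ?case by simp
qed simp

lemma pow_deriv_T: "h \<in> carrier A \<Longrightarrow> pow_deriv (Suc k) h = x [^] k \<otimes> (\<Oplus>j\<in>{..k}. (T ^^ j) h)"
proof (induction k)
  case (Suc k)
  let ?S = "\<Oplus>j\<in>{..k}. (T ^^ j) h"
  have c: "x \<otimes> x [^] k = x [^] k \<otimes> x" using nat_pow_Suc2[of x k] by simp
  have S: "?S \<in> carrier A" using Suc.prems by (intro finsum_closed) auto
  have "pow_deriv (Suc (Suc k)) h = x \<otimes> (x [^] k \<otimes> ?S) \<oplus> h \<otimes> x [^] Suc k"
    using Suc by (metis pow_deriv.simps(2))
  also have "\<dots> = x [^] Suc k \<otimes> ?S \<oplus> x [^] Suc k \<otimes> (T ^^ Suc k) h"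
    using Suc.prems S mult_x_pow[of h "Suc k"] by (simp add: m_assoc[symmetric] c)
  also have "\<dots> = x [^] Suc k \<otimes> ((T ^^ Suc k) h \<oplus> ?S)"
    using Suc.prems S by (simp add: r_distr a_comm)
  also have "(T ^^ Suc k) h \<oplus> ?S = (\<Oplus>j\<in>{..Suc k}. (T ^^ j) h)"
    using Suc.prems by (subst finsum_Suc) auto
  finally show ?case .
qed simp

text \<open>So \<open>\<tau>(h)\<close> is what a derivation with \<open>x \<mapsto> h\<close> would assign to \<open>f(x)\<close>.\<close>

lemma tau_eq_pow_deriv:
  assumes "h \<in> carrier A"
  shows "\<tau> h = (\<Oplus>n\<in>{..m}. pow_deriv n h \<otimes> a n)"
proof -
  obtain m' where "m = Suc m'" using m_pos by (cases m) auto
  then have m': "{..<m} = {..m'}" "{..m} = {..Suc m'}" by auto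
  have "\<tau> h = (\<Oplus>k\<in>{..m'}. pow_deriv (Suc k) h \<otimes> a (Suc k))"
    unfolding \<tau>_def m'
  proof (intro finsum_cong')
    fix k
    have "(\<Oplus>j\<in>{..k}. (T ^^ j) h \<otimes> a (Suc k)) = (\<Oplus>j\<in>{..k}. (T ^^ j) h) \<otimes> a (Suc k)"
      using assms by (intro finsum_ldistr[symmetric]) auto
    then show "x [^] k \<otimes> (\<Oplus>j\<in>{..k}. (T ^^ j) h \<otimes> a (Suc k)) = pow_deriv (Suc k) h \<otimes> a (Suc k)"
      unfolding pow_deriv_T[OF assms] using assms by (simp add: m_assoc)
  qed (use assms in auto)
  also have "\<dots> = (\<Oplus>k\<in>{..m'}. pow_deriv (Suc k) h \<otimes> a (Suc k)) \<oplus> pow_deriv 0 h \<otimes> a 0"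
    using assms by (simp del: pow_deriv.simps(2) add: Pi_iff finsum_closed)
  also have "\<dots> = (\<Oplus>n\<in>{..m}. pow_deriv n h \<otimes> a n)"
    unfolding m' using assms by (intro finsum_Suc2[symmetric]) auto
  finally show ?thesis .
qed

lemma tau_closed [simp]: "h \<in> carrier A \<Longrightarrow> \<tau> h \<in> carrier A"
  by (simp add: tau_eq_pow_deriv)

lemma derivation_x_pow:
  assumes "derivation_over A K \<delta>"
  shows "\<delta> (x [^] n) = pow_deriv n (\<delta> x)"
proof (induction n)
  case 0
  then show ?case using assms by (simp add: derivation_over_def)
next
  case (Suc n)
  have "\<delta> x \<in> carrier A" using assms x_closed by (auto simp: derivation_over_def)
  moreover have "\<delta> (x \<otimes> x [^] n) = \<delta> x \<otimes> x [^] n \<oplus> x \<otimes> \<delta> (x [^] n)"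
    using assms by (simp add: derivation_over_def)
  moreover have "x \<otimes> x [^] n = x [^] Suc n" by (rule nat_pow_Suc2[symmetric]) simp
  ultimately show ?case using Suc by (simp add: a_comm)
qed

text \<open>Differentiate \<open>k x = x T(k)\<close> and \<open>f(x) = 0\<close>.\<close>

lemma derivation_tau_zero:
  assumes der: "derivation_over A K \<delta>"
  shows "\<delta> x \<in> J" "\<tau> (\<delta> x) = \<zero>"
proof -
  have cl: "\<And>y. y \<in> carrier A \<Longrightarrow> \<delta> y \<in> carrier A"
    and add: "\<And>y z. y \<in> carrier A \<Longrightarrow> z \<in> carrier A \<Longrightarrow> \<delta> (y \<oplus> z) = \<delta> y \<oplus> \<delta> z"
    and leib: "\<And>y z. y \<in> carrier A \<Longrightarrow> z \<in> carrier A \<Longrightarrow> \<delta> (y \<otimes> z) = \<delta> y \<otimes> z \<oplus> y \<otimes> \<delta> z"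
    and zero: "\<And>k. k \<in> K \<Longrightarrow> \<delta> k = \<zero>"
    using der unfolding derivation_over_def by blast+
  have "k \<otimes> \<delta> x = \<delta> x \<otimes> T k" if "k \<in> K" for k
    using leib[of k x] leib[of x "T k"] mult_x[of k] that by (simp add: cl zero)
  then show "\<delta> x \<in> J" unfolding J_def using cl[OF x_closed] by blast
  have "\<delta> (\<Oplus>n\<in>S. x [^] n \<otimes> a n) = (\<Oplus>n\<in>S. pow_deriv n (\<delta> x) \<otimes> a n)" if "finite S" for S
    using that
  proof (induction S rule: finite_induct)
    case (insert n S)
    then show ?case
      by (simp add: Pi_iff cl add leib zero derivation_x_pow[OF der] finsum_closed)
  qed (simp add: zero)
  then have "\<tau> (\<delta> x) = \<delta> (\<Oplus>n\<in>{..m}. x [^] n \<otimes> a n)" by (simp add: tau_eq_pow_deriv cl)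
  then show "\<tau> (\<delta> x) = \<zero>" by (simp add: root zero)
qed

lemma inner_derivation_over:
  assumes "u \<in> V"
  shows "derivation_over A K (\<lambda>y. u \<otimes> y \<ominus> y \<otimes> u)"
proof -
  have u: "u \<in> carrier A" using assms by simp
  have "u \<otimes> k \<ominus> k \<otimes> u = \<zero>" if "k \<in> K" for k
    unfolding V_comm[OF assms that] using u that by (simp add: a_minus_def r_neg)
  moreover have "u \<otimes> (y \<otimes> z) \<ominus> y \<otimes> z \<otimes> u =
      (u \<otimes> y \<ominus> y \<otimes> u) \<otimes> z \<oplus> y \<otimes> (u \<otimes> z \<ominus> z \<otimes> u)"
    if "y \<in> carrier A" "z \<in> carrier A" for y z
    using u that by algebra
  moreover have "u \<otimes> (y \<oplus> z) \<ominus> (y \<oplus> z) \<otimes> u = (u \<otimes> y \<ominus> y \<otimes> u) \<oplus> (u \<otimes> z \<ominus> z \<otimes> u)"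
    if "y \<in> carrier A" "z \<in> carrier A" for y z
    using u that by algebra
  ultimately show ?thesis
    unfolding derivation_over_def using u by simp
qed

lemma ad_x_in_J: "u \<in> V \<Longrightarrow> ad_x u \<in> J"
  and tau_ad_x: "u \<in> V \<Longrightarrow> \<tau> (ad_x u) = \<zero>"
  using derivation_tau_zero[OF inner_derivation_over] by (simp_all add: ad_x_def)

text \<open>Two derivations over \<open>K\<close> that agree at \<open>x\<close> are equal.\<close>

lemma derivation_eq_inner:
  assumes der: "derivation_over A K \<delta>" and u: "u \<in> V" and \<delta>: "\<delta> x = ad_x u" and y: "y \<in> carrier A"
  shows "\<delta> y = u \<otimes> y \<ominus> y \<otimes> u"
proof -
  have der': "derivation_over A K (\<lambda>y. u \<otimes> y \<ominus> y \<otimes> u)" by (rule inner_derivation_over[OF u])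
  show ?thesis
    using y
  proof (induction rule: gen_induct)
    case (base k)
    then show ?case by (simp only: derivation_overD(4)[OF der] derivation_overD(4)[OF der'])
  next
    case x
    then show ?case using \<delta> by (simp add: ad_x_def)
  next
    case (add y z)
    then show ?case by (simp only: derivation_overD(2)[OF der] derivation_overD(2)[OF der'])
  next
    case (mult y z)
    then show ?case by (simp only: derivation_overD(3)[OF der] derivation_overD(3)[OF der'])
  qed
qed

lemma J_pow_deriv_comm:
  assumes "h \<in> J" "k \<in> K"
  shows "k \<otimes> pow_deriv n h = pow_deriv n h \<otimes> (T ^^ n) k"
  using assms(2)
proof (induction n arbitrary: k)
  case (Suc n)
  have "k \<otimes> (x \<otimes> pow_deriv n h) = x \<otimes> (T k \<otimes> pow_deriv n h)"
    using Suc.prems assms by (simp add: m_assoc[symmetric] mult_x)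
  also have "\<dots> = x \<otimes> pow_deriv n h \<otimes> (T ^^ Suc n) k"
    using Suc assms by (simp add: m_assoc funpow_swap1)
  finally have 1: "k \<otimes> (x \<otimes> pow_deriv n h) = x \<otimes> pow_deriv n h \<otimes> (T ^^ Suc n) k" .
  have "k \<otimes> (h \<otimes> x [^] n) = h \<otimes> (T k \<otimes> x [^] n)"
    using Suc.prems assms J_comm[of h k] by (simp add: m_assoc[symmetric])
  also have "\<dots> = h \<otimes> x [^] n \<otimes> (T ^^ Suc n) k"
    using Suc.prems assms mult_x_pow[of "T k" n] by (simp add: m_assoc funpow_swap1)
  finally have 2: "k \<otimes> (h \<otimes> x [^] n) = h \<otimes> x [^] n \<otimes> (T ^^ Suc n) k" .
  have "k \<otimes> pow_deriv (Suc n) h = k \<otimes> (x \<otimes> pow_deriv n h) \<oplus> k \<otimes> (h \<otimes> x [^] n)"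
    using Suc.prems assms by (simp add: r_distr)
  also have "\<dots> = pow_deriv (Suc n) h \<otimes> (T ^^ Suc n) k"
    unfolding 1 2 using Suc.prems assms by (simp add: l_distr del: funpow.simps)
  finally show ?case .
qed (use assms in simp)

text \<open>The derivation is defined on the basis by \<open>\<delta>(x\<^sup>j c) = \<delta>(x\<^sup>j) c\<close> for \<open>j < m\<close>. The condition
  \<open>\<tau>(h) = 0\<close> extends this formula to \<open>j = m\<close>, and hence \<open>\<delta>(x y) = h y + x \<delta>(y)\<close> for all
  \<open>y\<close>; \<open>h \<in> J\<close> makes \<open>\<delta>\<close> left \<open>K\<close>-linear. The product rule then spreads from \<open>K\<close> and \<open>x\<close>
  to the ring they generate.\<close>

lemma exists_derivation:
  assumes h: "h \<in> J" and tau: "\<tau> h = \<zero>"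
  obtains \<delta> where "derivation_over A K \<delta>" "\<delta> x = h"
proof -
  define \<delta> where "\<delta> y = (\<Oplus>j\<in>{..<m}. pow_deriv j h \<otimes> coord y j)" for y
  have hC: "h \<in> carrier A" using h by simp
  have cl [simp]: "\<delta> y \<in> carrier A" if "y \<in> carrier A" for y
    unfolding \<delta>_def using that hC by (intro finsum_closed) auto
  have add: "\<delta> (y \<oplus> z) = \<delta> y \<oplus> \<delta> z" if "y \<in> carrier A" "z \<in> carrier A" for y z
  proof -
    have "\<delta> (y \<oplus> z) = (\<Oplus>j\<in>{..<m}. pow_deriv j h \<otimes> coord y j \<oplus> pow_deriv j h \<otimes> coord z j)"
      unfolding \<delta>_def using that hC by (intro finsum_cong') (auto simp: coord_add r_distr)
    also have "\<dots> = \<delta> y \<oplus> \<delta> z"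
      unfolding \<delta>_def using that hC by (intro finsum_addf) auto
    finally show ?thesis .
  qed
  (* the case n = m is where the hypothesis on tau enters *)
  have pow: "\<delta> (x [^] n \<otimes> k) = pow_deriv n h \<otimes> k" if n: "n \<le> m" and k: "k \<in> K" for n k
  proof (cases "n = m")
    case False
    then have "\<delta> (x [^] n \<otimes> k) = pow_deriv n h \<otimes> coord (x [^] n \<otimes> k) n"
      unfolding \<delta>_def using n k hC by (intro finsum_single) (auto simp: coord_basis)
    then show ?thesis using False n k by (simp add: coord_basis)
  next
    case True
    let ?s = "\<Oplus>j\<in>{..<m}. pow_deriv j h \<otimes> a j"
    have s: "?s \<in> carrier A" using hC by (intro finsum_closed) auto
    have "{..m} = insert m {..<m}" by auto
    then have "pow_deriv m h \<oplus> ?s = \<zero>"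
      using tau hC by (simp add: tau_eq_pow_deriv Pi_iff)
    then have Dm: "pow_deriv m h = \<ominus> ?s" using s hC by (intro minus_equality[symmetric]) auto
    have "\<delta> (x [^] m \<otimes> k) = (\<Oplus>j\<in>{..<m}. pow_deriv j h \<otimes> a j \<otimes> (\<ominus> k))"
      unfolding \<delta>_def using k hC
      by (intro finsum_cong') (auto simp: coord_x_pow_m m_assoc r_minus)
    also have "\<dots> = ?s \<otimes> (\<ominus> k)" using k hC by (intro finsum_ldistr[symmetric]) auto
    also have "\<dots> = pow_deriv m h \<otimes> k" unfolding Dm using s k by (simp add: r_minus l_minus)
    finally show ?thesis using True by simp
  qed
  have lK: "\<delta> (k \<otimes> y) = k \<otimes> \<delta> y" if k: "k \<in> K" and y: "y \<in> carrier A" for k y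
    using y
  proof (induction rule: span_induct)
    case (basis j c)
    have "k \<otimes> (x [^] j \<otimes> c) = x [^] j \<otimes> ((T ^^ j) k \<otimes> c)"
      using basis k mult_x_pow[of k j] by (simp add: m_assoc[symmetric])
    then have "\<delta> (k \<otimes> (x [^] j \<otimes> c)) = pow_deriv j h \<otimes> ((T ^^ j) k \<otimes> c)"
      using basis k by (simp add: pow)
    also have "\<dots> = k \<otimes> (pow_deriv j h \<otimes> c)"
      using basis k hC J_pow_deriv_comm[OF h k, of j] by (simp add: m_assoc[symmetric])
    finally show ?case using basis by (simp add: pow)
  qed (use k in \<open>simp add: add r_distr\<close>)
  have lx: "\<delta> (x \<otimes> y) = h \<otimes> y \<oplus> x \<otimes> \<delta> y" if y: "y \<in> carrier A" for y
    using y
  proof (induction rule: span_induct)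
    case (add y z)
    then show ?case using hC by (simp add: \<open>\<And>y z. _ \<Longrightarrow> _ \<Longrightarrow> \<delta> (y \<oplus> z) = _\<close> r_distr a_ac)
  next
    case (basis j c)
    have "x \<otimes> (x [^] j \<otimes> c) = x [^] Suc j \<otimes> c"
      using basis nat_pow_Suc2[of x j] by (simp add: m_assoc[symmetric])
    then have "\<delta> (x \<otimes> (x [^] j \<otimes> c)) = pow_deriv (Suc j) h \<otimes> c"
      using basis by (simp only: pow Suc_leI)
    then show ?case using basis hC by (simp add: pow l_distr m_assoc a_comm)
  qed
  have K0: "\<delta> k = \<zero>" if "k \<in> K" for k
    using pow[of 0 k] that by simp
  have dx: "\<delta> x = h"
    using pow[of 1 \<one>] m_pos hC by simp
  have "\<forall>z\<in>carrier A. \<delta> (y \<otimes> z) = \<delta> y \<otimes> z \<oplus> y \<otimes> \<delta> z" if "y \<in> carrier A" for y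
    using that
  proof (induction rule: gen_induct)
    case (base k)
    then show ?case by (simp add: lK K0)
  next
    case x
    show ?case by (simp add: lx dx)
  next
    case (add y z)
    then show ?case by (simp add: \<open>\<And>y z. _ \<Longrightarrow> _ \<Longrightarrow> \<delta> (y \<oplus> z) = _\<close> l_distr a_ac)
  next
    case (mult y z)
    show ?case
    proof
      fix w assume w: "w \<in> carrier A"
      have "\<delta> (y \<otimes> z \<otimes> w) = \<delta> y \<otimes> (z \<otimes> w) \<oplus> y \<otimes> (\<delta> z \<otimes> w \<oplus> z \<otimes> \<delta> w)"
        using mult w by (simp add: m_assoc)
      also have "\<dots> = (\<delta> y \<otimes> z \<oplus> y \<otimes> \<delta> z) \<otimes> w \<oplus> y \<otimes> z \<otimes> \<delta> w"
        using mult.hyps w by (simp add: l_distr r_distr m_assoc a_ac)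
      finally show "\<delta> (y \<otimes> z \<otimes> w) = \<delta> (y \<otimes> z) \<otimes> w \<oplus> y \<otimes> z \<otimes> \<delta> w"
        using mult by simp
    qed
  qed
  then have "derivation_over A K \<delta>"
    unfolding derivation_over_def using add K0 cl by blast
  then show thesis using dx that by blast
qed

lemma weakly_separable_iff:
  "weakly_separable_ext A K \<longleftrightarrow> {h \<in> J. \<tau> h = \<zero>} = ad_x ` V"
proof
  assume ws: "weakly_separable_ext A K"
  show "{h \<in> J. \<tau> h = \<zero>} = ad_x ` V"
  proof (intro equalityI subsetI)
    fix h assume "h \<in> {h \<in> J. \<tau> h = \<zero>}"
    then obtain \<delta> where der: "derivation_over A K \<delta>" "\<delta> x = h"
      using exists_derivation by blast
    then obtain u where u: "u \<in> carrier A" "\<And>y. y \<in> carrier A \<Longrightarrow> \<delta> y = u \<otimes> y \<ominus> y \<otimes> u"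
      using ws unfolding weakly_separable_ext_def inner_derivation_def by blast
    have "u \<in> V"
      unfolding V_def centralizer_def
    proof (intro CollectI conjI ballI u(1))
      fix k assume k: "k \<in> K"
      then have "u \<otimes> k \<ominus> k \<otimes> u = \<zero>" using u(2)[of k] der(1) by (simp add: derivation_over_def)
      then show "k \<otimes> u = u \<otimes> k"
        using u(1) k minus_eq_zeroD[of "u \<otimes> k" "k \<otimes> u"] by simp
    qed
    moreover have "h = ad_x u" using u(2)[of x] der(2) by (simp add: ad_x_def)
    ultimately show "h \<in> ad_x ` V" by blast
  qed (auto simp: ad_x_in_J tau_ad_x)
next
  assume ex: "{h \<in> J. \<tau> h = \<zero>} = ad_x ` V"
  show "weakly_separable_ext A K"
    unfolding weakly_separable_ext_def inner_derivation_def
  proof (intro allI impI)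
    fix \<delta> assume der: "derivation_over A K \<delta>"
    then obtain u where "u \<in> V" "\<delta> x = ad_x u" using derivation_tau_zero ex by blast
    then show "\<exists>u\<in>carrier A. \<forall>y\<in>carrier A. \<delta> y = u \<otimes> y \<ominus> y \<otimes> u"
      using derivation_eq_inner[OF der] by (intro bexI[of _ u]) auto
  qed
qed

text \<open>Both sides equal \<open>a\<^sub>j h\<close>: the left one for every \<open>h \<in> A\<close>, the right one because \<open>h \<in> J\<close> and
  \<open>T(a\<^sub>j) = a\<^sub>j\<close>.\<close>

lemma T_J:
  assumes "h \<in> J" "j \<le> m"
  shows "(T ^^ j) h \<otimes> a j = h \<otimes> a j"
  using assms a_mult[of h j] J_a[of h j] by simp

text \<open>The element on the left is \<open>x\<^sup>k\<close> times the sum of \<open>T\<^sup>j(h)\<close> over \<open>1 \<le> j \<le> k + 1\<close>, plus the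
  term for \<open>j = 0\<close>; on the right the last term is split off instead.\<close>

lemma T_pow_deriv_shift:
  assumes hC: "h \<in> carrier A"
  shows "T (pow_deriv (Suc k) h) \<oplus> x [^] k \<otimes> h = pow_deriv (Suc k) h \<oplus> x [^] k \<otimes> (T ^^ Suc k) h"
proof (induction k)
  case 0
  show ?case using hC by (simp add: a_comm)
next
  case (Suc k)
  let ?pow_deriv = "pow_deriv (Suc k) h" and ?X = "x [^] Suc k"
  have c: "?X = x \<otimes> x [^] k" by (rule nat_pow_Suc2) simp
  have h: "h \<otimes> ?X = ?X \<otimes> (T ^^ Suc k) h" "T h \<otimes> ?X = ?X \<otimes> (T ^^ Suc (Suc k)) h"
    using hC mult_x_pow[of h "Suc k"] mult_x_pow[of "T h" "Suc k"] by (simp_all add: funpow_swap1)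
  have "T (pow_deriv (Suc (Suc k)) h) \<oplus> ?X \<otimes> h = (x \<otimes> T ?pow_deriv \<oplus> T h \<otimes> ?X) \<oplus> x \<otimes> (x [^] k \<otimes> h)"
  proof -
    have "?X \<otimes> h = x \<otimes> (x [^] k \<otimes> h)" unfolding c using hC by (simp add: m_assoc)
    moreover have "T ?X = ?X" using T_pow_x[of 1 "Suc k"] by simp
    ultimately show ?thesis
      unfolding pow_deriv.simps(2)[of "Suc k"] using hC by (simp del: pow_deriv.simps nat_pow_Suc add: T_add T_mult)
  qed
  also have "\<dots> = x \<otimes> (T ?pow_deriv \<oplus> x [^] k \<otimes> h) \<oplus> T h \<otimes> ?X"
    using hC by (simp del: pow_deriv.simps nat_pow_Suc add: r_distr a_ac)
  also have "\<dots> = x \<otimes> (?pow_deriv \<oplus> x [^] k \<otimes> (T ^^ Suc k) h) \<oplus> T h \<otimes> ?X"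
    unfolding Suc ..
  also have "\<dots> = x \<otimes> ?pow_deriv \<oplus> ?X \<otimes> (T ^^ Suc k) h \<oplus> ?X \<otimes> (T ^^ Suc (Suc k)) h"
    unfolding h(2) unfolding c using hC by (simp del: pow_deriv.simps funpow.simps nat_pow_Suc add: r_distr m_assoc)
  also have "\<dots> = pow_deriv (Suc (Suc k)) h \<oplus> ?X \<otimes> (T ^^ Suc (Suc k)) h"
    unfolding pow_deriv.simps(2)[of "Suc k"] h(1) ..
  finally show ?case .
qed

text \<open>Each summand \<open>\<delta>(x\<^sup>n) a\<^sub>n\<close> of \<open>\<tau>(h)\<close> already lies in \<open>W\<close>. It commutes with \<open>K\<close> since moving
  \<open>k\<close> past the first factor twists it by \<open>T\<^sup>n\<close>, which \<open>a\<^sub>n\<close> undoes. Applying \<open>T\<close> exchanges a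
  term \<open>x\<^sup>k h a\<^sub>n\<close> for \<open>x\<^sup>k T\<^sup>n(h) a\<^sub>n\<close> with \<open>n = k + 1\<close>, and these two agree.\<close>

lemma tau_in_W:
  assumes h: "h \<in> J"
  shows "\<tau> h \<in> W"
proof -
  have hC: "h \<in> carrier A" using h by simp
  have comm: "k \<otimes> (pow_deriv n h \<otimes> a n) = pow_deriv n h \<otimes> a n \<otimes> k" if "k \<in> K" "n \<le> m" for k n
    using J_pow_deriv_comm[OF h, of k n] a_mult[of k n] that hC by (simp add: m_assoc[symmetric]) (simp add: m_assoc)
  have "k \<otimes> \<tau> h = \<tau> h \<otimes> k" if k: "k \<in> K" for k
  proof -
    have "k \<otimes> \<tau> h = (\<Oplus>n\<in>{..m}. k \<otimes> (pow_deriv n h \<otimes> a n))"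
      unfolding tau_eq_pow_deriv[OF hC] using k hC by (intro finsum_rdistr) auto
    also have "\<dots> = (\<Oplus>n\<in>{..m}. pow_deriv n h \<otimes> a n \<otimes> k)"
      using k hC comm by (intro finsum_cong') auto
    also have "\<dots> = \<tau> h \<otimes> k"
      unfolding tau_eq_pow_deriv[OF hC] using k hC by (intro finsum_ldistr[symmetric]) auto
    finally show ?thesis .
  qed
  then have "\<tau> h \<in> V" unfolding V_def centralizer_def using tau_closed[OF hC] by blast
  moreover have "T (\<tau> h) = \<tau> h"
  proof -
    have term_fixed: "T (pow_deriv n h \<otimes> a n) = pow_deriv n h \<otimes> a n" if n: "n \<le> m" for n
    proof (cases n)
      case (Suc k)
      have "(T (pow_deriv n h) \<oplus> x [^] k \<otimes> h) \<otimes> a n = (pow_deriv n h \<oplus> x [^] k \<otimes> (T ^^ n) h) \<otimes> a n"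
        unfolding Suc T_pow_deriv_shift[OF hC] ..
      then have "T (pow_deriv n h) \<otimes> a n \<oplus> x [^] k \<otimes> (h \<otimes> a n) = pow_deriv n h \<otimes> a n \<oplus> x [^] k \<otimes> ((T ^^ n) h \<otimes> a n)"
        using hC by (simp add: l_distr m_assoc)
      then have "T (pow_deriv n h) \<otimes> a n = pow_deriv n h \<otimes> a n"
        using hC T_J[OF h n] by simp
      then show ?thesis using hC by (simp add: T_mult)
    qed simp
    have "T (\<Oplus>n\<in>S. pow_deriv n h \<otimes> a n) = (\<Oplus>n\<in>S. pow_deriv n h \<otimes> a n)" if "finite S" "S \<subseteq> {..m}" for S
      using that
    proof (induction S rule: finite_induct)
      case (insert n S)
      then show ?case using hC term_fixed[of n] by (simp add: Pi_iff T_add finsum_closed)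
    qed simp
    from this[of "{..m}"] show ?thesis using hC by (simp add: tau_eq_pow_deriv)
  qed
  ultimately show ?thesis unfolding W_def by blast
qed

end


section \<open>Separability and the image of \<open>\<tau>\<close>\<close>

context ring_ext
begin

lemma separability_element_commute:
  assumes e: "separability_element e" and g: "balanced g" and b: "b \<in> carrier A"
  shows "frag_eval A (\<lambda>p. g (b \<otimes> fst p, snd p)) e = frag_eval A (\<lambda>p. g (fst p, snd p \<otimes> b)) e"
proof -
  have e': "Poly_Mapping.keys e \<subseteq> AA" "pair_act A b \<one> e - pair_act A \<one> b e \<in> N"
    using e b unfolding separability_element_def by blast+
  have gC: "g \<in> AA \<rightarrow> carrier A" using g by (simp add: balanced_def)
  have "frag_eval A g (pair_act A b \<one> e) = frag_eval A g (pair_act A \<one> b e)"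
    using e' b by (intro frag_eval_eq_of_kernel[OF g]) (simp_all add: pair_act_keys)
  moreover have "frag_eval A g (pair_act A b \<one> e) = frag_eval A (\<lambda>p. g (b \<otimes> fst p, snd p)) e"
    using e' b gC by (subst frag_eval_pair_act) (auto intro!: frag_eval_cong)
  moreover have "frag_eval A g (pair_act A \<one> b e) = frag_eval A (\<lambda>p. g (fst p, snd p \<otimes> b)) e"
    using e' b gC by (subst frag_eval_pair_act) (auto intro!: frag_eval_cong)
  ultimately show ?thesis by simp
qed

end

context skew_extension
begin

text \<open>The coefficient of \<open>x\<^sup>m\<^sup>-\<^sup>1\<close> when the coefficients are written on the left of the powers of
  \<open>x\<close>: since \<open>T\<^sup>m = 1\<close> on \<open>K\<close>, moving \<open>c\<close> in \<open>x\<^sup>m\<^sup>-\<^sup>1 c\<close> to the left turns it into \<open>T(c)\<close>.\<close>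

definition top_coeff :: "'a \<Rightarrow> 'a" where
  "top_coeff y = T (coord y (m - 1))"

lemma top_coeff_K [simp, intro]: "y \<in> carrier A \<Longrightarrow> top_coeff y \<in> K"
  using m_pos by (auto simp: top_coeff_def coord)

lemma top_coeff_closed [simp]: "y \<in> carrier A \<Longrightarrow> top_coeff y \<in> carrier A"
  by blast

lemma top_coeff_add:
  "y \<in> carrier A \<Longrightarrow> z \<in> carrier A \<Longrightarrow> top_coeff (y \<oplus> z) = top_coeff y \<oplus> top_coeff z"
  using m_pos by (simp add: top_coeff_def coord_add T_add)

lemma top_coeff_rmult:
  "y \<in> carrier A \<Longrightarrow> k \<in> K \<Longrightarrow> top_coeff (y \<otimes> k) = top_coeff y \<otimes> T k"
  using m_pos by (simp add: top_coeff_def coord_rmult T_mult)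

lemma top_coeff_lmult:
  assumes "y \<in> carrier A" "k \<in> K"
  shows "top_coeff (k \<otimes> y) = k \<otimes> top_coeff y"
proof -
  have "T ((T ^^ (m - 1)) k) = (T ^^ m) k" using m_pos by (cases m) auto
  then show ?thesis
    using assms m_pos by (simp add: top_coeff_def coord_lmult T_mult T_order)
qed

lemma top_coeff_zero [simp]: "top_coeff \<zero> = \<zero>"
  using top_coeff_lmult[of \<zero> \<zero>] by simp

lemma top_coeff_x_pow: "n < m \<Longrightarrow> top_coeff (x [^] n) = (if n = m - 1 then \<one> else \<zero>)"
  using coord_basis[of n \<one> "m - 1"] by (simp add: top_coeff_def)

text \<open>The sum of \<open>\<pi>(v x\<^sup>i) x\<^sup>j\<close> over \<open>i + j = n - 1\<close>, where \<open>\<pi>\<close> stands for \<open>top_coeff\<close>.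
  If \<open>h = \<Sum> u\<^sub>i \<pi>(v\<^sub>i)\<close> is obtained from a separability element \<open>\<Sum> u\<^sub>i \<otimes> v\<^sub>i\<close>, then
  \<open>pow_deriv n h\<close> is the sum of the \<open>u\<^sub>i dual_part n v\<^sub>i\<close>.\<close>

primrec dual_part :: "nat \<Rightarrow> 'a \<Rightarrow> 'a" where
  "dual_part 0 v = \<zero>"
| "dual_part (Suc n) v = dual_part n v \<otimes> x \<oplus> top_coeff (v \<otimes> x [^] n)"

lemma dual_part_closed [simp]: "v \<in> carrier A \<Longrightarrow> dual_part n v \<in> carrier A"
  by (induction n) auto

lemma dual_part_Suc_left:
  "v \<in> carrier A \<Longrightarrow> dual_part (Suc n) v = dual_part n (v \<otimes> x) \<oplus> top_coeff v \<otimes> x [^] n"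
proof (induction n)
  case (Suc n)
  have c: "x \<otimes> x [^] n = x [^] Suc n" using nat_pow_Suc2[of x n] by simp
  have "dual_part (Suc (Suc n)) v =
    (dual_part n (v \<otimes> x) \<oplus> top_coeff v \<otimes> x [^] n) \<otimes> x \<oplus> top_coeff (v \<otimes> x [^] Suc n)"
    using Suc by (metis dual_part.simps(2))
  also have "\<dots> = (dual_part n (v \<otimes> x) \<otimes> x \<oplus> top_coeff (v \<otimes> x \<otimes> x [^] n)) \<oplus> top_coeff v \<otimes> x [^] Suc n"
    unfolding m_assoc[OF Suc.prems x_closed nat_pow_closed[OF x_closed]] c
    using Suc.prems by (simp add: l_distr m_assoc a_ac)
  finally show ?case by simp
qed simp

lemma dual_part_add: "v \<in> carrier A \<Longrightarrow> w \<in> carrier A \<Longrightarrow> dual_part n (v \<oplus> w) = dual_part n v \<oplus> dual_part n w"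
  by (induction n) (simp_all add: l_distr top_coeff_add a_ac)

lemma dual_part_lmult: "v \<in> carrier A \<Longrightarrow> k \<in> K \<Longrightarrow> dual_part n (k \<otimes> v) = k \<otimes> dual_part n v"
  by (induction n) (simp_all add: r_distr m_assoc top_coeff_lmult)

lemma dual_part_one: "n < m \<Longrightarrow> dual_part n \<one> = \<zero>"
  by (induction n) (auto simp: top_coeff_x_pow)

lemma dual_part_one_m: "dual_part m \<one> = \<one>"
proof -
  have m: "m = Suc (m - 1)" "m - 1 < m" using m_pos by auto
  have "dual_part (Suc (m - 1)) \<one> = \<one>"
    unfolding dual_part.simps dual_part_one[OF m(2)] using top_coeff_x_pow[OF m(2)] by simp
  then show ?thesis using m(1) by argo
qed

definition dual_sum :: "'a \<Rightarrow> 'a" where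
  "dual_sum v = (\<Oplus>n\<in>{..m}. dual_part n v \<otimes> a n)"

lemma dual_sum_closed [simp]: "v \<in> carrier A \<Longrightarrow> dual_sum v \<in> carrier A"
  by (simp add: dual_sum_def)

text \<open>The two recursions for \<open>dual_part\<close> show that the difference of the two sides telescopes to
  \<open>\<pi>(v f(x)) - \<pi>(v) f(x)\<close> for \<open>\<pi> = top_coeff\<close>, where both terms vanish.\<close>

lemma dual_sum_mult_x:
  assumes v: "v \<in> carrier A"
  shows "dual_sum (v \<otimes> x) = dual_sum v \<otimes> x"
proof -
  have "top_coeff (\<Oplus>n\<in>S. v \<otimes> (x [^] n \<otimes> a n)) = (\<Oplus>n\<in>S. top_coeff (v \<otimes> x [^] n) \<otimes> a n)"
    if "finite S" for S
    using that
  proof (induction S rule: finite_induct)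
    case (insert n S)
    have "top_coeff (v \<otimes> (x [^] n \<otimes> a n)) = top_coeff (v \<otimes> x [^] n) \<otimes> a n"
      using v by (simp add: m_assoc[symmetric] top_coeff_rmult)
    then show ?case using v insert by (simp add: Pi_iff top_coeff_add finsum_closed)
  qed simp
  moreover have "(\<Oplus>n\<in>{..m}. v \<otimes> (x [^] n \<otimes> a n)) = \<zero>"
    using v root by (subst finsum_rdistr[symmetric]) auto
  ultimately have 1: "(\<Oplus>n\<in>{..m}. top_coeff (v \<otimes> x [^] n) \<otimes> a n) = \<zero>"
    by (metis finite_atMost top_coeff_zero)
  have 2: "(\<Oplus>n\<in>{..m}. top_coeff v \<otimes> (x [^] n \<otimes> a n)) = \<zero>"
    using v root by (subst finsum_rdistr[symmetric]) auto
  have "dual_sum (v \<otimes> x) \<oplus> (\<Oplus>n\<in>{..m}. top_coeff v \<otimes> (x [^] n \<otimes> a n)) =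
      (\<Oplus>n\<in>{..m}. dual_part n (v \<otimes> x) \<otimes> a n \<oplus> top_coeff v \<otimes> (x [^] n \<otimes> a n))"
    unfolding dual_sum_def using v by (intro finsum_addf[symmetric]) auto
  also have "\<dots> = (\<Oplus>n\<in>{..m}. dual_part n v \<otimes> a n \<otimes> x \<oplus> top_coeff (v \<otimes> x [^] n) \<otimes> a n)"
  proof (intro finsum_cong')
    fix n
    have "dual_part n (v \<otimes> x) \<oplus> top_coeff v \<otimes> x [^] n = dual_part n v \<otimes> x \<oplus> top_coeff (v \<otimes> x [^] n)"
      using dual_part_Suc_left[OF v, of n] by simp
    then have "(dual_part n (v \<otimes> x) \<oplus> top_coeff v \<otimes> x [^] n) \<otimes> a n = (dual_part n v \<otimes> x \<oplus> top_coeff (v \<otimes> x [^] n)) \<otimes> a n"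
      by simp
    then show "dual_part n (v \<otimes> x) \<otimes> a n \<oplus> top_coeff v \<otimes> (x [^] n \<otimes> a n) =
        dual_part n v \<otimes> a n \<otimes> x \<oplus> top_coeff (v \<otimes> x [^] n) \<otimes> a n"
      using v by (simp add: l_distr m_assoc a_x)
  qed (use v in auto)
  also have "\<dots> = (\<Oplus>n\<in>{..m}. dual_part n v \<otimes> a n \<otimes> x) \<oplus> (\<Oplus>n\<in>{..m}. top_coeff (v \<otimes> x [^] n) \<otimes> a n)"
    using v by (intro finsum_addf) auto
  also have "(\<Oplus>n\<in>{..m}. dual_part n v \<otimes> a n \<otimes> x) = dual_sum v \<otimes> x"
    unfolding dual_sum_def using v by (intro finsum_ldistr[symmetric]) auto
  finally show ?thesis unfolding 1 2 using v by simp
qed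

text \<open>The reproducing formula for \<open>top_coeff\<close>: its values at the \<open>v x\<^sup>i\<close> determine \<open>v\<close>. Both sides are left \<open>K\<close>-linear and compatible with right
  multiplication by \<open>x\<close>, and they agree at \<open>1\<close>.\<close>

lemma dual_sum_id:
  assumes "v \<in> carrier A"
  shows "dual_sum v = v"
  using assms
proof (induction rule: span_induct)
  case (add y z)
  have "dual_sum (y \<oplus> z) = (\<Oplus>n\<in>{..m}. dual_part n y \<otimes> a n \<oplus> dual_part n z \<otimes> a n)"
    unfolding dual_sum_def using add by (intro finsum_cong') (auto simp: dual_part_add l_distr)
  also have "\<dots> = dual_sum y \<oplus> dual_sum z"
    unfolding dual_sum_def using add by (intro finsum_addf) auto
  finally show ?case using add by simp
next
  case (basis j k)
  have "dual_sum \<one> = dual_part m \<one> \<otimes> a m"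
    unfolding dual_sum_def by (intro finsum_single) (auto simp: dual_part_one)
  then have one: "dual_sum \<one> = \<one>" by (simp add: dual_part_one_m)
  have pow: "dual_sum (x [^] (n::nat)) = x [^] n" for n
    by (induction n) (simp_all add: one dual_sum_mult_x)
  (* T^(m-j) inverts T^j on K, which moves the coefficient k from the right of x^j to the left *)
  let ?k = "(T ^^ (m - j)) k"
  have "(T ^^ j) ?k = (T ^^ m) k" using basis by (simp flip: funpow_add[THEN fun_cong, unfolded o_apply])
  then have eq: "x [^] j \<otimes> k = ?k \<otimes> x [^] j"
    using basis mult_x_pow[of ?k j] by (simp add: T_order)
  have "dual_sum (?k \<otimes> x [^] j) = (\<Oplus>n\<in>{..m}. ?k \<otimes> (dual_part n (x [^] j) \<otimes> a n))"
    unfolding dual_sum_def using basis by (intro finsum_cong') (auto simp: dual_part_lmult m_assoc)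
  also have "\<dots> = ?k \<otimes> dual_sum (x [^] j)"
    unfolding dual_sum_def using basis by (intro finsum_rdistr[symmetric]) auto
  finally show ?case unfolding eq pow .
qed

text \<open>Take \<open>h = \<Sum> u\<^sub>i \<pi>(v\<^sub>i)\<close> with \<open>\<pi> = top_coeff\<close>. Commutation of the separability element with \<open>b\<close> gives
  \<open>b h = \<Sum> u\<^sub>i \<pi>(v\<^sub>i b)\<close>. For \<open>b \<in> K\<close> this says \<open>h \<in> J\<close>; for powers of \<open>x\<close> it turns
  \<open>\<tau>(h)\<close> into \<open>\<Sum> u\<^sub>i dual_sum(v\<^sub>i) = \<Sum> u\<^sub>i v\<^sub>i = 1\<close>.\<close>

lemma separable_imp_tau_one:
  assumes "separable_ext A K"
  obtains h where "h \<in> J" "\<tau> h = \<one>"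
proof -
  obtain e where e: "separability_element e" using assms separable_ext_iff by blast
  have keys: "Poly_Mapping.keys e \<subseteq> AA" and mult: "pair_eval A e = \<one>"
    using e unfolding separability_element_def by blast+
  define g where "g p = fst p \<otimes> top_coeff (snd p)" for p
  have gC: "g \<in> AA \<rightarrow> carrier A" by (auto simp: g_def)
  have bal: "balanced g"
    unfolding balanced_def using gC
    by (auto simp: g_def l_distr r_distr m_assoc top_coeff_add top_coeff_lmult)
  define h where "h = frag_eval A g e"
  have h: "h \<in> carrier A" unfolding h_def using gC keys by (intro frag_eval_closed) blast
  have left: "b \<otimes> h = frag_eval A (\<lambda>p. fst p \<otimes> top_coeff (snd p \<otimes> b)) e" if b: "b \<in> carrier A" for b
  proof -
    have "b \<otimes> h = frag_eval A (\<lambda>p. b \<otimes> g p) e"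
      unfolding h_def by (rule frag_eval_lmult[OF keys gC b, symmetric])
    also have "\<dots> = frag_eval A (\<lambda>p. g (b \<otimes> fst p, snd p)) e"
      by (rule frag_eval_cong[OF keys]) (use b in \<open>auto simp: g_def m_assoc\<close>)
    also have "\<dots> = frag_eval A (\<lambda>p. g (fst p, snd p \<otimes> b)) e"
      by (rule separability_element_commute[OF e bal b])
    finally show ?thesis by (simp add: g_def)
  qed
  have "k \<otimes> h = h \<otimes> T k" if k: "k \<in> K" for k
  proof -
    have "k \<otimes> h = frag_eval A (\<lambda>p. fst p \<otimes> top_coeff (snd p \<otimes> k)) e" using left k by blast
    also have "\<dots> = frag_eval A (\<lambda>p. g p \<otimes> T k) e"
      by (rule frag_eval_cong[OF keys]) (use k in \<open>auto simp: g_def m_assoc top_coeff_rmult\<close>)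
    also have "\<dots> = h \<otimes> T k"
      unfolding h_def using k by (intro frag_eval_rmult[OF keys gC]) blast
    finally show ?thesis .
  qed
  then have hJ: "h \<in> J" unfolding J_def using h by blast
  have pow_deriv: "pow_deriv n h = frag_eval A (\<lambda>p. fst p \<otimes> dual_part n (snd p)) e" for n
  proof (induction n)
    case 0
    have "frag_eval A (\<lambda>p. fst p \<otimes> dual_part 0 (snd p)) e = frag_eval A (\<lambda>p. \<zero> \<otimes> g p) e"
      by (rule frag_eval_cong[OF keys]) (auto simp: g_def)
    also have "\<dots> = \<zero>" using frag_eval_lmult[OF keys gC, of \<zero>] h by (simp add: h_def)
    finally show ?case by simp
  next
    case (Suc n)
    have "pow_deriv (Suc n) h = frag_eval A (\<lambda>p. fst p \<otimes> dual_part n (snd p)) e \<otimes> x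
        \<oplus> frag_eval A (\<lambda>p. fst p \<otimes> top_coeff (snd p \<otimes> x [^] n)) e"
      unfolding pow_deriv_Suc_right[OF h] Suc left[OF nat_pow_closed[OF x_closed]] ..
    also have "frag_eval A (\<lambda>p. fst p \<otimes> dual_part n (snd p)) e \<otimes> x = frag_eval A (\<lambda>p. fst p \<otimes> dual_part n (snd p) \<otimes> x) e"
      by (rule frag_eval_rmult[OF keys, symmetric]) auto
    also have "\<dots> \<oplus> frag_eval A (\<lambda>p. fst p \<otimes> top_coeff (snd p \<otimes> x [^] n)) e =
        frag_eval A (\<lambda>p. fst p \<otimes> dual_part n (snd p) \<otimes> x \<oplus> fst p \<otimes> top_coeff (snd p \<otimes> x [^] n)) e"
      by (rule frag_eval_fun_add[OF keys, symmetric]) auto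
    also have "\<dots> = frag_eval A (\<lambda>p. fst p \<otimes> dual_part (Suc n) (snd p)) e"
      by (rule frag_eval_cong[OF keys]) (auto simp: r_distr m_assoc)
    finally show ?case .
  qed
  have "(\<Oplus>n\<in>S. pow_deriv n h \<otimes> a n) = frag_eval A (\<lambda>p. fst p \<otimes> (\<Oplus>n\<in>S. dual_part n (snd p) \<otimes> a n)) e"
    if "finite S" for S
    using that
  proof (induction S rule: finite_induct)
    case empty
    have "frag_eval A (\<lambda>p. fst p \<otimes> \<zero>) e = frag_eval A (\<lambda>p. \<zero> \<otimes> g p) e"
      by (rule frag_eval_cong[OF keys]) (auto simp: g_def)
    also have "\<dots> = \<zero>" using frag_eval_lmult[OF keys gC, of \<zero>] h by (simp add: h_def)
    finally show ?case by simp
  next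
    case (insert n S)
    have "pow_deriv n h \<otimes> a n = frag_eval A (\<lambda>p. fst p \<otimes> dual_part n (snd p) \<otimes> a n) e"
      unfolding pow_deriv by (rule frag_eval_rmult[OF keys, symmetric]) auto
    moreover have "(\<Oplus>n\<in>insert n S. pow_deriv n h \<otimes> a n) = pow_deriv n h \<otimes> a n \<oplus> (\<Oplus>n\<in>S. pow_deriv n h \<otimes> a n)"
      using insert.hyps h by (simp add: Pi_iff)
    ultimately have "(\<Oplus>n\<in>insert n S. pow_deriv n h \<otimes> a n) =
      frag_eval A (\<lambda>p. fst p \<otimes> dual_part n (snd p) \<otimes> a n) e \<oplus>
      frag_eval A (\<lambda>p. fst p \<otimes> (\<Oplus>n\<in>S. dual_part n (snd p) \<otimes> a n)) e"
      using insert.IH by simp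
    also have "\<dots> = frag_eval A (\<lambda>p. fst p \<otimes> dual_part n (snd p) \<otimes> a n \<oplus> fst p \<otimes> (\<Oplus>n\<in>S. dual_part n (snd p) \<otimes> a n)) e"
      by (rule frag_eval_fun_add[OF keys, symmetric]) (auto intro!: finsum_closed)
    also have "\<dots> = frag_eval A (\<lambda>p. fst p \<otimes> (\<Oplus>n\<in>insert n S. dual_part n (snd p) \<otimes> a n)) e"
      by (rule frag_eval_cong[OF keys])
        (use insert in \<open>auto simp: r_distr m_assoc Pi_iff intro!: finsum_closed\<close>)
    finally show ?case .
  qed
  then have "\<tau> h = frag_eval A (\<lambda>p. fst p \<otimes> dual_sum (snd p)) e"
    by (simp add: tau_eq_pow_deriv[OF h] dual_sum_def)
  also have "\<dots> = pair_eval A e"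
    unfolding pair_eval_eq by (rule frag_eval_cong[OF keys]) (auto simp: dual_sum_id)
  finally show thesis using hJ mult that by simp
qed

text \<open>The formal sum of the pairs \<open>(x\<^sup>i h, x\<^sup>j)\<close> over \<open>i + j = n - 1\<close>; multiplying out gives
  \<open>pow_deriv n h\<close>.\<close>

primrec pow_tensor :: "'a \<Rightarrow> nat \<Rightarrow> ('a \<times> 'a \<Rightarrow>\<^sub>0 int)" where
  "pow_tensor h 0 = 0"
| "pow_tensor h (Suc n) = pair_act A \<one> x (pow_tensor h n) + frag_of (x [^] n \<otimes> h, \<one>)"

lemma pow_tensor_keys: "h \<in> carrier A \<Longrightarrow> Poly_Mapping.keys (pow_tensor h n) \<subseteq> AA"
  by (induction n) (simp_all add: keys_add_sub pair_act_keys)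

lemma pow_tensor_Suc_left:
  assumes h: "h \<in> carrier A"
  shows "pow_tensor h (Suc n) = pair_act A x \<one> (pow_tensor h n) + frag_of (h, x [^] n)"
proof (induction n)
  case 0
  then show ?case using h by simp
next
  case (Suc n)
  have c: "x \<otimes> x [^] n = x [^] Suc n" using nat_pow_Suc2[of x n] by simp
  have "pow_tensor h (Suc (Suc n)) =
    pair_act A \<one> x (pair_act A x \<one> (pow_tensor h n) + frag_of (h, x [^] n)) + frag_of (x [^] Suc n \<otimes> h, \<one>)"
    using Suc by (metis pow_tensor.simps(2))
  also have "\<dots> = pair_act A x \<one> (pair_act A \<one> x (pow_tensor h n)) + frag_of (h, x [^] Suc n)
      + pair_act A x \<one> (frag_of (x [^] n \<otimes> h, \<one>))"
    using h by (simp add: pair_act_add pair_act_comp pow_tensor_keys m_assoc[symmetric] c)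
  also have "\<dots> = pair_act A x \<one> (pow_tensor h (Suc n)) + frag_of (h, x [^] Suc n)"
    by (simp add: pair_act_add add.assoc add.commute)
  finally show ?case .
qed

lemma pair_eval_pow_tensor: "h \<in> carrier A \<Longrightarrow> pair_eval A (pow_tensor h n) = pow_deriv n h"
proof (induction n)
  case 0
  then show ?case by (simp add: pair_eval_eq)
next
  case (Suc n)
  have P: "(\<lambda>p. fst p \<otimes> snd p) \<in> AA \<rightarrow> carrier A" by auto
  note k = pow_tensor_keys[OF Suc.prems, of n]
  have "pair_eval A (pair_act A \<one> x (pow_tensor h n)) = frag_eval A (\<lambda>p. fst p \<otimes> snd p \<otimes> x) (pow_tensor h n)"
    unfolding pair_eval_eq using k by (subst frag_eval_pair_act) (auto intro!: frag_eval_cong simp: m_assoc)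
  also have "\<dots> = pow_deriv n h \<otimes> x"
    using frag_eval_rmult[OF k P x_closed] Suc by (simp add: pair_eval_eq)
  finally have "pair_eval A (pair_act A \<one> x (pow_tensor h n)) = pow_deriv n h \<otimes> x" .
  then have "pair_eval A (pow_tensor h (Suc n)) = pow_deriv n h \<otimes> x \<oplus> x [^] n \<otimes> h"
    using k Suc.prems unfolding pair_eval_eq pow_tensor.simps
    by (subst frag_eval_add[OF _ _ P]) (simp_all add: pair_act_keys)
  then show ?case using Suc.prems by (simp only: pow_deriv_Suc_right)
qed

lemma pow_tensor_comm_K:
  assumes h: "h \<in> J" and k: "k \<in> K"
  shows "tensor_class (pair_act A k \<one> (pow_tensor h n)) = tensor_class (pair_act A \<one> ((T ^^ n) k) (pow_tensor h n))"
proof (induction n)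
  case (Suc n)
  have hC: "h \<in> carrier A" using h by simp
  note ks = pow_tensor_keys[OF hC, of n]
  have kk: "(T ^^ j) k \<in> carrier A" for j using k by blast
  have "tensor_class (pair_act A k \<one> (pair_act A \<one> x (pow_tensor h n))) = tensor_class (pair_act A \<one> x (pair_act A k \<one> (pow_tensor h n)))"
    using ks k hC by (simp add: pair_act_comp)
  also have "\<dots> = tensor_class (pair_act A \<one> x (pair_act A \<one> ((T ^^ n) k) (pow_tensor h n)))"
    by (rule tensor_class_act[OF Suc]) auto
  also have "\<dots> = tensor_class (pair_act A \<one> ((T ^^ Suc n) k) (pair_act A \<one> x (pow_tensor h n)))"
    using ks k hC kk mult_x[of "(T ^^ n) k"] by (simp add: pair_act_comp)
  finally have 1: "tensor_class (pair_act A k \<one> (pair_act A \<one> x (pow_tensor h n))) =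
    tensor_class (pair_act A \<one> ((T ^^ Suc n) k) (pair_act A \<one> x (pow_tensor h n)))" .
  have "k \<otimes> (x [^] n \<otimes> h) = x [^] n \<otimes> h \<otimes> (T ^^ Suc n) k"
    using k hC mult_x_pow[of k n] J_comm[OF h, of "(T ^^ n) k"] by (simp add: m_assoc[symmetric]) (simp add: m_assoc)
  then have "tensor_class (pair_act A k \<one> (frag_of (x [^] n \<otimes> h, \<one>))) = tensor_class (frag_of (x [^] n \<otimes> h \<otimes> (T ^^ Suc n) k, \<one>))"
    by (simp del: funpow.simps)
  also have "\<dots> = tensor_class (pair_act A \<one> ((T ^^ Suc n) k) (frag_of (x [^] n \<otimes> h, \<one>)))"
    using k hC kk by (subst tensor_class_balance) (auto simp del: funpow.simps)
  finally have "tensor_class (pair_act A k \<one> (frag_of (x [^] n \<otimes> h, \<one>))) =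
    tensor_class (pair_act A \<one> ((T ^^ Suc n) k) (frag_of (x [^] n \<otimes> h, \<one>)))" .
  from tensor_class_add[OF 1 this] show ?case by (simp add: pair_act_add del: funpow.simps)
qed simp

text \<open>The separability element is \<open>\<Sum> x\<^sup>i h \<otimes> x\<^sup>j a\<^sub>n\<close> over \<open>n \<le> m\<close> and \<open>i + j = n - 1\<close>, whose
  product is \<open>\<tau>(h)\<close>. Its commutator with \<open>x\<close> telescopes to
  \<open>\<Sum> x\<^sup>n h \<otimes> a\<^sub>n - \<Sum> h \<otimes> x\<^sup>n a\<^sub>n\<close>. The second sum is \<open>h \<otimes> f(x) = 0\<close>; the first one is
  \<open>f(x) h \<otimes> 1 = 0\<close>, since \<open>h\<close> commutes with the \<open>a\<^sub>n\<close>.\<close>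

lemma tau_one_imp_separable:
  assumes h: "h \<in> J" and tau: "\<tau> h = \<one>"
  shows "separable_ext A K"
proof -
  have hC: "h \<in> carrier A" using h by simp
  note ks = pow_tensor_keys[OF hC]
  define e where "e = (\<Sum>n\<le>m. pair_act A \<one> (a n) (pow_tensor h n))"
  have keys: "Poly_Mapping.keys e \<subseteq> AA"
    unfolding e_def using sum_closed_free_Abelian_group[of "{..m}" "\<lambda>n. pair_act A \<one> (a n) (pow_tensor h n)" AA]
    by (simp add: pair_act_keys ks)
  have P: "(\<lambda>p. fst p \<otimes> snd p) \<in> AA \<rightarrow> carrier A" by auto
  have "pair_eval A e = (\<Oplus>n\<in>{..m}. pair_eval A (pair_act A \<one> (a n) (pow_tensor h n)))"
    unfolding e_def pair_eval_eq by (intro frag_eval_sum) (auto simp: pair_act_keys ks P)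
  also have "\<dots> = (\<Oplus>n\<in>{..m}. pow_deriv n h \<otimes> a n)"
  proof (intro finsum_cong')
    fix n
    have "pair_eval A (pair_act A \<one> (a n) (pow_tensor h n)) = frag_eval A (\<lambda>p. fst p \<otimes> snd p \<otimes> a n) (pow_tensor h n)"
      unfolding pair_eval_eq using ks by (subst frag_eval_pair_act) (auto intro!: frag_eval_cong simp: m_assoc)
    also have "\<dots> = pow_deriv n h \<otimes> a n"
      using frag_eval_rmult[OF ks P, of "a n"] pair_eval_pow_tensor[OF hC, of n] by (simp add: pair_eval_eq)
    finally show "pair_eval A (pair_act A \<one> (a n) (pow_tensor h n)) = pow_deriv n h \<otimes> a n" .
  qed (use hC in auto)
  finally have mult: "pair_eval A e = \<one>" using tau hC by (simp add: tau_eq_pow_deriv)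
  have comm_K: "tensor_class (pair_act A k \<one> e) = tensor_class (pair_act A \<one> k e)" if k: "k \<in> K" for k
    unfolding e_def pair_act_sum
  proof (rule tensor_class_sum)
    fix n assume n: "n \<in> {..m}"
    have kn: "(T ^^ n) k \<in> carrier A" using k by blast
    have "tensor_class (pair_act A k \<one> (pair_act A \<one> (a n) (pow_tensor h n))) = tensor_class (pair_act A \<one> (a n) (pair_act A k \<one> (pow_tensor h n)))"
      using ks k by (simp add: pair_act_comp)
    also have "\<dots> = tensor_class (pair_act A \<one> (a n) (pair_act A \<one> ((T ^^ n) k) (pow_tensor h n)))"
      by (rule tensor_class_act[OF pow_tensor_comm_K[OF h k]]) auto
    also have "\<dots> = tensor_class (pair_act A \<one> k (pair_act A \<one> (a n) (pow_tensor h n)))"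
      using ks k kn a_mult[of k n] n by (simp add: pair_act_comp)
    finally show "tensor_class (pair_act A k \<one> (pair_act A \<one> (a n) (pow_tensor h n))) =
        tensor_class (pair_act A \<one> k (pair_act A \<one> (a n) (pow_tensor h n)))" .
  qed
  have comm_x: "tensor_class (pair_act A x \<one> e) = tensor_class (pair_act A \<one> x e)"
  proof -
    have step: "pair_act A x \<one> (pair_act A \<one> (a n) (pow_tensor h n)) + frag_of (h, x [^] n \<otimes> a n) =
        pair_act A \<one> x (pair_act A \<one> (a n) (pow_tensor h n)) + frag_of (x [^] n \<otimes> h, a n)" for n
    proof -
      have "pair_act A \<one> (a n) (pair_act A x \<one> (pow_tensor h n) + frag_of (h, x [^] n)) =
        pair_act A \<one> (a n) (pair_act A \<one> x (pow_tensor h n) + frag_of (x [^] n \<otimes> h, \<one>))"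
        using pow_tensor_Suc_left[OF hC, of n] by simp
      then show ?thesis
        using ks hC a_x[of n] by (simp add: pair_act_add pair_act_comp)
    qed
    have "tensor_class (\<Sum>n\<le>m. frag_of (h, x [^] n \<otimes> a n)) = tensor_class (frag_of (h, \<Oplus>n\<in>{..m}. x [^] n \<otimes> a n))"
      using hC by (intro tensor_class_sum_right) auto
    also have "\<dots> = tensor_class 0" unfolding root by (rule tensor_class_zero_right[OF hC])
    finally have right: "tensor_class (\<Sum>n\<le>m. frag_of (h, x [^] n \<otimes> a n)) = tensor_class 0" .
    have "tensor_class (\<Sum>n\<le>m. frag_of (x [^] n \<otimes> h, a n)) = tensor_class (\<Sum>n\<le>m. frag_of (x [^] n \<otimes> a n \<otimes> h, \<one>))"
    proof (rule tensor_class_sum)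
      fix n assume n: "n \<in> {..m}"
      have "tensor_class (frag_of (x [^] n \<otimes> h \<otimes> a n, \<one>)) = tensor_class (frag_of (x [^] n \<otimes> h, a n \<otimes> \<one>))"
        using hC by (intro tensor_class_balance) auto
      moreover have "x [^] n \<otimes> h \<otimes> a n = x [^] n \<otimes> a n \<otimes> h"
        using hC J_a[OF h, of n] n by (simp add: m_assoc)
      ultimately show "tensor_class (frag_of (x [^] n \<otimes> h, a n)) = tensor_class (frag_of (x [^] n \<otimes> a n \<otimes> h, \<one>))"
        by simp
    qed
    also have "\<dots> = tensor_class (frag_of (\<Oplus>n\<in>{..m}. x [^] n \<otimes> a n \<otimes> h, \<one>))"
      using hC by (intro tensor_class_sum_left) auto
    also have "(\<Oplus>n\<in>{..m}. x [^] n \<otimes> a n \<otimes> h) = \<zero>"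
      using hC root by (subst finsum_ldistr[symmetric]) auto
    also have "tensor_class (frag_of (\<zero>, \<one>)) = tensor_class 0" by (rule tensor_class_zero_left) simp
    finally have left: "tensor_class (\<Sum>n\<le>m. frag_of (x [^] n \<otimes> h, a n)) = tensor_class 0" .
    have "tensor_class (pair_act A x \<one> e) = tensor_class (pair_act A x \<one> e + (\<Sum>n\<le>m. frag_of (h, x [^] n \<otimes> a n)))"
      using tensor_class_add[OF refl right, of "pair_act A x \<one> e"] by simp
    also have "\<dots> = tensor_class (pair_act A \<one> x e + (\<Sum>n\<le>m. frag_of (x [^] n \<otimes> h, a n)))"
      unfolding e_def pair_act_sum sum.distrib[symmetric] step ..
    also have "\<dots> = tensor_class (pair_act A \<one> x e)"
      using tensor_class_add[OF refl left, of "pair_act A \<one> x e"] by simp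
    finally show ?thesis .
  qed
  have "tensor_class (pair_act A b \<one> e) = tensor_class (pair_act A \<one> b e)" if "b \<in> carrier A" for b
    using that
  proof (induction rule: gen_induct)
    case (add y z)
    have "tensor_class (pair_act A (y \<oplus> z) \<one> e) = tensor_class (pair_act A y \<one> e + pair_act A z \<one> e)"
      using add keys by (intro tensor_class_eqI pair_act_biadditive) auto
    also have "\<dots> = tensor_class (pair_act A \<one> y e + pair_act A \<one> z e)"
      by (rule tensor_class_add) (use add in auto)
    also have "\<dots> = tensor_class (pair_act A \<one> (y \<oplus> z) e)"
      using add keys by (intro tensor_class_eqI[symmetric] pair_act_biadditive) auto
    finally show ?case .
  next
    case (mult y z)
    have "tensor_class (pair_act A (y \<otimes> z) \<one> e) = tensor_class (pair_act A y \<one> (pair_act A z \<one> e))"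
      using mult keys by (simp add: pair_act_comp)
    also have "\<dots> = tensor_class (pair_act A y \<one> (pair_act A \<one> z e))"
      using mult by (intro tensor_class_act) auto
    also have "\<dots> = tensor_class (pair_act A \<one> z (pair_act A y \<one> e))"
      using mult keys by (simp add: pair_act_comp)
    also have "\<dots> = tensor_class (pair_act A \<one> z (pair_act A \<one> y e))"
      using mult by (intro tensor_class_act) auto
    also have "\<dots> = tensor_class (pair_act A \<one> (y \<otimes> z) e)"
      using mult keys by (simp add: pair_act_comp)
    finally show ?case .
  qed (use comm_K comm_x in auto)
  then have "separability_element e"
    unfolding separability_element_def using keys mult tensor_class_eqD by blast
  then show ?thesis using separable_ext_iff by blast
qed

end


section \<open>The exact sequences\<close>

context skew_extension
begin

lemma pow_deriv_add: "h \<in> carrier A \<Longrightarrow> h' \<in> carrier A \<Longrightarrow> pow_deriv n (h \<oplus> h') = pow_deriv n h \<oplus> pow_deriv n h'"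
  by (induction n) (simp_all add: l_distr r_distr a_ac)

lemma pow_deriv_center: "w \<in> center A \<Longrightarrow> h \<in> carrier A \<Longrightarrow> pow_deriv n (w \<otimes> h) = w \<otimes> pow_deriv n h"
proof (induction n)
  case 0
  then show ?case unfolding center_def centralizer_def by simp
next
  case (Suc n)
  have w: "w \<in> carrier A" using Suc.prems(1) by (simp add: center_iff)
  have "x \<otimes> (w \<otimes> pow_deriv n h) = w \<otimes> (x \<otimes> pow_deriv n h)"
    using Suc.prems w center_comm[of w x] by (simp add: m_assoc[symmetric])
  then show ?case using Suc w by (simp add: r_distr m_assoc)
qed

lemma tau_add:
  assumes "h \<in> carrier A" "h' \<in> carrier A"
  shows "\<tau> (h \<oplus> h') = \<tau> h \<oplus> \<tau> h'"
proof -
  have "\<tau> (h \<oplus> h') = (\<Oplus>n\<in>{..m}. pow_deriv n h \<otimes> a n \<oplus> pow_deriv n h' \<otimes> a n)"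
    using assms by (simp add: tau_eq_pow_deriv pow_deriv_add l_distr)
  also have "\<dots> = \<tau> h \<oplus> \<tau> h'"
    using assms by (subst finsum_addf) (auto simp: tau_eq_pow_deriv)
  finally show ?thesis .
qed

lemma tau_center:
  assumes w: "w \<in> center A" and h: "h \<in> carrier A"
  shows "\<tau> (w \<otimes> h) = w \<otimes> \<tau> h"
proof -
  have wC: "w \<in> carrier A" using w by (simp add: center_iff)
  have "\<tau> (w \<otimes> h) = (\<Oplus>n\<in>{..m}. w \<otimes> (pow_deriv n h \<otimes> a n))"
    using wC h by (simp add: tau_eq_pow_deriv pow_deriv_center[OF w] m_assoc)
  also have "\<dots> = w \<otimes> \<tau> h"
    unfolding tau_eq_pow_deriv[OF h] using wC h by (intro finsum_rdistr[symmetric]) auto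
  finally show ?thesis .
qed

lemma center_mult_J:
  assumes w: "w \<in> center A" and h: "h \<in> J"
  shows "w \<otimes> h \<in> J"
proof -
  have wC: "w \<in> carrier A" using w by (simp add: center_iff)
  have "k \<otimes> (w \<otimes> h) = w \<otimes> h \<otimes> T k" if k: "k \<in> K" for k
  proof -
    have "k \<otimes> (w \<otimes> h) = w \<otimes> (k \<otimes> h)"
      using k wC h center_comm[OF w, of k] by (simp add: m_assoc[symmetric])
    then show ?thesis using k wC h J_comm[OF h k] by (simp add: m_assoc)
  qed
  moreover have "w \<otimes> h \<in> carrier A" using wC h by simp
  ultimately show ?thesis unfolding J_def by blast
qed

text \<open>If \<open>\<tau>(h) = 1\<close>, then \<open>\<tau>(w h) = w\<close> for every \<open>w \<in> W\<close>, as \<open>w\<close> is central.\<close>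

theorem separable_iff:
  "separable_ext A K \<longleftrightarrow> {h \<in> J. \<tau> h = \<zero>} = ad_x ` V \<and> \<tau> ` J = W"
proof
  assume sep: "separable_ext A K"
  obtain h where h: "h \<in> J" "\<tau> h = \<one>" using separable_imp_tau_one[OF sep] .
  have "w \<in> \<tau> ` J" if w: "w \<in> W" for w
  proof
    have c: "w \<in> center A" using w by (rule W_center)
    show "w \<otimes> h \<in> J" by (rule center_mult_J[OF c h(1)])
    show "w = \<tau> (w \<otimes> h)" using tau_center[OF c, of h] h w by simp
  qed
  then show "{h \<in> J. \<tau> h = \<zero>} = ad_x ` V \<and> \<tau> ` J = W"
    using separable_imp_weakly_separable[OF sep] weakly_separable_iff tau_in_W by blast
next
  assume "{h \<in> J. \<tau> h = \<zero>} = ad_x ` V \<and> \<tau> ` J = W"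
  moreover have "\<one> \<in> W" unfolding W_def V_def centralizer_def by simp
  ultimately have "\<one> \<in> \<tau> ` J" by blast
  then obtain h where "h \<in> J" "\<tau> h = \<one>" by force
  then show "separable_ext A K" by (rule tau_one_imp_separable)
qed

text \<open>Elements of \<open>W\<close> are central, so only left multiplication has to be checked.\<close>

lemma sub_bimoduleI:
  assumes U: "U \<subseteq> carrier A" "\<zero> \<in> U"
    and add: "\<And>h h'. h \<in> U \<Longrightarrow> h' \<in> U \<Longrightarrow> h \<oplus> h' \<in> U"
    and minus: "\<And>h. h \<in> U \<Longrightarrow> \<ominus> h \<in> U"
    and mult: "\<And>w h. w \<in> W \<Longrightarrow> h \<in> U \<Longrightarrow> w \<otimes> h \<in> U"
  shows "sub_bimodule A W U"
proof -
  have "subgroup U (add_monoid A)"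
    by (rule add.subgroupI) (use U add minus in auto)
  moreover have "h \<otimes> w = w \<otimes> h" if "w \<in> W" "h \<in> U" for w h
    using center_comm[OF W_center[OF that(1)]] U that(2) by blast
  ultimately show ?thesis
    unfolding sub_bimodule_def using mult by auto
qed

lemma sub_bimodule_zero: "sub_bimodule A W {\<zero>}"
  by (rule sub_bimoduleI) auto

lemma sub_bimodule_V: "sub_bimodule A W V"
proof (rule sub_bimoduleI)
  fix h h' assume h: "h \<in> V" "h' \<in> V"
  show "h \<oplus> h' \<in> V" "\<ominus> h \<in> V"
    unfolding V_def centralizer_def using V_closed[OF h(1)] V_closed[OF h(2)] V_comm[OF h(1)] V_comm[OF h(2)]
    by (simp_all add: l_distr r_distr l_minus r_minus)
next
  fix w h assume w: "w \<in> W" and h: "h \<in> V"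
  have "k \<otimes> (w \<otimes> h) = w \<otimes> h \<otimes> k" if k: "k \<in> K" for k
  proof -
    have "k \<otimes> (w \<otimes> h) = w \<otimes> (k \<otimes> h)"
      using k w h V_comm[OF W_V[OF w] k] by (simp add: m_assoc[symmetric])
    then show ?thesis using k w h V_comm[OF h k] by (simp add: m_assoc)
  qed
  moreover have "w \<otimes> h \<in> carrier A" using w h by simp
  ultimately show "w \<otimes> h \<in> V" unfolding V_def centralizer_def by blast
next
  show "\<zero> \<in> V" unfolding V_def centralizer_def by simp
  show "V \<subseteq> carrier A" using V_closed by blast
qed

lemma sub_bimodule_J: "sub_bimodule A W J"
proof (rule sub_bimoduleI)
  fix h h' assume h: "h \<in> J" "h' \<in> J"
  show "h \<oplus> h' \<in> J" "\<ominus> h \<in> J"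
    unfolding J_def using J_closed[OF h(1)] J_closed[OF h(2)] J_comm[OF h(1)] J_comm[OF h(2)]
    by (simp_all add: l_distr r_distr l_minus r_minus)
next
  show "\<zero> \<in> J" unfolding J_def by simp
  show "J \<subseteq> carrier A" using J_closed by blast
qed (rule center_mult_J, rule W_center)

lemma sub_bimodule_W: "sub_bimodule A W W"
proof (rule sub_bimoduleI)
  have V: "subgroup V (add_monoid A)" "\<And>w h. w \<in> W \<Longrightarrow> h \<in> V \<Longrightarrow> w \<otimes> h \<in> V"
    using sub_bimodule_V unfolding sub_bimodule_def by blast+
  show "\<zero> \<in> W" unfolding W_def V_def centralizer_def by simp
  show "W \<subseteq> carrier A" using W_closed by blast
  fix h h' assume h: "h \<in> W" "h' \<in> W"
  show "h \<oplus> h' \<in> W"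
    using h subgroup.m_closed[OF V(1)] unfolding W_def by (simp add: T_add)
  have "T (\<ominus> h) \<oplus> h = T (\<ominus> h \<oplus> h)" using h by (simp add: T_add W_T)
  then have "T (\<ominus> h) = \<ominus> h" using h by (intro minus_equality[symmetric]) (simp_all add: l_neg)
  moreover have "\<ominus> h \<in> V" using h subgroup.m_inv_closed[OF V(1), of h] by (simp add: W_V a_inv_def)
  ultimately show "\<ominus> h \<in> W" unfolding W_def by blast
  show "h \<otimes> h' \<in> W" using V(2)[OF h(1) W_V[OF h(2)]] h unfolding W_def by (simp add: T_mult)
qed

lemma sub_bimodule_center: "sub_bimodule A W (center A)"
proof (rule sub_bimoduleI)
  fix h h' assume h: "h \<in> center A" "h' \<in> center A"
  have hC: "h \<in> carrier A" "h' \<in> carrier A" using h by (simp_all add: center_iff)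
  show "h \<oplus> h' \<in> center A" "\<ominus> h \<in> center A"
    unfolding center_def centralizer_def using hC center_comm[OF h(1)] center_comm[OF h(2)]
    by (simp_all add: l_distr r_distr l_minus r_minus)
next
  fix w h assume w: "w \<in> W" and h: "h \<in> center A"
  have hC: "h \<in> carrier A" using h by (simp add: center_iff)
  have "y \<otimes> (w \<otimes> h) = w \<otimes> h \<otimes> y" if y: "y \<in> carrier A" for y
  proof -
    have "y \<otimes> (w \<otimes> h) = w \<otimes> (y \<otimes> h)"
      using y w hC center_comm[OF W_center[OF w] y] by (simp add: m_assoc[symmetric])
    then show ?thesis using y w hC center_comm[OF h y] by (simp add: m_assoc)
  qed
  moreover have "w \<otimes> h \<in> carrier A" using w hC by simp
  ultimately show "w \<otimes> h \<in> center A" unfolding center_def centralizer_def by blast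
next
  show "\<zero> \<in> center A" unfolding center_def centralizer_def by simp
  show "center A \<subseteq> carrier A" unfolding center_def centralizer_def by blast
qed

lemma ad_x_add: "h \<in> carrier A \<Longrightarrow> h' \<in> carrier A \<Longrightarrow> ad_x (h \<oplus> h') = ad_x h \<oplus> ad_x h'"
  unfolding ad_x_def using x_closed by algebra

lemma ad_x_center:
  assumes w: "w \<in> center A" and h: "h \<in> carrier A"
  shows "ad_x (w \<otimes> h) = w \<otimes> ad_x h"
proof -
  have wC: "w \<in> carrier A" using w by (simp add: center_iff)
  have "x \<otimes> (w \<otimes> h) = w \<otimes> (x \<otimes> h)"
    using wC h center_comm[OF w x_closed] by (simp add: m_assoc[symmetric])
  then show ?thesis unfolding ad_x_def using wC h
    by (simp add: a_minus_def r_distr r_minus m_assoc)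
qed

end

text \<open>Exact sequences of bimodules live in a ring record without additional fields.\<close>

locale plain_skew_extension = skew_extension A K T x m a
  for A :: "'r ring" (structure) and K T x m a
begin

text \<open>All modules and maps are well defined, and exactness at \<open>center A\<close> and at \<open>V\<close> always holds;
  what remains is exactness at \<open>J\<close> and, in the longer sequence, at \<open>W\<close>.\<close>

theorem exact_sequence_iff:
  shows "exact_bimodule_seq A W [{\<zero>}, center A, V, J, W] [\<lambda>_. \<zero>, \<lambda>h. h, ad_x, \<tau>] \<longleftrightarrow>
      {h \<in> J. \<tau> h = \<zero>} = ad_x ` V" (is ?one)
    and "exact_bimodule_seq A W [{\<zero>}, center A, V, J, W, {\<zero>}] [\<lambda>_. \<zero>, \<lambda>h. h, ad_x, \<tau>, \<lambda>_. \<zero>] \<longleftrightarrow>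
      {h \<in> J. \<tau> h = \<zero>} = ad_x ` V \<and> \<tau> ` J = W" (is ?two)
proof -
  have hom: "bimodule_hom A W U U' g"
    if "U \<subseteq> carrier A" "U' \<subseteq> carrier A" "\<And>h. h \<in> U \<Longrightarrow> g h \<in> U'"
      "\<And>h h'. h \<in> U \<Longrightarrow> h' \<in> U \<Longrightarrow> g (h \<oplus> h') = g h \<oplus> g h'"
      "\<And>w h. w \<in> W \<Longrightarrow> h \<in> U \<Longrightarrow> g (w \<otimes> h) = w \<otimes> g h" for U U' g
  proof -
    have "g (h \<otimes> w) = g h \<otimes> w" if "w \<in> W" "h \<in> U" for w h
    proof -
      have "h \<in> carrier A" "g h \<in> carrier A" using \<open>h \<in> U\<close> \<open>U \<subseteq> carrier A\<close> \<open>U' \<subseteq> carrier A\<close>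
          \<open>\<And>h. h \<in> U \<Longrightarrow> g h \<in> U'\<close> by blast+
      then show ?thesis using center_comm[OF W_center[OF \<open>w \<in> W\<close>]] \<open>\<And>w h. w \<in> W \<Longrightarrow> h \<in> U \<Longrightarrow> _ = _\<close> that by metis
    qed
    then show ?thesis
      unfolding bimodule_hom_def using that by (auto simp: hom_def add_sub_def)
  qed
  have sub: "sub_bimodule A W {\<zero>}" "sub_bimodule A W (center A)" "sub_bimodule A W V"
    "sub_bimodule A W J" "sub_bimodule A W W"
    by (rule sub_bimodule_zero sub_bimodule_center sub_bimodule_V sub_bimodule_J sub_bimodule_W)+
  have grp: "group (add_sub A U)" if "sub_bimodule A W U" for U
    using that add.subgroup_imp_group unfolding sub_bimodule_def add_sub_def by blast
  have CV: "center A \<subseteq> V" using center_iff by blast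
  have sets: "center A \<subseteq> carrier A" "V \<subseteq> carrier A" "J \<subseteq> carrier A" "W \<subseteq> carrier A"
    using center_iff V_closed J_closed W_closed by blast+
  have homs: "bimodule_hom A W {\<zero>} (center A) (\<lambda>_. \<zero>)"
    "bimodule_hom A W (center A) V (\<lambda>h. h)"
    "bimodule_hom A W V J ad_x" "bimodule_hom A W J W \<tau>"
    "bimodule_hom A W W {\<zero>} (\<lambda>_. \<zero>)"
  proof -
    have z: "\<zero> \<in> center A" using sub(2) subgroup.one_closed unfolding sub_bimodule_def by fastforce
    show "bimodule_hom A W {\<zero>} (center A) (\<lambda>_. \<zero>)"
      by (rule hom) (use sets z in auto)
    show "bimodule_hom A W (center A) V (\<lambda>h. h)"
      by (rule hom) (use sets CV in auto)
    show "bimodule_hom A W V J ad_x"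
      by (rule hom) (use sets ad_x_in_J ad_x_add ad_x_center W_center in auto)
    show "bimodule_hom A W J W \<tau>"
      by (rule hom) (use sets tau_in_W tau_add tau_center W_center in auto)
    show "bimodule_hom A W W {\<zero>} (\<lambda>_. \<zero>)"
      by (rule hom) (use sets in auto)
  qed
  have ghom: "g \<in> hom (add_sub A U) (add_sub A U')" if "bimodule_hom A W U U' g" for U U' g
    using that unfolding bimodule_hom_def by blast
  have ker: "kernel (add_sub A U) (add_sub A U') g = {h \<in> U. g h = \<zero>}" for U U' g
    by (simp add: kernel_def add_sub_def)
  have car: "carrier (add_sub A U) = U" for U by (simp add: add_sub_def)
  have kI: "{h \<in> V. ad_x h = \<zero>} = center A" using center_iff by blast
  have kZ: "{h \<in> center A. h = \<zero>} = {\<zero>}"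
    using sub(2) subgroup.one_closed unfolding sub_bimodule_def by fastforce
  have first: "group_hom (add_sub A {\<zero>}) (add_sub A (center A)) (\<lambda>_. \<zero>)"
    using grp sub ghom homs by (simp add: group_hom_def group_hom_axioms_def)
  show ?one
    unfolding exact_bimodule_seq_def using sub homs first grp ghom
    by (simp add: ker car kI kZ All_less_Suc2)
  show ?two
    unfolding exact_bimodule_seq_def using sub homs first grp ghom
    by (auto simp: ker car kI kZ All_less_Suc2)
qed

end


section \<open>The quotient of the skew polynomial ring\<close>

lemma ring_hom_finsum:
  assumes h: "h \<in> ring_hom R S" and R: "ring R" and S: "ring S" and I: "finite I" "\<And>i. i \<in> I \<Longrightarrow> g i \<in> carrier R"
  shows "h (finsum R g I) = (\<Oplus>\<^bsub>S\<^esub>i\<in>I. h (g i))"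
proof -
  interpret R: ring R by fact
  interpret S: ring S by fact
  show ?thesis
    using I
  proof (induction I rule: finite_induct)
    case empty
    then show ?case using ring_hom_zero[OF h R S] by simp
  next
    case (insert i I)
    then show ?case using h by (simp add: Pi_iff ring_hom_closed ring_hom_add R.finsum_closed)
  qed
qed

lemma ring_hom_nat_pow:
  assumes h: "h \<in> ring_hom R S" and R: "ring R" and S: "ring S" and y: "y \<in> carrier R"
  shows "h (y [^]\<^bsub>R\<^esub> (n::nat)) = h y [^]\<^bsub>S\<^esub> n"
proof -
  interpret R: ring R by fact
  interpret S: ring S by fact
  show ?thesis
    using h y by (induction n) (simp_all add: ring_hom_one ring_hom_mult)
qed

context skew_monic
begin

sublocale ideal: ideal "skew_ideal B \<rho> f" "skew_poly B \<rho>"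
  by (rule ideal_skew_ideal)

abbreviation Q where "Q \<equiv> skew_quot B \<rho> f"
abbreviation cl where "cl p \<equiv> skew_ideal B \<rho> f +>\<^bsub>P\<^esub> p"

sublocale Q: ring "skew_quot B \<rho> f"
  unfolding skew_quot_def by (rule ideal.quotient_is_ring)

lemma cl_hom: "cl \<in> ring_hom P Q"
  unfolding skew_quot_def by (rule ideal.rcos_ring_hom)

lemma cl_closed [simp]: "p \<in> up B \<Longrightarrow> cl p \<in> carrier Q"
  using ring_hom_closed[OF cl_hom] by simp

lemma carrier_Q: "carrier Q = cl ` up B"
  by (auto simp: skew_quot_def FactRing_def A_RCOSETS_def')

lemma cl_eq_iff:
  assumes "p \<in> up B" "q \<in> up B"
  shows "cl p = cl q \<longleftrightarrow> p \<ominus>\<^bsub>P\<^esub> q \<in> skew_ideal B \<rho> f"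
  using P.quotient_eq_iff_same_a_r_cos[OF ideal_skew_ideal] assms by simp

lemma cl_minus: "p \<in> up B \<Longrightarrow> q \<in> up B \<Longrightarrow> p \<ominus>\<^bsub>P\<^esub> q = (\<lambda>n. p n \<ominus> q n)"
proof -
  assume pq: "p \<in> up B" "q \<in> up B"
  have "\<ominus>\<^bsub>P\<^esub> q = (\<lambda>n. \<ominus> q n)"
    using pq up_a_inv_closed[OF pq(2)] by (intro P.minus_equality) (auto simp: l_neg)
  then show ?thesis by (simp add: a_minus_def)
qed

lemma quot_const_eq: "quot_const B \<rho> f b = cl (skew_const B b)"
  by (simp add: quot_const_def)

lemma quot_const_hom: "quot_const B \<rho> f \<in> ring_hom B Q"
  using ring_hom_trans[OF const_hom cl_hom] by (simp add: quot_const_eq[abs_def] o_def)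

lemma skew_X_closed [simp]: "skew_X B \<in> up B"
proof -
  have "skew_X B = skew_monom B 1 \<one>" by (auto simp: skew_X_def skew_monom_def)
  then show ?thesis by simp
qed

lemma skew_const_closed [simp]: "b \<in> carrier B \<Longrightarrow> skew_const B b \<in> up B"
  using ring_hom_closed[OF const_hom] by simp

lemma truncation_closed:
  "(\<And>j. j < n \<Longrightarrow> c j \<in> carrier B) \<Longrightarrow> (\<lambda>j. if j < n then c j else \<zero>) \<in> up B"
  by (intro mem_upI) (auto intro!: exI[of _ n])

lemma finsum_quot_monom:
  assumes "\<And>j. j < n \<Longrightarrow> c j \<in> carrier B"
  shows "(\<Oplus>\<^bsub>Q\<^esub>j\<in>{..<n}. quot_x B \<rho> f [^]\<^bsub>Q\<^esub> j \<otimes>\<^bsub>Q\<^esub> quot_const B \<rho> f (c j)) =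
    cl (\<lambda>j. if j < n then c j else \<zero>)"
proof -
  have X: "skew_X B [^]\<^bsub>P\<^esub> j \<in> carrier P" for j :: nat by (rule P.nat_pow_closed) simp
  have fm: "(\<Oplus>\<^bsub>P\<^esub>j\<in>{..<n}. skew_X B [^]\<^bsub>P\<^esub> j \<otimes>\<^bsub>P\<^esub> skew_const B (c j)) =
      (\<lambda>j. if j < n then c j else \<zero>)"
    using assms by (rule finsum_monom)
  have "cl (\<lambda>j. if j < n then c j else \<zero>) =
    (\<Oplus>\<^bsub>Q\<^esub>j\<in>{..<n}. cl (skew_X B [^]\<^bsub>P\<^esub> j \<otimes>\<^bsub>P\<^esub> skew_const B (c j)))"
    unfolding fm[symmetric]
  proof (rule ring_hom_finsum[OF cl_hom P.ring_axioms Q.ring_axioms])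
    fix j assume "j \<in> {..<n}"
    then have "skew_const B (c j) \<in> carrier P" using assms by simp
    then show "skew_X B [^]\<^bsub>P\<^esub> j \<otimes>\<^bsub>P\<^esub> skew_const B (c j) \<in> carrier P"
      by (rule P.m_closed[OF X])
  qed simp
  also have "\<dots> = (\<Oplus>\<^bsub>Q\<^esub>j\<in>{..<n}. quot_x B \<rho> f [^]\<^bsub>Q\<^esub> j \<otimes>\<^bsub>Q\<^esub> quot_const B \<rho> f (c j))"
  proof (rule Q.finsum_cong')
    fix j assume j: "j \<in> {..<n}"
    then have c: "skew_const B (c j) \<in> carrier P" using assms by simp
    show "cl (skew_X B [^]\<^bsub>P\<^esub> j \<otimes>\<^bsub>P\<^esub> skew_const B (c j)) =
      quot_x B \<rho> f [^]\<^bsub>Q\<^esub> j \<otimes>\<^bsub>Q\<^esub> quot_const B \<rho> f (c j)"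
      unfolding ring_hom_mult[OF cl_hom X c] quot_x_def quot_const_eq
      by (subst ring_hom_nat_pow[OF cl_hom P.ring_axioms Q.ring_axioms]) auto
  next
    show "(\<lambda>j. quot_x B \<rho> f [^]\<^bsub>Q\<^esub> j \<otimes>\<^bsub>Q\<^esub> quot_const B \<rho> f (c j)) \<in> {..<n} \<rightarrow> carrier Q"
      using assms by (auto simp: quot_x_def quot_const_eq intro!: Q.m_closed Q.nat_pow_closed)
  qed simp
  finally show ?thesis ..
qed

lemma quot_comb_eq:
  "(\<And>j. j < m \<Longrightarrow> c j \<in> carrier B) \<Longrightarrow> quot_comb B \<rho> f m c = cl (\<lambda>j. if j < m then c j else \<zero>)"
  unfolding quot_comb_def by (rule finsum_quot_monom)

lemma cl_remainder:
  assumes "p \<in> up B"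
  obtains r where "r \<in> up B" "\<And>n. n \<ge> m \<Longrightarrow> r n = \<zero>" "p \<ominus>\<^bsub>P\<^esub> r \<in> skew_ideal B \<rho> f" "cl p = cl r"
proof -
  obtain q r where qr: "q \<in> up B" "r \<in> up B" "p = f \<otimes>\<^bsub>P\<^esub> q \<oplus>\<^bsub>P\<^esub> r" "\<And>n. n \<ge> m \<Longrightarrow> r n = \<zero>"
    using division[OF assms] by blast
  have fq: "f \<otimes>\<^bsub>P\<^esub> q \<in> carrier P" using qr by (intro P.m_closed) auto
  have "p \<ominus>\<^bsub>P\<^esub> r = f \<otimes>\<^bsub>P\<^esub> q"
    unfolding qr(3) using fq qr(2)[folded skew_poly_simps(1)[of B \<rho>]]
    by (simp add: a_minus_def P.a_assoc P.r_neg del: skew_poly_simps)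
  then have d: "p \<ominus>\<^bsub>P\<^esub> r \<in> skew_ideal B \<rho> f" using qr(1) skew_ideal_iff by blast
  then have "cl p = cl r" using cl_eq_iff[OF assms qr(2)] by simp
  from qr(2) qr(4) d this show thesis by (rule that)
qed

text \<open>Two remainders with the same class differ by a multiple of \<open>f\<close> of degree less than \<open>m\<close>.\<close>

lemma cl_low_degree_inj:
  assumes "r \<in> up B" "r' \<in> up B" "\<And>n. n \<ge> m \<Longrightarrow> r n = \<zero>" "\<And>n. n \<ge> m \<Longrightarrow> r' n = \<zero>" "cl r = cl r'"
  shows "r = r'"
proof -
  obtain q where q: "q \<in> up B" "r \<ominus>\<^bsub>P\<^esub> r' = f \<otimes>\<^bsub>P\<^esub> q"
    using cl_eq_iff[OF assms(1,2)] assms(5) skew_ideal_iff by auto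
  have "(f \<otimes>\<^bsub>P\<^esub> q) n = \<zero>" if "n \<ge> m" for n
    unfolding q(2)[symmetric] cl_minus[OF assms(1,2)] using assms that by (simp add: a_minus_def)
  then have "q = \<zero>\<^bsub>P\<^esub>" using low_degree_multiple q(1) by blast
  then have "r \<ominus>\<^bsub>P\<^esub> r' = \<zero>\<^bsub>P\<^esub>" unfolding q(2) using P.r_null[of f] by simp
  then show ?thesis by (rule P.minus_eq_zeroD) (use assms in auto)
qed

lemma quot_coords_cl:
  assumes r: "r \<in> up B" "\<And>n. n \<ge> m \<Longrightarrow> r n = \<zero>"
  shows "quot_coords B \<rho> f m (cl r) = restrict r {..<m}"
  unfolding quot_coords_def
proof (rule the_equality)
  have "(\<lambda>j. if j < m then restrict r {..<m} j else \<zero>) = r" using r by auto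
  then show "restrict r {..<m} \<in> {..<m} \<rightarrow>\<^sub>E carrier B \<and> quot_comb B \<rho> f m (restrict r {..<m}) = cl r"
    using r by (subst quot_comb_eq) auto
next
  fix c assume c: "c \<in> {..<m} \<rightarrow>\<^sub>E carrier B \<and> quot_comb B \<rho> f m c = cl r"
  then have cB: "\<And>j. j < m \<Longrightarrow> c j \<in> carrier B" by auto
  have eq: "(\<lambda>j. if j < m then c j else \<zero>) = r"
    using c cB r by (intro cl_low_degree_inj) (auto simp: quot_comb_eq truncation_closed)
  have "c j = r j" if "j < m" for j using fun_cong[OF eq, of j] that by simp
  moreover have "c j = undefined" if "\<not> j < m" for j using c that by (auto simp: PiE_def extensional_def)
  ultimately show "c = restrict r {..<m}" by (auto simp: restrict_def)
qed

abbreviation rt where "rt \<equiv> rho_tilde B \<rho> f m"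

text \<open>The definition through coordinates agrees with the map induced by \<open>\<rho>\<close> on coefficients,
  because that map fixes \<open>f\<close> and therefore preserves the ideal. In particular it is
  multiplicative.\<close>

lemma rho_tilde_cl:
  assumes p: "p \<in> up B"
  shows "rt (cl p) = cl (\<rho> \<circ> p)"
proof -
  obtain r where r: "r \<in> up B" "\<And>n. n \<ge> m \<Longrightarrow> r n = \<zero>" "p \<ominus>\<^bsub>P\<^esub> r \<in> skew_ideal B \<rho> f" "cl p = cl r"
    using cl_remainder[OF p] by blast
  have coords: "quot_coords B \<rho> f m (cl r) = restrict r {..<m}"
    using r(1,2) by (rule quot_coords_cl)
  have "(\<lambda>j. if j < m then \<rho> (restrict r {..<m} j) else \<zero>) = \<rho> \<circ> r" using r by auto
  moreover have "rt (cl p) = cl (\<lambda>j. if j < m then \<rho> (restrict r {..<m} j) else \<zero>)"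
    unfolding rho_tilde_def r(4) coords using r(1) by (intro quot_comb_eq) auto
  ultimately have "rt (cl p) = cl (\<rho> \<circ> r)" by simp
  moreover have "cl (\<rho> \<circ> p) = cl (\<rho> \<circ> r)"
  proof -
    obtain q where q: "q \<in> up B" "p \<ominus>\<^bsub>P\<^esub> r = f \<otimes>\<^bsub>P\<^esub> q" using r(3) skew_ideal_iff by blast
    have pr: "p = f \<otimes>\<^bsub>P\<^esub> q \<oplus>\<^bsub>P\<^esub> r"
      unfolding q(2)[symmetric] cl_minus[OF p r(1)] using p r(1) by (auto simp: a_minus_def a_assoc l_neg)
    have fq: "f \<otimes>\<^bsub>P\<^esub> q \<in> carrier P" using q by (intro P.m_closed) auto
    have "\<rho> \<circ> p = (\<rho> \<circ> (f \<otimes>\<^bsub>P\<^esub> q)) \<oplus>\<^bsub>P\<^esub> (\<rho> \<circ> r)"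
      unfolding pr using ring_hom_add[OF map_rho_hom fq, of r] r(1) by simp
    also have "\<rho> \<circ> (f \<otimes>\<^bsub>P\<^esub> q) = (\<rho> \<circ> f) \<otimes>\<^bsub>P\<^esub> (\<rho> \<circ> q)"
      using ring_hom_mult[OF map_rho_hom, of f q] q by simp
    also have "\<rho> \<circ> f = f" by auto
    finally have eq: "\<rho> \<circ> p = f \<otimes>\<^bsub>P\<^esub> (\<rho> \<circ> q) \<oplus>\<^bsub>P\<^esub> (\<rho> \<circ> r)" .
    have fq': "f \<otimes>\<^bsub>P\<^esub> (\<rho> \<circ> q) \<in> carrier P" using q by (intro P.m_closed) auto
    have rr: "\<rho> \<circ> r \<in> carrier P" using r(1) by simp
    have "(\<rho> \<circ> p) \<ominus>\<^bsub>P\<^esub> (\<rho> \<circ> r) = f \<otimes>\<^bsub>P\<^esub> (\<rho> \<circ> q)"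
      unfolding eq using fq' rr by (simp add: a_minus_def P.a_assoc P.r_neg del: skew_poly_simps)
    then have "(\<rho> \<circ> p) \<ominus>\<^bsub>P\<^esub> (\<rho> \<circ> r) \<in> skew_ideal B \<rho> f"
      using q skew_ideal_iff map_rho_closed by blast
    then show ?thesis using p r(1) cl_eq_iff by simp
  qed
  ultimately show ?thesis by simp
qed

lemma rho_tilde_hom: "rt \<in> ring_hom Q Q"
proof (rule ring_hom_memI)
  fix y assume "y \<in> carrier Q"
  then show "rt y \<in> carrier Q" by (auto simp: carrier_Q rho_tilde_cl)
next
  fix y z assume "y \<in> carrier Q" "z \<in> carrier Q"
  then obtain p q where pq: "p \<in> carrier P" "q \<in> carrier P" "y = cl p" "z = cl q" by (auto simp: carrier_Q)
  have "\<rho> \<circ> p \<in> carrier P" "\<rho> \<circ> q \<in> carrier P" using pq by simp_all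
  note h = ring_hom_mult[OF cl_hom] ring_hom_add[OF cl_hom]
  have "p \<otimes>\<^bsub>P\<^esub> q \<in> carrier P" "p \<oplus>\<^bsub>P\<^esub> q \<in> carrier P" using pq(1,2) by (rule P.m_closed P.a_closed)+
  then have 1: "rt (cl (p \<otimes>\<^bsub>P\<^esub> q)) = cl (\<rho> \<circ> (p \<otimes>\<^bsub>P\<^esub> q))" "rt (cl (p \<oplus>\<^bsub>P\<^esub> q)) = cl (\<rho> \<circ> (p \<oplus>\<^bsub>P\<^esub> q))"
    by (simp_all only: rho_tilde_cl skew_poly_simps(1))
  have 2: "rt (cl p) = cl (\<rho> \<circ> p)" "rt (cl q) = cl (\<rho> \<circ> q)"
    using pq by (simp_all add: rho_tilde_cl)
  show "rt (y \<otimes>\<^bsub>Q\<^esub> z) = rt y \<otimes>\<^bsub>Q\<^esub> rt z"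
    unfolding pq(3,4) 2 h(1)[OF pq(1,2), symmetric] 1(1) ring_hom_mult[OF map_rho_hom pq(1,2)]
    by (rule h) fact+
  show "rt (y \<oplus>\<^bsub>Q\<^esub> z) = rt y \<oplus>\<^bsub>Q\<^esub> rt z"
    unfolding pq(3,4) 2 h(2)[OF pq(1,2), symmetric] 1(2) ring_hom_add[OF map_rho_hom pq(1,2)]
    by (rule h) fact+
next
  have "\<one>\<^bsub>Q\<^esub> = cl \<one>\<^bsub>P\<^esub>" using ring_hom_one[OF cl_hom] by simp
  moreover have "\<rho> \<circ> \<one>\<^bsub>P\<^esub> = \<one>\<^bsub>P\<^esub>" by auto
  ultimately show "rt \<one>\<^bsub>Q\<^esub> = \<one>\<^bsub>Q\<^esub>" using rho_tilde_cl[of "\<one>\<^bsub>P\<^esub>"] P.one_closed by simp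
qed

lemma rho_tilde_const: "b \<in> carrier B \<Longrightarrow> rt (quot_const B \<rho> f b) = quot_const B \<rho> f (\<rho> b)"
proof -
  assume b: "b \<in> carrier B"
  have "\<rho> \<circ> skew_const B b = skew_const B (\<rho> b)" by (auto simp: skew_const_def)
  then show ?thesis using b by (simp add: quot_const_eq rho_tilde_cl)
qed

lemma rho_tilde_pow_const: "b \<in> carrier B \<Longrightarrow> (rt ^^ j) (quot_const B \<rho> f b) = quot_const B \<rho> f ((\<rho> ^^ j) b)"
  by (induction j) (simp_all add: rho_tilde_const)

lemma mult_X: "p \<in> up B \<Longrightarrow> p \<otimes>\<^bsub>P\<^esub> skew_X B = skew_X B \<otimes>\<^bsub>P\<^esub> (\<rho> \<circ> p)"
proof
  fix n assume p: "p \<in> up B"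
  have X: "skew_X B = skew_monom B 1 \<one>" by (auto simp: skew_X_def skew_monom_def)
  have "(skew_X B \<otimes>\<^bsub>P\<^esub> (\<rho> \<circ> p)) n = (if 1 \<le> n then \<rho> (p (n - 1)) else \<zero>)"
  proof (cases "1 \<le> n")
    case True
    have "(skew_X B \<otimes>\<^bsub>P\<^esub> (\<rho> \<circ> p)) n = (\<rho> ^^ (n - 1)) (skew_X B 1) \<otimes> (\<rho> \<circ> p) (n - 1)"
      unfolding mult_coeff by (rule finsum_single) (use p True in \<open>auto simp: skew_X_def\<close>)
    then show ?thesis using True p by (simp add: skew_X_def)
  next
    case False
    then have "n = 0" by simp
    then show ?thesis using p by (simp add: mult_coeff skew_X_def)
  qed
  then show "(p \<otimes>\<^bsub>P\<^esub> skew_X B) n = (skew_X B \<otimes>\<^bsub>P\<^esub> (\<rho> \<circ> p)) n"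
    unfolding X using p by (subst mult_monom_coeff) auto
qed

lemma quot_basis:
  assumes y: "y \<in> carrier Q"
  shows "\<exists>!c. c \<in> {..<m} \<rightarrow>\<^sub>E quot_base B \<rho> f \<and>
    (\<Oplus>\<^bsub>Q\<^esub>j\<in>{..<m}. quot_x B \<rho> f [^]\<^bsub>Q\<^esub> j \<otimes>\<^bsub>Q\<^esub> c j) = y"
proof -
  have comb: "(\<Oplus>\<^bsub>Q\<^esub>j\<in>{..<m}. quot_x B \<rho> f [^]\<^bsub>Q\<^esub> j \<otimes>\<^bsub>Q\<^esub> c j) = cl (\<lambda>j. if j < m then b j else \<zero>)"
    if "\<And>j. j < m \<Longrightarrow> b j \<in> carrier B" "\<And>j. j < m \<Longrightarrow> c j = quot_const B \<rho> f (b j)" for b c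
  proof -
    have "(\<Oplus>\<^bsub>Q\<^esub>j\<in>{..<m}. quot_x B \<rho> f [^]\<^bsub>Q\<^esub> j \<otimes>\<^bsub>Q\<^esub> c j) =
        (\<Oplus>\<^bsub>Q\<^esub>j\<in>{..<m}. quot_x B \<rho> f [^]\<^bsub>Q\<^esub> j \<otimes>\<^bsub>Q\<^esub> quot_const B \<rho> f (b j))"
      using that by (intro Q.finsum_cong') (auto simp: quot_x_def quot_const_eq intro!: Q.m_closed Q.nat_pow_closed)
    then show ?thesis using finsum_quot_monom[of m b] that by simp
  qed
  obtain p where "p \<in> up B" "y = cl p" using y by (auto simp: carrier_Q)
  then obtain r where r: "r \<in> up B" "\<And>n. n \<ge> m \<Longrightarrow> r n = \<zero>" "y = cl r"
    using cl_remainder by metis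
  define c0 where "c0 = restrict (\<lambda>j. quot_const B \<rho> f (r j)) {..<m}"
  show ?thesis
  proof (rule ex1I[of _ c0])
    have "(\<lambda>j. if j < m then r j else \<zero>) = r" using r by auto
    then show "c0 \<in> {..<m} \<rightarrow>\<^sub>E quot_base B \<rho> f \<and>
      (\<Oplus>\<^bsub>Q\<^esub>j\<in>{..<m}. quot_x B \<rho> f [^]\<^bsub>Q\<^esub> j \<otimes>\<^bsub>Q\<^esub> c0 j) = y"
      using comb[of r c0] r by (auto simp: c0_def)
  next
    fix c assume c: "c \<in> {..<m} \<rightarrow>\<^sub>E quot_base B \<rho> f \<and>
      (\<Oplus>\<^bsub>Q\<^esub>j\<in>{..<m}. quot_x B \<rho> f [^]\<^bsub>Q\<^esub> j \<otimes>\<^bsub>Q\<^esub> c j) = y"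
    have "\<forall>j. \<exists>b. j < m \<longrightarrow> b \<in> carrier B \<and> c j = quot_const B \<rho> f b"
      using c by (auto simp: PiE_def Pi_def)
    then obtain b where b: "\<And>j. j < m \<Longrightarrow> b j \<in> carrier B" "\<And>j. j < m \<Longrightarrow> c j = quot_const B \<rho> f (b j)"
      by metis
    have eq: "(\<lambda>j. if j < m then b j else \<zero>) = r"
      using c comb[OF b] r b(1) by (intro cl_low_degree_inj) (auto simp: truncation_closed)
    have "b j = r j" if "j < m" for j using fun_cong[OF eq, of j] that by simp
    then have "c j = c0 j" if "j < m" for j using that b by (simp add: c0_def)
    moreover have "c j = undefined" if "\<not> j < m" for j using c that by (auto simp: PiE_def extensional_def)
    ultimately show "c = c0" by (auto simp: c0_def fun_eq_iff)
  qed
qed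

lemma quot_root: "(\<Oplus>\<^bsub>Q\<^esub>j\<in>{..m}. quot_x B \<rho> f [^]\<^bsub>Q\<^esub> j \<otimes>\<^bsub>Q\<^esub> quot_const B \<rho> f (f j)) = \<zero>\<^bsub>Q\<^esub>"
proof -
  have "(\<lambda>j. if j < Suc m then f j else \<zero>) = f" using f_above by auto
  moreover have "(\<Oplus>\<^bsub>Q\<^esub>j\<in>{..m}. quot_x B \<rho> f [^]\<^bsub>Q\<^esub> j \<otimes>\<^bsub>Q\<^esub> quot_const B \<rho> f (f j)) =
      cl (\<lambda>j. if j < Suc m then f j else \<zero>)"
    using finsum_quot_monom[of "Suc m" f] by (simp add: lessThan_Suc_atMost)
  moreover have "f = f \<otimes>\<^bsub>P\<^esub> \<one>\<^bsub>P\<^esub>" using P.r_one[of f] by simp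
  then have "f \<in> skew_ideal B \<rho> f" using skew_ideal_iff P.one_closed skew_poly_simps(1) by metis
  then have "cl f = skew_ideal B \<rho> f" by (rule P.a_rcos_zero[OF ideal_skew_ideal])
  moreover have "\<zero>\<^bsub>Q\<^esub> = skew_ideal B \<rho> f" by (simp add: skew_quot_def FactRing_def)
  ultimately show ?thesis by simp
qed

lemma plain_skew_extension_quot:
  assumes order: "\<And>b. b \<in> carrier B \<Longrightarrow> (\<rho> ^^ m) b = b" and m: "0 < m"
  shows "plain_skew_extension Q (quot_base B \<rho> f) rt (quot_x B \<rho> f) m (\<lambda>j. quot_const B \<rho> f (f j))"
proof -
  have qx: "quot_x B \<rho> f \<in> carrier Q" by (simp add: quot_x_def)
  show ?thesis
  proof (intro plain_skew_extension.intro skew_extension.intro ring_ext.intro ring_ext_axioms.intro skew_extension_axioms.intro)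
    show "ring Q" by (rule Q.ring_axioms)
    show "quot_base B \<rho> f \<subseteq> carrier Q" by (auto simp: quot_const_eq)
    show "subring (quot_base B \<rho> f) Q"
      using ring_hom_ring.img_is_subring[OF ring_hom_ringI2[OF B.ring_axioms Q.ring_axioms quot_const_hom] B.carrier_is_subring] .
    show "rt \<in> ring_hom Q Q" by (rule rho_tilde_hom)
    show "rt k \<in> quot_base B \<rho> f" if "k \<in> quot_base B \<rho> f" for k
      using that by (auto simp: rho_tilde_const)
    have "\<rho> \<circ> skew_X B = skew_X B" by (auto simp: skew_X_def)
    then show "rt (quot_x B \<rho> f) = quot_x B \<rho> f" by (simp add: quot_x_def rho_tilde_cl)
    show "quot_x B \<rho> f \<in> carrier Q" by fact
    show "y \<otimes>\<^bsub>Q\<^esub> quot_x B \<rho> f = quot_x B \<rho> f \<otimes>\<^bsub>Q\<^esub> rt y" if "y \<in> carrier Q" for y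
    proof -
      obtain p where p: "p \<in> up B" "y = cl p" using \<open>y \<in> carrier Q\<close> by (auto simp: carrier_Q)
      show ?thesis
        unfolding p(2) quot_x_def rho_tilde_cl[OF p(1)]
        using ring_hom_mult[OF cl_hom, of p "skew_X B"] ring_hom_mult[OF cl_hom, of "skew_X B" "\<rho> \<circ> p"] p mult_X[OF p(1)]
        by simp
    qed
    show "(rt ^^ m) k = k" if "k \<in> quot_base B \<rho> f" for k
      using that order by (auto simp: rho_tilde_pow_const)
    show "0 < m" by fact
    show "quot_const B \<rho> f (f j) \<in> quot_base B \<rho> f" for j by simp
    show "rt (quot_const B \<rho> f (f j)) = quot_const B \<rho> f (f j)" for j by (simp add: rho_tilde_const)
    show "quot_const B \<rho> f (f m) = \<one>\<^bsub>Q\<^esub>" using ring_hom_one[OF quot_const_hom] by simp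
    show "(\<Oplus>\<^bsub>Q\<^esub>j\<in>{..m}. quot_x B \<rho> f [^]\<^bsub>Q\<^esub> j \<otimes>\<^bsub>Q\<^esub> quot_const B \<rho> f (f j)) = \<zero>\<^bsub>Q\<^esub>"
      by (rule quot_root)
  qed (rule quot_basis)
qed

end


theorem theorem3p4:
  fixes B :: "('a, 'm) ring_scheme" and \<rho> :: "'a \<Rightarrow> 'a" and m :: nat and f :: "nat \<Rightarrow> 'a"
  assumes "ring B"
    and "\<rho> \<in> ring_iso B B"
    and "has_order B \<rho> m"
    and "2 \<le> m"
    and "monic_of_degree B m f"
    and "f \<in> skew_poly_0 B \<rho>"
    and "\<forall>j. f j \<in> fixed_ring B \<rho>"
  shows
    "let A = skew_quot B \<rho> f; C = center A; V = V_cent B \<rho> f; J = J_mod B \<rho> f 1;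
         W = V_fixed B \<rho> f m; Z = {\<zero>\<^bsub>A\<^esub>};
         zero_map = (\<lambda>_. \<zero>\<^bsub>A\<^esub>); inj = (\<lambda>h. h)
     in (weakly_separable_poly B \<rho> f \<longleftrightarrow>
           exact_bimodule_seq A W [Z, C, V, J, W] [zero_map, inj, I_x B \<rho> f, tau B \<rho> f m]) \<and>
        (separable_poly B \<rho> f \<longleftrightarrow>
           exact_bimodule_seq A W [Z, C, V, J, W, Z]
             [zero_map, inj, I_x B \<rho> f, tau B \<rho> f m, zero_map])"
proof -
  interpret skew_monic B \<rho> m f
    using assms
    by (auto simp: skew_monic_def skew_poly_ring_def skew_poly_ring_axioms_def skew_monic_axioms_def ring_iso_def)
  interpret E: plain_skew_extension "skew_quot B \<rho> f" "quot_base B \<rho> f" "rho_tilde B \<rho> f m" "quot_x B \<rho> f" m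
      "\<lambda>j. quot_const B \<rho> f (f j)"
    using assms by (intro plain_skew_extension_quot) (auto simp: has_order_def)
  have V: "V_cent B \<rho> f = E.V" by (simp add: V_cent_def E.V_def)
  have W: "V_fixed B \<rho> f m = E.W" by (simp add: V_fixed_def E.W_def V)
  have J: "J_mod B \<rho> f 1 = E.J"
    unfolding J_mod_def E.J_def by (intro Collect_cong conj_cong refl) (simp add: rho_tilde_const)
  have ad_x: "I_x B \<rho> f = E.ad_x" by (simp add: fun_eq_iff I_x_def E.ad_x_def)
  have tau: "tau B \<rho> f m = E.\<tau>" by (simp add: fun_eq_iff tau_def E.\<tau>_def)
  show ?thesis
    unfolding Let_def V W J ad_x tau weakly_separable_poly_def separable_poly_def
      E.exact_sequence_iff E.weakly_separable_iff E.separable_iff by simp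
qed

end
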